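(* Let $\Omega$ be the pinwheel tiling space, with the action of $O(2)$ about the origin, and let $H_1\cong D_4$ be the 4-element group generated by the reflections about the $x$ axis and about the $y$ axis. The maximal symmetry group of a pinwheel tiling is $H_1$: for every $T\in\Omega$ the stabilizer $\{g\in O(2): gT=T\}$ is conjugate in $O(2)$ to a subgroup of $H_1$. Moreover, there are exactly four tilings $T\in\Omega$ with $hT=T$ for all $h\in H_1$, and each of them is a fixed point of $\sigma^2$, the square of the pinwheel substitution.
   Context: Pinwheel substitution: the only tile, up to congruence (translations, rotations and reflections), is the right triangle with legs $1,2$ and hypotenuse $\sqrt5$. The substitution $\sigma$ dilates a tile by $\sqrt5$ about the origin of $\mathbb{R}^2$ and subdivides the resulting triangle into five triangles congruent to the original tile. Up to congruence the subdivision is the following. The dilated triangle has right-angle vertex $R=(-\tfrac32,-\tfrac12)$ and other vertices $P=(\tfrac12,-\tfrac32)$, $S=(\tfrac12,\tfrac72)$. With $F=(\tfrac12,-\tfrac12)$, $M_1=(\tfrac12,\tfrac32)$, $M_2=(-\tfrac12,\tfrac32)$, $M_3=(-\tfrac12,-\tfrac12)$, the five pieces are the triangles $PFR$, $RM_3M_2$, $M_3FM_2$, $M_1FM_2$, $M_1SM_2$. For any other tile the subdivision is obtained by transporting this picture by the corresponding isometry. $\sigma$ extends to patches and tilings tile by tile. $\Omega$ is the set of all tilings of $\mathbb{R}^2$ by such triangles for which every finite patch is congruent to a subpatch of $\sigma^n(t)$ for some tile $t$ and some $n\ge0$. The group $O(2)$ acts on $\Omega$ by acting on $\mathbb{R}^2$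 about the origin. *)

theory Defs
  imports "HOL-Analysis.Analysis" "HOL-Algebra.Algebra"
begin

subsection \<open>Tiles\<close>

text \<open>Isometries of the plane, orientation-reversing ones included. Distance-preserving self-maps
  of the plane are automatically bijective.\<close>

definition isometry :: "(real^2 \<Rightarrow> real^2) \<Rightarrow> bool" where
  "isometry f \<longleftrightarrow> (\<forall>x y. dist (f x) (f y) = dist x y)"

definition pt :: "real \<Rightarrow> real \<Rightarrow> real^2" where
  "pt a b = vector [a, b]"

definition triangle :: "real^2 \<Rightarrow> real^2 \<Rightarrow> real^2 \<Rightarrow> (real^2) set" where
  "triangle A B C = convex hull {A, B, C}"

text \<open>A tile is a closed region of the plane. The prototile is scalene, so it has no nontrivial
  symmetry, and nothing is lost by not recording the isometry.\<close>

definition tile :: "(real^2) set \<Rightarrow> bool" where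
  "tile t \<longleftrightarrow> (\<exists>f. isometry f \<and> t = f ` triangle (pt 0 0) (pt 1 0) (pt 0 2))"


subsection \<open>The substitution\<close>

context
begin

qualified abbreviation "P \<equiv> pt (1/2) (-3/2)"
qualified abbreviation "R \<equiv> pt (-3/2) (-1/2)"
qualified abbreviation "S \<equiv> pt (1/2) (7/2)"
qualified abbreviation "F \<equiv> pt (1/2) (-1/2)"
qualified abbreviation "M1 \<equiv> pt (1/2) (3/2)"
qualified abbreviation "M2 \<equiv> pt (-1/2) (3/2)"
qualified abbreviation "M3 \<equiv> pt (-1/2) (-1/2)"

definition big_triangle :: "(real^2) set" where
  "big_triangle = triangle R P S"

definition pieces :: "(real^2) set set" where
  "pieces = {triangle P F R, triangle R M3 M2, triangle M3 F M2, triangle M1 F M2, triangle M1 S M2}"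

end

text \<open>For a tile \<open>t\<close> there is exactly one isometry \<open>h\<close> carrying \<open>big_triangle\<close> onto the dilated
  tile (the triangle is scalene), so the comprehension below collects exactly the five pieces
  transported by this \<open>h\<close>.\<close>

definition subdivide :: "(real^2) set \<Rightarrow> (real^2) set set" where
  "subdivide t = {h ` p | h p. isometry h \<and> h ` big_triangle = (\<lambda>x. sqrt 5 *\<^sub>R x) ` t \<and> p \<in> pieces}"

definition pinwheel_subst :: "(real^2) set set \<Rightarrow> (real^2) set set" where
  "pinwheel_subst T = (\<Union>t\<in>T. subdivide t)"


subsection \<open>The tiling space\<close>

definition tiling :: "(real^2) set set \<Rightarrow> bool" where
  "tiling T \<longleftrightarrow> (\<forall>t\<in>T. tile t) \<and> \<Union>T = UNIV \<and>
     (\<forall>s\<in>T. \<forall>t\<in>T. s \<noteq> t \<longrightarrow> interior s \<inter> interior t = {})"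

text \<open>The action of a map of the plane on patches and tilings.\<close>

definition act :: "(real^2 \<Rightarrow> real^2) \<Rightarrow> (real^2) set set \<Rightarrow> (real^2) set set" where
  "act g T = (\<lambda>t. g ` t) ` T"

text \<open>A patch of a tiling is an arbitrary finite subset; since every finite subset of a tiling lies
  in a finite connected one, insisting on connected patches would give the same space.\<close>

definition Omega :: "(real^2) set set set" where
  "Omega = {T. tiling T \<and>
     (\<forall>Q. finite Q \<and> Q \<subseteq> T \<longrightarrow>
        (\<exists>f t n. isometry f \<and> tile t \<and> act f Q \<subseteq> (pinwheel_subst ^^ n) {t}))}"


subsection \<open>The groups\<close>

definition O2 :: "(real^2 \<Rightarrow> real^2) monoid" where
  "O2 = \<lparr>carrier = {g. orthogonal_transformation g}, mult = (\<circ>), one = id\<rparr>"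

definition refl_x :: "real^2 \<Rightarrow> real^2" where
  "refl_x v = pt (v $ 1) (- (v $ 2))"

definition refl_y :: "real^2 \<Rightarrow> real^2" where
  "refl_y v = pt (- (v $ 1)) (v $ 2)"

definition H1 :: "(real^2 \<Rightarrow> real^2) set" where
  "H1 = generate O2 {refl_x, refl_y}"

lemma group_O2: "group O2"
proof (rule groupI)
  fix g assume g: "g \<in> carrier O2"
  then have "inv_into UNIV g \<in> carrier O2" "inv_into UNIV g \<otimes>\<^bsub>O2\<^esub> g = \<one>\<^bsub>O2\<^esub>"
    by (auto simp: O2_def orthogonal_transformation_inv orthogonal_transformation_inj)
  then show "\<exists>h\<in>carrier O2. h \<otimes>\<^bsub>O2\<^esub> g = \<one>\<^bsub>O2\<^esub>" by blast
qed (auto simp: O2_def id_def comp_assoc intro: orthogonal_transformation_compose)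

lemma refl_O2: "refl_x \<in> carrier O2" "refl_y \<in> carrier O2"
  by (auto simp: O2_def refl_x_def refl_y_def pt_def orthogonal_transformation_def
      inner_vec_def sum_2 vec_eq_iff forall_2 intro!: linearI)

lemma refl_comp:
  "refl_x \<circ> refl_x = id" "refl_y \<circ> refl_y = id"
  "refl_x \<circ> refl_y = uminus" "refl_y \<circ> refl_x = uminus"
  by (auto simp: fun_eq_iff refl_x_def refl_y_def pt_def vec_eq_iff forall_2)

lemma H1_eq: "H1 = {id, refl_x, refl_y, uminus}"
proof
  interpret group O2 by (rule group_O2)
  have m: "g \<otimes>\<^bsub>O2\<^esub> h = g \<circ> h" "\<one>\<^bsub>O2\<^esub> = id" for g h by (auto simp: O2_def)
  have i: "inv\<^bsub>O2\<^esub> refl_x = refl_x" "inv\<^bsub>O2\<^esub> refl_y = refl_y"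
    by (intro inv_equality; simp add: m refl_comp refl_O2)+
  have c: "refl_x (refl_x v) = v" "refl_y (refl_y v) = v" "refl_x (refl_y v) = - v"
    "refl_y (refl_x v) = - v" "refl_x (- v) = refl_y v" "refl_y (- v) = refl_x v"
    "- refl_x v = refl_y v" "- refl_y v = refl_x v" for v
    by (auto simp: refl_x_def refl_y_def pt_def vec_eq_iff forall_2)
  show "H1 \<subseteq> {id, refl_x, refl_y, uminus}"
  proof
    fix g assume "g \<in> H1"
    then have "g \<in> generate O2 {refl_x, refl_y}" by (simp add: H1_def)
    then show "g \<in> {id, refl_x, refl_y, uminus}"
      by induction (auto simp: m i c comp_def id_def)
  qed
  have "refl_x \<otimes>\<^bsub>O2\<^esub> refl_y \<in> H1"
    unfolding H1_def by (intro generate.eng generate.incl) auto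
  moreover have "\<one>\<^bsub>O2\<^esub> \<in> H1" "refl_x \<in> H1" "refl_y \<in> H1"
    unfolding H1_def by (auto intro: generate.one generate.incl)
  ultimately show "{id, refl_x, refl_y, uminus} \<subseteq> H1" by (auto simp: m refl_comp)
qed

lemma card_H1: "card H1 = 4"
proof -
  have e: "id (pt 1 2) = pt 1 2" "refl_x (pt 1 2) = pt 1 (-2)" "refl_y (pt 1 2) = pt (-1) 2"
    "- pt 1 2 = pt (-1) (-2)"
    by (auto simp: refl_x_def refl_y_def pt_def vec_eq_iff forall_2)
  have d: "pt a b = pt c d \<longleftrightarrow> a = c \<and> b = d" for a b c d
    by (auto simp: pt_def vec_eq_iff forall_2)
  have "distinct (map (\<lambda>f. f (pt 1 2)) [id, refl_x, refl_y, uminus])" by (simp add: e d del: id_apply)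
  then have "distinct [id, refl_x, refl_y, uminus :: real^2 \<Rightarrow> _]" by (simp only: distinct_map)
  from distinct_card[OF this] show ?thesis by (simp add: H1_eq)
qed

end

theory Submission
  imports Defs
begin

text \<open>Recognizability holds for a purely local reason: if the middle piece of the subdivision of \<open>q\<close> is a
  piece of the subdivision of \<open>s\<close> in the wrong position, then some neighbour prescribed by \<open>q\<close> overlaps,
  without being equal to, a neighbour prescribed by \<open>s\<close>. Hence every \<open>T \<in> \<Omega>\<close> is \<open>\<sigma>(T')\<close> for a unique
  \<open>T' \<in> \<Omega>\<close>, and \<open>T'\<close> has at least the symmetries of \<open>T\<close>.

  If the origin is not a vertex of some tile of \<open>T'\<close> containing it, that tile fills a half disc around the origin. Otherwise
  follow the origin up the hierarchy of a supertile until it lies inside or on an edge of a tile; going down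
  again, one sees a half disc at the origin filled by four tiles of \<open>T\<close>, which belong to a set of eight tiles
  (a star) invariant under a conjugate of \<open>H\<^sub>1\<close>. A symmetry either reverses the normal of the half disc or
  maps one of the tiles filling it to another; in all cases it is an involution, and a group of orthogonal
  involutions of the plane is conjugate to a subgroup of \<open>H\<^sub>1\<close>.

  A tiling with symmetry group \<open>H\<^sub>1\<close> contains a whole star with axes on the coordinate axes. There are four
  such stars. Each is contained in its image under \<open>\<sigma>\<^sup>2\<close>, so by desubstitution the tiling is the
  increasing union of the images of its star. Each of the four occurs: a supertile of order three
  contains a rhombus of four tiles, whose centre carries a star after one more substitution step
  and one of the other kind after two.\<close>

subsection \<open>Right triangles in coordinates\<close>

text \<open>The origin may lie on edges of supertiles of every order, and a supertile with the
  origin on an edge controls only the half disc on its own side. This is enough because an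
  orthogonal map \<open>g\<close> sends a half disc with normal \<open>m\<close> to one with normal
  \<open>g m\<close>, and the two overlap in an open set unless \<open>g m = - m\<close>. The vertex
  is inspected in \<open>T'\<close> rather than in \<open>T\<close> to get rid of right angles: one
  subdivision cuts each of them into an \<open>alpha\<close> and a \<open>beta\<close> corner, and
  all vertex patterns become instances of \<open>fan\<close>. The square of \<sigma> enters through
  acute corners: subdividing one gives the same angle with leg and hypotenuse exchanged, so stars
  come in two kinds that \<sigma> swaps. Two kinds, and two ways of laying the axes of a star on the
  coordinate axes, give the number four.\<close>

definition rtri :: "real^2 \<Rightarrow> real^2 \<Rightarrow> real^2 \<Rightarrow> bool" where
  "rtri a b c \<longleftrightarrow> (b - a) \<bullet> (b - a) = 1 \<and> (c - a) \<bullet> (c - a) = 4 \<and> (b - a) \<bullet> (c - a) = 0"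

definition frame :: "real^2 \<Rightarrow> real^2 \<Rightarrow> bool" where
  "frame e n \<longleftrightarrow> e \<bullet> e = 1 \<and> n \<bullet> n = 1 \<and> e \<bullet> n = 0"

lemma frame_expand:
  assumes "frame e n"
  shows "x = (x \<bullet> e) *\<^sub>R e + (x \<bullet> n) *\<^sub>R n"
proof -
  have 1: "e$1 * e$1 + e$2 * e$2 = 1" "n$1 * n$1 + n$2 * n$2 = 1" "e$1 * n$1 + e$2 * n$2 = 0"
    using assms by (auto simp: frame_def inner_vec_def sum_2)
  have 2: "e$1 * e$1 + n$1 * n$1 = 1" "e$2 * e$2 + n$2 * n$2 = 1" "e$1 * e$2 + n$1 * n$2 = 0"
  proof -
    \<comment> \<open>\<open>d\<close> is the determinant of \<open>e\<close>, \<open>n\<close>: in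
      the plane \<open>n\<close> is \<open>d\<close> times \<open>e\<close> turned by a right angle.
      Hence \<open>d * d = 1\<close>, and orthonormal columns give orthonormal rows.\<close>
    define d where "d = e$1 * n$2 - e$2 * n$1"
    have n1: "n$1 = - d * e$2"
    proof -
      have "n$1 + d * e$2 = n$1 * (e$1 * e$1 + e$2 * e$2) + d * e$2" using 1(1) by simp
      also have "\<dots> = e$1 * (e$1 * n$1 + e$2 * n$2)" by (simp add: d_def algebra_simps)
      finally show ?thesis using 1(3) by simp
    qed
    have n2: "n$2 = d * e$1"
    proof -
      have "n$2 - d * e$1 = n$2 * (e$1 * e$1 + e$2 * e$2) - d * e$1" using 1(1) by simp
      also have "\<dots> = e$2 * (e$1 * n$1 + e$2 * n$2)" by (simp add: d_def algebra_simps)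
      finally show ?thesis using 1(3) by simp
    qed
    have "d * d * (e$1 * e$1 + e$2 * e$2) = n$1 * n$1 + n$2 * n$2"
      by (simp add: n1 n2 algebra_simps)
    then have d: "d * d = 1" using 1 by simp
    have "n$1 * n$1 = d * d * (e$2 * e$2)" "n$2 * n$2 = d * d * (e$1 * e$1)"
      "n$1 * n$2 = - (d * d * (e$1 * e$2))"
      by (simp_all add: n1 n2)
    then show "e$1 * e$1 + n$1 * n$1 = 1" "e$2 * e$2 + n$2 * n$2 = 1" "e$1 * e$2 + n$1 * n$2 = 0"
      using 1(1) d by simp_all
  qed
  have "(x$1 * e$1 + x$2 * e$2) * e$1 + (x$1 * n$1 + x$2 * n$2) * n$1
      = x$1 * (e$1 * e$1 + n$1 * n$1) + x$2 * (e$1 * e$2 + n$1 * n$2)"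
    "(x$1 * e$1 + x$2 * e$2) * e$2 + (x$1 * n$1 + x$2 * n$2) * n$2
      = x$1 * (e$1 * e$2 + n$1 * n$2) + x$2 * (e$2 * e$2 + n$2 * n$2)"
    by (simp_all add: algebra_simps)
  with 2 have "x$1 = (x$1 * e$1 + x$2 * e$2) * e$1 + (x$1 * n$1 + x$2 * n$2) * n$1"
    "x$2 = (x$1 * e$1 + x$2 * e$2) * e$2 + (x$1 * n$1 + x$2 * n$2) * n$2"
    by simp_all
  then show ?thesis by (simp add: vec_eq_iff forall_2 inner_vec_def sum_2)
qed

lemma rtri_frame: "rtri a b c \<Longrightarrow> frame (b - a) ((1/2) *\<^sub>R (c - a))"
  by (auto simp: rtri_def frame_def)

lemma frame_rtri: "frame e n \<Longrightarrow> rtri a (a + e) (a + 2 *\<^sub>R n)"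
  by (auto simp: rtri_def frame_def)

lemma rtri_coord:
  assumes "rtri a b c"
  shows "x = a + ((x - a) \<bullet> (b - a)) *\<^sub>R (b - a) + ((x - a) \<bullet> (c - a) / 4) *\<^sub>R (c - a)"
proof -
  have "x - a = ((x - a) \<bullet> (b - a)) *\<^sub>R (b - a) + ((x - a) \<bullet> (c - a) / 4) *\<^sub>R (c - a)"
    using frame_expand[OF rtri_frame[OF assms], of "x - a"] by simp
  then have "a + (x - a) = a + (((x - a) \<bullet> (b - a)) *\<^sub>R (b - a) + ((x - a) \<bullet> (c - a) / 4) *\<^sub>R (c - a))"
    by (rule arg_cong)
  then show ?thesis by (simp only: add.assoc[symmetric] add_diff_cancel_left' diff_add_cancel add_diff_eq)
qed

lemma rtri_coordE:
  assumes "rtri a b c"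
  obtains s t where "x = a + s *\<^sub>R (b - a) + t *\<^sub>R (c - a)"
  using rtri_coord[OF assms] by blast

lemma rtri_coord_unique:
  assumes "rtri a b c" "a + s *\<^sub>R (b - a) + t *\<^sub>R (c - a) = a + s' *\<^sub>R (b - a) + t' *\<^sub>R (c - a)"
  shows "s = s' \<and> t = t'"
proof -
  have eq: "s *\<^sub>R (b - a) + t *\<^sub>R (c - a) = s' *\<^sub>R (b - a) + t' *\<^sub>R (c - a)"
    using assms(2) by (simp add: add.assoc)
  have "(s *\<^sub>R (b - a) + t *\<^sub>R (c - a)) \<bullet> (b - a) = s"
    "(s' *\<^sub>R (b - a) + t' *\<^sub>R (c - a)) \<bullet> (b - a) = s'"
    "(s *\<^sub>R (b - a) + t *\<^sub>R (c - a)) \<bullet> (c - a) = 4 * t"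
    "(s' *\<^sub>R (b - a) + t' *\<^sub>R (c - a)) \<bullet> (c - a) = 4 * t'"
    using assms(1) by (auto simp: rtri_def inner_add_left inner_commute[of "c - a" "b - a"])
  with eq show ?thesis by auto
qed

lemma rtri_not_collinear:
  assumes "rtri a b c" shows "\<not> collinear {a, b, c}"
proof
  assume "collinear {a, b, c}"
  then have "collinear {0, b - a, c - a}"
    using collinear_3[of b a c] by (simp add: insert_commute)
  then have "\<bar>(b - a) \<bullet> (c - a)\<bar> = norm (b - a) * norm (c - a)"
    by (simp add: norm_cauchy_schwarz_equal)
  then show False
    using assms by (auto simp: rtri_def)
qed

lemma triangle_iff:
  "x \<in> triangle a b c \<longleftrightarrow>
    (\<exists>s t. 0 \<le> s \<and> 0 \<le> t \<and> s + t \<le> 1 \<and> x = a + s *\<^sub>R (b - a) + t *\<^sub>R (c - a))"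
  by (auto simp: triangle_def convex_hull_3_alt)

lemma interior_triangle_iff:
  assumes "rtri a b c"
  shows "x \<in> interior (triangle a b c) \<longleftrightarrow>
    (\<exists>s t. 0 < s \<and> 0 < t \<and> s + t < 1 \<and> x = a + s *\<^sub>R (b - a) + t *\<^sub>R (c - a))"
proof -
  have "x \<in> interior (triangle a b c) \<longleftrightarrow>
     (\<exists>r s t. 0 < r \<and> 0 < s \<and> 0 < t \<and> r + s + t = 1 \<and> r *\<^sub>R a + s *\<^sub>R b + t *\<^sub>R c = x)"
    using interior_convex_hull_3_minimal[OF rtri_not_collinear[OF assms]] by (auto simp: triangle_def)
  also have "\<dots> \<longleftrightarrow> (\<exists>s t. 0 < s \<and> 0 < t \<and> s + t < 1 \<and> x = a + s *\<^sub>R (b - a) + t *\<^sub>R (c - a))"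
  proof safe
    fix r s t :: real assume *: "0 < r" "0 < s" "0 < t" "r + s + t = 1"
    then have "r = 1 - s - t" by simp
    then have "r *\<^sub>R a + s *\<^sub>R b + t *\<^sub>R c = a + s *\<^sub>R (b - a) + t *\<^sub>R (c - a)"
      by (simp add: scaleR_diff_left scaleR_diff_right)
    then show "\<exists>s' t'. 0 < s' \<and> 0 < t' \<and> s' + t' < 1 \<and>
       r *\<^sub>R a + s *\<^sub>R b + t *\<^sub>R c = a + s' *\<^sub>R (b - a) + t' *\<^sub>R (c - a)"
      using * by (intro exI[of _ s] exI[of _ t]) auto
  next
    fix s t :: real assume *: "0 < s" "0 < t" "s + t < 1"
    have "(1 - s - t) *\<^sub>R a + s *\<^sub>R b + t *\<^sub>R c = a + s *\<^sub>R (b - a) + t *\<^sub>R (c - a)"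
      by (simp add: algebra_simps)
    then show "\<exists>r' s' t'. 0 < r' \<and> 0 < s' \<and> 0 < t' \<and> r' + s' + t' = 1 \<and>
       r' *\<^sub>R a + s' *\<^sub>R b + t' *\<^sub>R c = a + s *\<^sub>R (b - a) + t *\<^sub>R (c - a)"
      using * by (intro exI[of _ "1 - s - t"] exI[of _ s] exI[of _ t]) auto
  qed
  finally show ?thesis .
qed

lemma extreme_triangle:
  assumes "rtri a b c"
  shows "x extreme_point_of triangle a b c \<longleftrightarrow> x \<in> {a, b, c}"
proof -
  have "\<not> affine_dependent {a, b, c}"
    using rtri_not_collinear[OF assms] affine_dependent_imp_collinear_3 by blast
  then show ?thesis
    unfolding triangle_def by (rule extreme_point_of_convex_hull_affine_independent)
qed

lemma rtri_dist:
  assumes "rtri a b c" shows "dist a b = 1" "dist a c = 2" "dist b c = sqrt 5"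
proof -
  have "(c - b) \<bullet> (c - b) = 5"
  proof -
    have "(c - b) \<bullet> (c - b) = (c - a) \<bullet> (c - a) - 2 * ((b - a) \<bullet> (c - a)) + (b - a) \<bullet> (b - a)"
      by (simp add: inner_diff_left inner_diff_right inner_commute)
    then show ?thesis using assms by (simp add: rtri_def)
  qed
  then show "dist b c = sqrt 5"
    by (subst dist_commute) (simp add: dist_norm norm_eq_sqrt_inner)
  have "dist b a = 1" "dist c a = 2"
    using assms real_sqrt_abs[of 2] by (auto simp: dist_norm norm_eq_sqrt_inner rtri_def)
  then show "dist a b = 1" "dist a c = 2" by (simp_all add: dist_commute)
qed

text \<open>The vertices are the extreme points of the set, and their mutual distances 1, 2,
  \<open>sqrt 5\<close> are distinct, so each vertex is recognized by its distances. Thus a tile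
  kept as a bare set of points still has well-defined labelled vertices.\<close>

lemma triangle_inj:
  assumes "rtri a b c" "rtri a' b' c'" "triangle a b c = triangle a' b' c'"
  shows "a = a'" "b = b'" "c = c'"
proof -
  have s: "{a, b, c} = {a', b', c'}"
    using extreme_triangle[OF assms(1)] extreme_triangle[OF assms(2)] assms(3) by auto
  note d = rtri_dist[OF assms(1)] rtri_dist[OF assms(2)]
  have q: "sqrt 5 \<noteq> 1" "sqrt 5 \<noteq> 2" "sqrt 5 \<noteq> 0"
    using real_sqrt_eq_iff[of 5 4] by auto
  have m: "a \<in> {a', b', c'}" "b \<in> {a', b', c'}" "c \<in> {a', b', c'}" using s by blast+
  have 5: "x = b' \<and> y = c' \<or> x = c' \<and> y = b'"
    if "x \<in> {a', b', c'}" "y \<in> {a', b', c'}" "dist x y = sqrt 5" for x y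
    using that d(4-6) q by (elim insertE emptyE; simp add: dist_commute)
  have 2: "x = a' \<and> y = c' \<or> x = c' \<and> y = a'"
    if "x \<in> {a', b', c'}" "y \<in> {a', b', c'}" "dist x y = 2" for x y
    using that d(4-6) q by (elim insertE emptyE; simp add: dist_commute)
  have ne: "a' \<noteq> b'" using d(4) by auto
  show "a = a'" "b = b'" "c = c'"
    using 5[OF m(2,3) d(3)] 2[OF m(1,3) d(2)] ne by blast+
qed

subsection \<open>Tiles and their subdivision\<close>

lemma isometry_linear_part:
  assumes "isometry f" shows "orthogonal_transformation (\<lambda>x. f x - f 0)"
  using assms by (simp add: orthogonal_transformation_isometry isometry_def dist_norm)

lemma isometry_affine:
  assumes "isometry f"
  shows "f (a + s *\<^sub>R (b - a) + t *\<^sub>R (c - a)) = f a + s *\<^sub>R (f b - f a) + t *\<^sub>R (f c - f a)"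
proof -
  define L where "L x = f x - f 0" for x
  have "linear L"
    using isometry_linear_part[OF assms] by (simp add: L_def[abs_def] orthogonal_transformation_def)
  then have "L (a + s *\<^sub>R (b - a) + t *\<^sub>R (c - a)) = L a + s *\<^sub>R (L b - L a) + t *\<^sub>R (L c - L a)"
    by (simp add: linear_add linear_diff linear_scale)
  then show ?thesis by (simp add: L_def algebra_simps)
qed

lemma isometry_inner:
  assumes "isometry f"
  shows "(f x - f z) \<bullet> (f y - f z) = (x - z) \<bullet> (y - z)"
proof -
  define L where "L x = f x - f 0" for x
  have L: "orthogonal_transformation L"
    using isometry_linear_part[OF assms] by (simp add: L_def[abs_def])
  have "f x - f z = L (x - z)" for x z
    using L by (simp add: orthogonal_transformation_def linear_diff) (simp add: L_def)
  then show ?thesis using L by (simp add: orthogonal_transformation_def)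
qed

lemma isometry_rtri: "isometry f \<Longrightarrow> rtri (f a) (f b) (f c) \<longleftrightarrow> rtri a b c"
  by (simp add: rtri_def isometry_inner)

lemma isometry_triangle:
  assumes "isometry f" shows "f ` triangle a b c = triangle (f a) (f b) (f c)"
proof -
  have "y \<in> f ` triangle a b c \<longleftrightarrow> y \<in> triangle (f a) (f b) (f c)" for y
    unfolding triangle_iff image_iff Bex_def isometry_affine[OF assms, symmetric] by blast
  then show ?thesis by blast
qed

lemma isometry_inj: "isometry f \<Longrightarrow> inj f"
  unfolding isometry_def inj_def by (metis dist_eq_0_iff)

lemma isometry_bij: "isometry f \<Longrightarrow> bij f"
proof -
  assume f: "isometry f"
  have "surj (\<lambda>x. f x - f 0)"
    using isometry_linear_part[OF f] orthogonal_transformation_surj by blast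
  have "\<exists>x. y = f x" for y
  proof -
    obtain x where "y - f 0 = f x - f 0"
      using surjD[OF \<open>surj _\<close>, of "y - f 0"] by blast
    then show ?thesis by (intro exI[of _ x]) simp
  qed
  then show "bij f" using isometry_inj[OF f] by (auto simp: bij_def surj_def)
qed

lemma isometry_comp: "isometry f \<Longrightarrow> isometry g \<Longrightarrow> isometry (f \<circ> g)"
  by (simp add: isometry_def)

lemma isometry_inv: "isometry f \<Longrightarrow> isometry (inv_into UNIV f)"
proof -
  assume f: "isometry f"
  have "dist (inv_into UNIV f x) (inv_into UNIV f y)
     = dist (f (inv_into UNIV f x)) (f (inv_into UNIV f y))" for x y
    using f by (simp add: isometry_def)
  then show ?thesis
    using isometry_bij[OF f] by (simp add: isometry_def bij_is_surj surj_f_inv_f)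
qed

lemma isometry_orth: "orthogonal_transformation f \<Longrightarrow> isometry f"
  by (simp add: isometry_def orthogonal_transformation_isometry)

lemma isometry_interior:
  assumes "isometry f" shows "interior (f ` S) = f ` interior S"
proof -
  define L where "L x = f x - f 0" for x
  have L: "orthogonal_transformation L"
    using isometry_linear_part[OF assms] by (simp add: L_def[abs_def])
  have i: "f ` A = (+) (f 0) ` (L ` A)" for A
    by (auto simp: L_def image_image)
  show ?thesis
    unfolding i interior_translation
    by (subst interior_injective_linear_image)
       (use L in \<open>auto simp: orthogonal_transformation_def orthogonal_transformation_inj\<close>)
qed

lemma isometry_rescale:
  assumes "isometry f" "r \<noteq> 0"
  shows "isometry (\<lambda>x. r *\<^sub>R f ((1 / r) *\<^sub>R x))"
proof -
  have "dist (r *\<^sub>R f ((1 / r) *\<^sub>R x)) (r *\<^sub>R f ((1 / r) *\<^sub>R y)) = \<bar>r\<bar> * dist (f ((1 / r) *\<^sub>R x)) (f ((1 / r) *\<^sub>R y))" for x y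
    by (simp add: dist_norm flip: scaleR_diff_right)
  moreover have "dist ((1 / r) *\<^sub>R x) ((1 / r) *\<^sub>R y) = dist x y / \<bar>r\<bar>" for x y :: "real^2"
    by (simp add: dist_norm flip: scaleR_diff_right)
  ultimately show ?thesis using assms by (simp add: isometry_def)
qed

lemma pt_nth [simp]: "pt a b $ 1 = a" "pt a b $ 2 = b"
  by (simp_all add: pt_def)

lemma isometry_to_frame:
  assumes "frame e n"
  shows "isometry (\<lambda>x :: real^2. a + (x $ 1) *\<^sub>R e + (x $ 2) *\<^sub>R n)"
proof -
  have "dist (a + (x $ 1) *\<^sub>R e + (x $ 2) *\<^sub>R n) (a + (y $ 1) *\<^sub>R e + (y $ 2) *\<^sub>R n) = dist x y" for x y :: "real^2"
  proof -
    have "(a + (x $ 1) *\<^sub>R e + (x $ 2) *\<^sub>R n) - (a + (y $ 1) *\<^sub>R e + (y $ 2) *\<^sub>R n)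
       = (x$1 - y$1) *\<^sub>R e + (x$2 - y$2) *\<^sub>R n" by (simp add: algebra_simps)
    moreover have "((x$1 - y$1) *\<^sub>R e + (x$2 - y$2) *\<^sub>R n) \<bullet> ((x$1 - y$1) *\<^sub>R e + (x$2 - y$2) *\<^sub>R n)
      = (x - y) \<bullet> (x - y)"
    proof -
      have "(s *\<^sub>R e + t *\<^sub>R n) \<bullet> (s *\<^sub>R e + t *\<^sub>R n) = s * s + t * t" for s t
        using assms by (simp add: frame_def inner_add_left inner_add_right inner_commute[of n e])
      moreover have "(x - y) \<bullet> (x - y) = (x$1 - y$1) * (x$1 - y$1) + (x$2 - y$2) * (x$2 - y$2)"
        by (simp add: inner_vec_def sum_2)
      ultimately show ?thesis by simp
    qed
    ultimately show ?thesis by (simp only: dist_norm norm_eq_sqrt_inner)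
  qed
  then show ?thesis by (simp add: isometry_def)
qed

lemma tile_iff: "tile t \<longleftrightarrow> (\<exists>a b c. rtri a b c \<and> t = triangle a b c)"
proof
  have "rtri (pt 0 0) (pt 1 0) (pt 0 2)"
    by (simp add: rtri_def inner_vec_def sum_2)
  moreover assume "tile t"
  ultimately show "\<exists>a b c. rtri a b c \<and> t = triangle a b c"
    unfolding tile_def using isometry_rtri isometry_triangle by blast
next
  assume "\<exists>a b c. rtri a b c \<and> t = triangle a b c"
  then obtain a b c where abc: "rtri a b c" "t = triangle a b c" by blast
  define f where "f x = a + (x $ 1) *\<^sub>R (b - a) + (x $ 2) *\<^sub>R ((1/2) *\<^sub>R (c - a))" for x :: "real^2"
  have "isometry f" unfolding f_def by (rule isometry_to_frame[OF rtri_frame[OF abc(1)]])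
  moreover have "f (pt 0 0) = a" "f (pt 1 0) = b" "f (pt 0 2) = c" by (simp_all add: f_def)
  ultimately have "isometry f \<and> t = f ` triangle (pt 0 0) (pt 1 0) (pt 0 2)"
    by (simp add: abc(2) isometry_triangle)
  then show "tile t" unfolding tile_def by blast
qed

lemma tile_triangle: "rtri a b c \<Longrightarrow> tile (triangle a b c)"
  by (auto simp: tile_iff)

lemma tileE:
  assumes "tile t" obtains a b c where "rtri a b c" "t = triangle a b c"
  using assms tile_iff by auto

lemma tile_image: "isometry f \<Longrightarrow> tile (f ` t) \<longleftrightarrow> tile t"
proof
  show "tile (f ` t)" if "isometry f" "tile t" for f t
    using that unfolding tile_iff using isometry_rtri isometry_triangle by blast
  from this[of "inv_into UNIV f" "f ` t"] show "tile t" if "isometry f" "tile (f ` t)"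
    using that isometry_inv isometry_inj[of f] by (simp add: image_inv_f_f)
qed

text \<open>Coordinates on the dilated tile, with the short leg as unit of \<open>x\<close> and the
  long leg as unit of \<open>y\<close>; in inner products the weights 1 and 4 are the squared leg
  lengths and the factor 5 is the squared dilation. The geometry of the subdivision becomes linear
  arithmetic in \<open>x\<close> and \<open>y\<close>.\<close>

definition loc :: "real^2 \<Rightarrow> real^2 \<Rightarrow> real^2 \<Rightarrow> real \<Rightarrow> real \<Rightarrow> real^2" where
  "loc a b c x y = sqrt 5 *\<^sub>R (a + x *\<^sub>R (b - a) + y *\<^sub>R (c - a))"

lemma loc_inner:
  assumes "rtri a b c"
  shows "(loc a b c x y - loc a b c x0 y0) \<bullet> (loc a b c x' y' - loc a b c x0' y0')
     = 5 * ((x - x0) * (x' - x0') + 4 * ((y - y0) * (y' - y0')))"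
proof -
  have d: "loc a b c x y - loc a b c x0 y0 = sqrt 5 *\<^sub>R ((x - x0) *\<^sub>R (b - a) + (y - y0) *\<^sub>R (c - a))" for x y x0 y0
    by (simp add: loc_def algebra_simps)
  have "(c - a) \<bullet> (b - a) = 0" using assms by (simp add: rtri_def inner_commute)
  then show ?thesis
    using assms by (simp add: d rtri_def inner_add_left inner_add_right) (simp add: algebra_simps)
qed

lemma loc_combine:
  "loc a b c x1 y1 + s *\<^sub>R (loc a b c x2 y2 - loc a b c x1 y1) + t *\<^sub>R (loc a b c x3 y3 - loc a b c x1 y1)
    = loc a b c (x1 + s * (x2 - x1) + t * (x3 - x1)) (y1 + s * (y2 - y1) + t * (y3 - y1))"
  by (simp add: loc_def algebra_simps)

lemma loc_eq_iff:
  assumes "rtri a b c"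
  shows "loc a b c x y = loc a b c x' y' \<longleftrightarrow> x = x' \<and> y = y'"
  using rtri_coord_unique[OF assms] by (auto simp: loc_def)

lemma loc_surj:
  assumes "rtri a b c"
  obtains x y where "p = loc a b c x y"
proof -
  obtain x y where "(1 / sqrt 5) *\<^sub>R p = a + x *\<^sub>R (b - a) + y *\<^sub>R (c - a)"
    using rtri_coord[OF assms] by blast
  then have "loc a b c x y = sqrt 5 *\<^sub>R ((1 / sqrt 5) *\<^sub>R p)" by (simp add: loc_def)
  then show ?thesis using that[of x y] by simp
qed

lemma rtri_loc:
  assumes "rtri a b c"
  shows "rtri (loc a b c x1 y1) (loc a b c x2 y2) (loc a b c x3 y3) \<longleftrightarrow>
    5 * ((x2 - x1)\<^sup>2 + 4 * (y2 - y1)\<^sup>2) = 1 \<and> 5 * ((x3 - x1)\<^sup>2 + 4 * (y3 - y1)\<^sup>2) = 4 \<and>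
    (x2 - x1) * (x3 - x1) + 4 * ((y2 - y1) * (y3 - y1)) = 0"
  unfolding rtri_def loc_inner[OF assms] power2_eq_square by (auto; linarith)

lemma loc_in_triangle:
  assumes "rtri a b c"
  shows "loc a b c x y \<in> triangle (loc a b c x1 y1) (loc a b c x2 y2) (loc a b c x3 y3) \<longleftrightarrow>
    (\<exists>s t. 0 \<le> s \<and> 0 \<le> t \<and> s + t \<le> 1 \<and> x = x1 + s * (x2 - x1) + t * (x3 - x1)
       \<and> y = y1 + s * (y2 - y1) + t * (y3 - y1))"
  unfolding triangle_iff loc_combine loc_eq_iff[OF assms] by simp

lemma loc_in_interior:
  assumes "rtri a b c" "rtri (loc a b c x1 y1) (loc a b c x2 y2) (loc a b c x3 y3)"
  shows "loc a b c x y \<in> interior (triangle (loc a b c x1 y1) (loc a b c x2 y2) (loc a b c x3 y3)) \<longleftrightarrow>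
    (\<exists>s t. 0 < s \<and> 0 < t \<and> s + t < 1 \<and> x = x1 + s * (x2 - x1) + t * (x3 - x1)
       \<and> y = y1 + s * (y2 - y1) + t * (y3 - y1))"
  unfolding interior_triangle_iff[OF assms(2)] loc_combine loc_eq_iff[OF assms(1)] by simp

text \<open>The pieces in the order of \<^const>\<open>pieces\<close>, with the vertices in the order right angle, end of
  the short leg, end of the long leg. The coordinates are those of the points \<open>F\<close>, \<open>M1\<close>, \<open>M2\<close>, \<open>M3\<close>
  with respect to \<open>R\<close>, \<open>P\<close>, \<open>S\<close>.\<close>

definition pieceA where "pieceA a b c = triangle (loc a b c (4/5) (1/5)) (loc a b c 1 0) (loc a b c 0 0)"
definition pieceB where "pieceB a b c = triangle (loc a b c (2/5) (1/10)) (loc a b c 0 0) (loc a b c 0 (1/2))"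
definition pieceC where "pieceC a b c = triangle (loc a b c (2/5) (1/10)) (loc a b c (4/5) (1/5)) (loc a b c 0 (1/2))"
definition pieceD where "pieceD a b c = triangle (loc a b c (2/5) (3/5)) (loc a b c 0 (1/2)) (loc a b c (4/5) (1/5))"
definition pieceE where "pieceE a b c = triangle (loc a b c (2/5) (3/5)) (loc a b c 0 (1/2)) (loc a b c 0 1)"

lemmas piece_defs = pieceA_def pieceB_def pieceC_def pieceD_def pieceE_def

lemma rtri_pieces:
  assumes "rtri a b c"
  shows "rtri (loc a b c (4/5) (1/5)) (loc a b c 1 0) (loc a b c 0 0)"
    "rtri (loc a b c (2/5) (1/10)) (loc a b c 0 0) (loc a b c 0 (1/2))"
    "rtri (loc a b c (2/5) (1/10)) (loc a b c (4/5) (1/5)) (loc a b c 0 (1/2))"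
    "rtri (loc a b c (2/5) (3/5)) (loc a b c 0 (1/2)) (loc a b c (4/5) (1/5))"
    "rtri (loc a b c (2/5) (3/5)) (loc a b c 0 (1/2)) (loc a b c 0 1)"
  by (simp_all add: rtri_loc[OF assms] power2_eq_square)

lemma triangle_scale: "(\<lambda>x. r *\<^sub>R x) ` triangle a b c = triangle (r *\<^sub>R a) (r *\<^sub>R b) (r *\<^sub>R c)"
  unfolding triangle_def
  using convex_hull_linear_image[of "\<lambda>x. r *\<^sub>R x" "{a, b, c}"] by simp

lemma triangle_perm: "triangle a b c = triangle b a c" "triangle a b c = triangle a c b"
  by (simp_all add: triangle_def insert_commute)

text \<open>An isometry in the definition of \<open>subdivide\<close> must match vertices with
  vertices because the triangle is scalene (\<open>uniq\<close>), and one exists by composing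
  coordinate maps (\<open>h0\<close>); the transported pieces then have the listed coordinates
  (\<open>im\<close>).\<close>

lemma subdivide_triangle:
  assumes "rtri a b c"
  shows "subdivide (triangle a b c) = {pieceA a b c, pieceB a b c, pieceC a b c, pieceD a b c, pieceE a b c}"
proof -
  define R where "R = pt (-3/2) (-1/2)"
  define P where "P = pt (1/2) (-3/2)"
  define S where "S = pt (1/2) (7/2)"
  have pts: "pt (1/2) (-1/2) = R + (4/5) *\<^sub>R (P - R) + (1/5) *\<^sub>R (S - R)"
    "pt (1/2) (3/2) = R + (2/5) *\<^sub>R (P - R) + (3/5) *\<^sub>R (S - R)"
    "pt (-1/2) (3/2) = R + 0 *\<^sub>R (P - R) + (1/2) *\<^sub>R (S - R)"
    "pt (-1/2) (-1/2) = R + (2/5) *\<^sub>R (P - R) + (1/10) *\<^sub>R (S - R)"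
    by (simp_all add: R_def P_def S_def vec_eq_iff forall_2)
  have im: "(`) h ` pieces = {pieceA a b c, pieceB a b c, pieceC a b c, pieceD a b c, pieceE a b c}"
    if h: "isometry h" "h R = sqrt 5 *\<^sub>R a" "h P = sqrt 5 *\<^sub>R b" "h S = sqrt 5 *\<^sub>R c" for h
  proof -
    have l: "h (R + x *\<^sub>R (P - R) + y *\<^sub>R (S - R)) = loc a b c x y" for x y
      unfolding isometry_affine[OF h(1)] h loc_def
      by (simp add: scaleR_right_distrib scaleR_right_diff_distrib mult.commute)
    have "h P = loc a b c 1 0" "h R = loc a b c 0 0" "h S = loc a b c 0 1"
      using l[of 1 0] l[of 0 0] l[of 0 1] by simp_all
    moreover have "h (pt (1/2) (-1/2)) = loc a b c (4/5) (1/5)" "h (pt (1/2) (3/2)) = loc a b c (2/5) (3/5)"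
      "h (pt (-1/2) (3/2)) = loc a b c 0 (1/2)" "h (pt (-1/2) (-1/2)) = loc a b c (2/5) (1/10)"
      unfolding pts l by simp_all
    ultimately show ?thesis
      unfolding pieces_def image_insert image_empty isometry_triangle[OF h(1)] piece_defs
      unfolding P_def[symmetric] R_def[symmetric] S_def[symmetric]
      by (simp only: triangle_perm(1)[of "loc a b c 1 0"] triangle_perm(1)[of "loc a b c 0 0"]
          triangle_perm(2)[of "loc a b c (2/5) (3/5)" _ "loc a b c 0 (1/2)"])
  qed
  \<comment> \<open>Both triangles are \<open>sqrt 5\<close> times a tile. Scaling by
    \<open>k\<close> returns to tile size, where \<open>rtri\<close> and \<open>triangle_inj\<close>
    apply.\<close>
  define k where "k = 1 / sqrt 5"
  have k: "k * sqrt 5 = 1" "sqrt 5 * k = 1" by (simp_all add: k_def)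
  have r0: "rtri (k *\<^sub>R R) (k *\<^sub>R P) (k *\<^sub>R S)"
  proof -
    have kk: "k * k = 1 / 5" by (simp add: k_def)
    have "(k *\<^sub>R u - k *\<^sub>R v) \<bullet> (k *\<^sub>R w - k *\<^sub>R v) = (k * k) * ((u - v) \<bullet> (w - v))" for u v w :: "real^2"
      by (simp flip: scaleR_diff_right)
    then show "rtri (k *\<^sub>R R) (k *\<^sub>R P) (k *\<^sub>R S)"
      by (simp only: rtri_def kk) (simp add: inner_vec_def sum_2 R_def P_def S_def)
  qed
  have uniq: "h R = sqrt 5 *\<^sub>R a \<and> h P = sqrt 5 *\<^sub>R b \<and> h S = sqrt 5 *\<^sub>R c"
    if h: "isometry h" "h ` big_triangle = (\<lambda>x. sqrt 5 *\<^sub>R x) ` triangle a b c" for h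
  proof -
    define f where "f x = k *\<^sub>R h (sqrt 5 *\<^sub>R x)" for x
    have f: "isometry f"
      using isometry_rescale[OF h(1), of k] unfolding f_def by (simp add: k_def)
    have "rtri (f (k *\<^sub>R R)) (f (k *\<^sub>R P)) (f (k *\<^sub>R S))"
      using r0 by (simp add: isometry_rtri[OF f])
    then have r1: "rtri (k *\<^sub>R h R) (k *\<^sub>R h P) (k *\<^sub>R h S)" by (simp add: f_def k)
    have "h ` big_triangle = triangle (h R) (h P) (h S)"
      unfolding big_triangle_def R_def[symmetric] P_def[symmetric] S_def[symmetric] by (rule isometry_triangle[OF h(1)])
    then have "(\<lambda>x. k *\<^sub>R x) ` triangle (h R) (h P) (h S) = (\<lambda>x. k *\<^sub>R x) ` (\<lambda>x. sqrt 5 *\<^sub>R x) ` triangle a b c"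
      using h by simp
    then have "triangle (k *\<^sub>R h R) (k *\<^sub>R h P) (k *\<^sub>R h S) = triangle a b c"
      by (simp add: triangle_scale k)
    from triangle_inj[OF r1 assms this]
    have "sqrt 5 *\<^sub>R (k *\<^sub>R h R) = sqrt 5 *\<^sub>R a" "sqrt 5 *\<^sub>R (k *\<^sub>R h P) = sqrt 5 *\<^sub>R b"
      "sqrt 5 *\<^sub>R (k *\<^sub>R h S) = sqrt 5 *\<^sub>R c" by simp_all
    then show ?thesis by (simp add: k)
  qed
  have "\<exists>h. isometry h \<and> h R = sqrt 5 *\<^sub>R a \<and> h P = sqrt 5 *\<^sub>R b \<and> h S = sqrt 5 *\<^sub>R c"
  proof -
    define f where "f a b c x = a + (x $ 1) *\<^sub>R (b - a) + (x $ 2) *\<^sub>R ((1/2) *\<^sub>R (c - a))" for a b c x :: "real^2"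
    have fi: "isometry (f a b c)" if "rtri a b c" for a b c
      unfolding f_def by (rule isometry_to_frame[OF rtri_frame[OF that]])
    have fv: "f a b c (pt 0 0) = a" "f a b c (pt 1 0) = b" "f a b c (pt 0 2) = c" for a b c
      by (simp_all add: f_def)
    define g where "g = f a b c \<circ> inv_into UNIV (f (k *\<^sub>R R) (k *\<^sub>R P) (k *\<^sub>R S))"
    have g: "isometry g" unfolding g_def
      using fi[OF assms] fi[OF r0] isometry_comp isometry_inv by blast
    have "g (k *\<^sub>R R) = a" "g (k *\<^sub>R P) = b" "g (k *\<^sub>R S) = c"
      using inv_f_f[OF isometry_inj[OF fi[OF r0]], of "pt 0 0"]
        inv_f_f[OF isometry_inj[OF fi[OF r0]], of "pt 1 0"]
        inv_f_f[OF isometry_inj[OF fi[OF r0]], of "pt 0 2"] by (simp_all add: g_def fv)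
    moreover define h where "h x = sqrt 5 *\<^sub>R g (k *\<^sub>R x)" for x
    moreover have "isometry h"
      using isometry_rescale[OF g, of "sqrt 5"] unfolding h_def by (simp add: k_def)
    ultimately show ?thesis by auto
  qed
  then obtain h0 where h0: "isometry h0" "h0 R = sqrt 5 *\<^sub>R a" "h0 P = sqrt 5 *\<^sub>R b" "h0 S = sqrt 5 *\<^sub>R c"
    by blast
  have h0b: "h0 ` big_triangle = (\<lambda>x. sqrt 5 *\<^sub>R x) ` triangle a b c"
    unfolding big_triangle_def R_def[symmetric] P_def[symmetric] S_def[symmetric]
    by (simp add: isometry_triangle[OF h0(1)] h0 triangle_scale)
  let ?Y = "{pieceA a b c, pieceB a b c, pieceC a b c, pieceD a b c, pieceE a b c}"
  show ?thesis
  proof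
    show "subdivide (triangle a b c) \<subseteq> ?Y"
    proof
      fix y assume "y \<in> subdivide (triangle a b c)"
      then obtain h p where h: "isometry h" "h ` big_triangle = (\<lambda>x. sqrt 5 *\<^sub>R x) ` triangle a b c"
        and "p \<in> pieces" "y = h ` p"
        unfolding subdivide_def by blast
      then have "y \<in> (`) h ` pieces" by blast
      then show "y \<in> ?Y" using im[OF h(1)] uniq[OF h] by simp
    qed
    have "(`) h0 ` pieces \<subseteq> subdivide (triangle a b c)"
      unfolding subdivide_def using h0(1) h0b by blast
    then show "?Y \<subseteq> subdivide (triangle a b c)" by (simp only: im[OF h0])
  qed
qed

subsection \<open>Patches\<close>

lemma tile_convex: "tile t \<Longrightarrow> convex t"
  by (auto simp: tile_iff triangle_def)

lemma tile_compact: "tile t \<Longrightarrow> compact t"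
  by (auto simp: tile_iff triangle_def intro!: finite_imp_compact_convex_hull)

lemma tile_closed: "tile t \<Longrightarrow> closed t"
  by (simp add: tile_compact compact_imp_closed)

lemma tile_interior_nonempty: "tile t \<Longrightarrow> interior t \<noteq> {}"
proof -
  assume "tile t"
  then obtain a b c where t: "rtri a b c" "t = triangle a b c" by (rule tileE)
  have "a + (1/4) *\<^sub>R (b - a) + (1/4) *\<^sub>R (c - a) \<in> interior t"
    unfolding t(2) interior_triangle_iff[OF t(1)] by (intro exI[of _ "1/4"]) simp
  then show ?thesis by blast
qed

lemma tile_open_meets:
  assumes "tile t" "open U" "U \<inter> t \<noteq> {}"
  shows "U \<inter> interior t \<noteq> {}"
proof -
  have "closure (interior t) = closure t"
    using assms(1) by (intro convex_closure_interior tile_convex tile_interior_nonempty)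
  then show ?thesis
    using assms open_Int_closure_eq_empty[of U "interior t"] tile_closed[of t] by auto
qed

lemma open_subset_Union_tiles:
  assumes "finite Q" "\<forall>t\<in>Q. tile t" "open U" "U \<noteq> {}" "U \<subseteq> \<Union>Q"
  shows "\<exists>t\<in>Q. U \<inter> interior t \<noteq> {}"
proof -
  obtain p where p: "p \<in> U" using assms by blast
  then obtain t where t: "t \<in> Q" "p \<in> t" using assms by blast
  then show ?thesis using tile_open_meets[of t U] assms p by blast
qed

text \<open>Infinite and disconnected sets are allowed, so that subdivisions, supertiles and tilings
  are all instances; a tiling is a patch that covers the plane.\<close>

definition patch :: "(real^2) set set \<Rightarrow> bool" where
  "patch W \<longleftrightarrow> (\<forall>t\<in>W. tile t) \<and> (\<forall>s\<in>W. \<forall>t\<in>W. s \<noteq> t \<longrightarrow> interior s \<inter> interior t = {})"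

lemma tiling_iff: "tiling T \<longleftrightarrow> patch T \<and> \<Union>T = UNIV"
  by (auto simp: tiling_def patch_def)

lemma patch_tile: "patch W \<Longrightarrow> t \<in> W \<Longrightarrow> tile t"
  by (simp add: patch_def)

lemma patch_overlap: "patch W \<Longrightarrow> s \<in> W \<Longrightarrow> t \<in> W \<Longrightarrow> interior s \<inter> interior t \<noteq> {} \<Longrightarrow> s = t"
  unfolding patch_def by blast

lemma patch_subset: "patch W \<Longrightarrow> V \<subseteq> W \<Longrightarrow> patch V"
  unfolding patch_def subset_iff by simp

lemma patch_sing: "tile t \<Longrightarrow> patch {t}"
  by (simp add: patch_def)

text \<open>Tiles of \<open>Q\<close> already fill \<open>U\<close>, so a tile of the patch that
  touches \<open>U\<close> overlaps one of them and is equal to it. This turns covering of a region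
  into membership of tiles.\<close>

lemma patch_meets_open:
  assumes "patch W" "t \<in> W" "Q \<subseteq> W" "open U" "U \<subseteq> \<Union>Q" "U \<inter> t \<noteq> {}"
  shows "t \<in> Q"
proof -
  have "U \<inter> interior t \<noteq> {}" using tile_open_meets patch_tile assms by blast
  then obtain s p where s: "s \<in> Q" "p \<in> s" "p \<in> U \<inter> interior t" using assms(5) by blast
  then have "interior t \<inter> interior s \<noteq> {}"
    using tile_open_meets[of s "interior t"] patch_tile[OF assms(1)] assms(3) by blast
  then have "t = s" using patch_overlap[OF assms(1,2)] s assms(3) by blast
  with s show ?thesis by simp
qed

lemma patch_act:
  assumes "isometry f" shows "patch (act f W) \<longleftrightarrow> patch W"
proof -
  note i = isometry_inj[OF assms]
  have "interior (f ` s) \<inter> interior (f ` t) = {} \<longleftrightarrow> interior s \<inter> interior t = {}" for s t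
    by (simp add: isometry_interior[OF assms] image_Int[OF i, symmetric])
  moreover have "f ` s = f ` t \<longleftrightarrow> s = t" for s t by (simp add: inj_image_eq_iff[OF i])
  ultimately show ?thesis
    by (simp add: patch_def act_def tile_image[OF assms])
qed

subsection \<open>The subdivision of a single tile\<close>

lemma subdivide_tiles:
  assumes "tile t" "p \<in> subdivide t" shows "tile p"
  using assms by (elim tileE) (auto simp: subdivide_triangle piece_defs intro!: tile_triangle rtri_pieces)

lemma subdivide_finite: "tile t \<Longrightarrow> finite (subdivide t)"
  by (elim tileE) (simp add: subdivide_triangle)

text \<open>The two linear forms are the coordinates of the point along the legs of the piece, found
  by inverting its affine frame; likewise for the other four pieces.\<close>

lemma loc_in_pieceA:
  assumes "rtri a b c"
  shows "loc a b c x y \<in> pieceA a b c \<longleftrightarrow> 0 \<le> x - 4 * y \<and> 0 \<le> 1 - x - y \<and> (x - 4 * y) + (1 - x - y) \<le> 1"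
    "loc a b c x y \<in> interior (pieceA a b c) \<longleftrightarrow> 0 < x - 4 * y \<and> 0 < 1 - x - y \<and> (x - 4 * y) + (1 - x - y) < 1"
proof -
  have "x = 4/5 + s * (1 - 4/5) + t * (0 - 4/5) \<and> y = 1/5 + s * (0 - 1/5) + t * (0 - 1/5)
    \<longleftrightarrow> s = x - 4 * y \<and> t = 1 - x - y" for s t :: real
    by (simp, rule iffI; elim conjE; intro conjI; linarith)
  then show "loc a b c x y \<in> pieceA a b c \<longleftrightarrow> 0 \<le> x - 4 * y \<and> 0 \<le> 1 - x - y \<and> (x - 4 * y) + (1 - x - y) \<le> 1"
    "loc a b c x y \<in> interior (pieceA a b c) \<longleftrightarrow> 0 < x - 4 * y \<and> 0 < 1 - x - y \<and> (x - 4 * y) + (1 - x - y) < 1"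
    unfolding pieceA_def loc_in_triangle[OF assms] loc_in_interior[OF assms rtri_pieces(1)[OF assms]]
    by auto
qed

lemma loc_in_pieceB:
  assumes "rtri a b c"
  shows "loc a b c x y \<in> pieceB a b c \<longleftrightarrow> 0 \<le> 1 - 2 * x - 2 * y \<and> 0 \<le> 2 * y - x / 2 \<and> (1 - 2 * x - 2 * y) + (2 * y - x / 2) \<le> 1"
    "loc a b c x y \<in> interior (pieceB a b c) \<longleftrightarrow> 0 < 1 - 2 * x - 2 * y \<and> 0 < 2 * y - x / 2 \<and> (1 - 2 * x - 2 * y) + (2 * y - x / 2) < 1"
proof -
  have "x = 2/5 + s * (0 - 2/5) + t * (0 - 2/5) \<and> y = 1/10 + s * (0 - 1/10) + t * (1/2 - 1/10)
    \<longleftrightarrow> s = 1 - 2 * x - 2 * y \<and> t = 2 * y - x / 2" for s t :: real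
    by (simp, rule iffI; elim conjE; intro conjI; linarith)
  then show "loc a b c x y \<in> pieceB a b c \<longleftrightarrow> 0 \<le> 1 - 2 * x - 2 * y \<and> 0 \<le> 2 * y - x / 2 \<and> (1 - 2 * x - 2 * y) + (2 * y - x / 2) \<le> 1"
    "loc a b c x y \<in> interior (pieceB a b c) \<longleftrightarrow> 0 < 1 - 2 * x - 2 * y \<and> 0 < 2 * y - x / 2 \<and> (1 - 2 * x - 2 * y) + (2 * y - x / 2) < 1"
    unfolding pieceB_def loc_in_triangle[OF assms] loc_in_interior[OF assms rtri_pieces(2)[OF assms]]
    by auto
qed

lemma loc_in_pieceC:
  assumes "rtri a b c"
  shows "loc a b c x y \<in> pieceC a b c \<longleftrightarrow> 0 \<le> 2 * x + 2 * y - 1 \<and> 0 \<le> 2 * y - x / 2 \<and> (2 * x + 2 * y - 1) + (2 * y - x / 2) \<le> 1"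
    "loc a b c x y \<in> interior (pieceC a b c) \<longleftrightarrow> 0 < 2 * x + 2 * y - 1 \<and> 0 < 2 * y - x / 2 \<and> (2 * x + 2 * y - 1) + (2 * y - x / 2) < 1"
proof -
  have "x = 2/5 + s * (4/5 - 2/5) + t * (0 - 2/5) \<and> y = 1/10 + s * (1/5 - 1/10) + t * (1/2 - 1/10)
    \<longleftrightarrow> s = 2 * x + 2 * y - 1 \<and> t = 2 * y - x / 2" for s t :: real
    by (simp, rule iffI; elim conjE; intro conjI; linarith)
  then show "loc a b c x y \<in> pieceC a b c \<longleftrightarrow> 0 \<le> 2 * x + 2 * y - 1 \<and> 0 \<le> 2 * y - x / 2 \<and> (2 * x + 2 * y - 1) + (2 * y - x / 2) \<le> 1"
    "loc a b c x y \<in> interior (pieceC a b c) \<longleftrightarrow> 0 < 2 * x + 2 * y - 1 \<and> 0 < 2 * y - x / 2 \<and> (2 * x + 2 * y - 1) + (2 * y - x / 2) < 1"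
    unfolding pieceC_def loc_in_triangle[OF assms] loc_in_interior[OF assms rtri_pieces(3)[OF assms]]
    by auto
qed

lemma loc_in_pieceD:
  assumes "rtri a b c"
  shows "loc a b c x y \<in> pieceD a b c \<longleftrightarrow> 0 \<le> 2 - 2 * x - 2 * y \<and> 0 \<le> 1 - 2 * y + x / 2 \<and> (2 - 2 * x - 2 * y) + (1 - 2 * y + x / 2) \<le> 1"
    "loc a b c x y \<in> interior (pieceD a b c) \<longleftrightarrow> 0 < 2 - 2 * x - 2 * y \<and> 0 < 1 - 2 * y + x / 2 \<and> (2 - 2 * x - 2 * y) + (1 - 2 * y + x / 2) < 1"
proof -
  have "x = 2/5 + s * (0 - 2/5) + t * (4/5 - 2/5) \<and> y = 3/5 + s * (1/2 - 3/5) + t * (1/5 - 3/5)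
    \<longleftrightarrow> s = 2 - 2 * x - 2 * y \<and> t = 1 - 2 * y + x / 2" for s t :: real
    by (simp, rule iffI; elim conjE; intro conjI; linarith)
  then show "loc a b c x y \<in> pieceD a b c \<longleftrightarrow> 0 \<le> 2 - 2 * x - 2 * y \<and> 0 \<le> 1 - 2 * y + x / 2 \<and> (2 - 2 * x - 2 * y) + (1 - 2 * y + x / 2) \<le> 1"
    "loc a b c x y \<in> interior (pieceD a b c) \<longleftrightarrow> 0 < 2 - 2 * x - 2 * y \<and> 0 < 1 - 2 * y + x / 2 \<and> (2 - 2 * x - 2 * y) + (1 - 2 * y + x / 2) < 1"
    unfolding pieceD_def loc_in_triangle[OF assms] loc_in_interior[OF assms rtri_pieces(4)[OF assms]]
    by auto
qed

lemma loc_in_pieceE: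
  assumes "rtri a b c"
  shows "loc a b c x y \<in> pieceE a b c \<longleftrightarrow> 0 \<le> 2 - 2 * x - 2 * y \<and> 0 \<le> 2 * y - x / 2 - 1 \<and> (2 - 2 * x - 2 * y) + (2 * y - x / 2 - 1) \<le> 1"
    "loc a b c x y \<in> interior (pieceE a b c) \<longleftrightarrow> 0 < 2 - 2 * x - 2 * y \<and> 0 < 2 * y - x / 2 - 1 \<and> (2 - 2 * x - 2 * y) + (2 * y - x / 2 - 1) < 1"
proof -
  have "x = 2/5 + s * (0 - 2/5) + t * (0 - 2/5) \<and> y = 3/5 + s * (1/2 - 3/5) + t * (1 - 3/5)
    \<longleftrightarrow> s = 2 - 2 * x - 2 * y \<and> t = 2 * y - x / 2 - 1" for s t :: real
    by (simp, rule iffI; elim conjE; intro conjI; linarith)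
  then show "loc a b c x y \<in> pieceE a b c \<longleftrightarrow> 0 \<le> 2 - 2 * x - 2 * y \<and> 0 \<le> 2 * y - x / 2 - 1 \<and> (2 - 2 * x - 2 * y) + (2 * y - x / 2 - 1) \<le> 1"
    "loc a b c x y \<in> interior (pieceE a b c) \<longleftrightarrow> 0 < 2 - 2 * x - 2 * y \<and> 0 < 2 * y - x / 2 - 1 \<and> (2 - 2 * x - 2 * y) + (2 * y - x / 2 - 1) < 1"
    unfolding pieceE_def loc_in_triangle[OF assms] loc_in_interior[OF assms rtri_pieces(5)[OF assms]]
    by auto
qed

lemma subdivide_cover:
  assumes "tile t" shows "\<Union>(subdivide t) = (\<lambda>x. sqrt 5 *\<^sub>R x) ` t"
proof -
  obtain a b c where t: "rtri a b c" "t = triangle a b c" using assms by (rule tileE)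
  have T: "(\<lambda>x. sqrt 5 *\<^sub>R x) ` t = triangle (loc a b c 0 0) (loc a b c 1 0) (loc a b c 0 1)"
    by (simp add: t(2) triangle_scale loc_def)
  have "p \<in> \<Union>(subdivide t) \<longleftrightarrow> p \<in> (\<lambda>x. sqrt 5 *\<^sub>R x) ` t" for p
  proof -
    obtain x y where p: "p = loc a b c x y" using t(1) by (rule loc_surj)
    have R: "p \<in> (\<lambda>x. sqrt 5 *\<^sub>R x) ` t \<longleftrightarrow> 0 \<le> x \<and> 0 \<le> y \<and> x + y \<le> 1"
      unfolding T p loc_in_triangle[OF t(1)] by auto
    have lin: "(0 \<le> x - 4 * y \<and> 0 \<le> 1 - x - y \<and> (x - 4 * y) + (1 - x - y) \<le> 1 \<or>
      0 \<le> 1 - 2 * x - 2 * y \<and> 0 \<le> 2 * y - x / 2 \<and> (1 - 2 * x - 2 * y) + (2 * y - x / 2) \<le> 1 \<or>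
      0 \<le> 2 * x + 2 * y - 1 \<and> 0 \<le> 2 * y - x / 2 \<and> (2 * x + 2 * y - 1) + (2 * y - x / 2) \<le> 1 \<or>
      0 \<le> 2 - 2 * x - 2 * y \<and> 0 \<le> 1 - 2 * y + x / 2 \<and> (2 - 2 * x - 2 * y) + (1 - 2 * y + x / 2) \<le> 1 \<or>
      0 \<le> 2 - 2 * x - 2 * y \<and> 0 \<le> 2 * y - x / 2 - 1 \<and> (2 - 2 * x - 2 * y) + (2 * y - x / 2 - 1) \<le> 1)
      \<longleftrightarrow> 0 \<le> x \<and> 0 \<le> y \<and> x + y \<le> 1" (is "?L \<longleftrightarrow> ?R")
    proof
      assume ?L
      then show ?R by (elim disjE conjE; intro conjI; linarith)
    next
      assume R: ?R
      \<comment> \<open>The four cut lines: \<open>x = 4 * y\<close> passes through R and F,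
        \<open>2 * x + 2 * y = 1\<close> separates \<open>B\<close> from \<open>C\<close>,
        \<open>3 * x + 8 * y = 4\<close> separates \<open>C\<close> from \<open>D\<close>, and
        \<open>2 * y - x / 2 = 1\<close> separates \<open>D\<close> from \<open>E\<close>.\<close>
      consider "4 * y \<le> x" | "x \<le> 4 * y" "2 * x + 2 * y \<le> 1" | "x \<le> 4 * y" "1 \<le> 2 * x + 2 * y" "3 * x + 8 * y \<le> 4"
        | "4 \<le> 3 * x + 8 * y" "2 * y - x / 2 \<le> 1" | "1 \<le> 2 * y - x / 2"
        by linarith
      then show ?L
      proof cases
        case 1 with R show ?thesis by (intro disjI1 conjI; linarith)
      next
        case 2 with R show ?thesis by (intro disjI2[OF disjI1] conjI; linarith)
      next
        case 3 with R show ?thesis by (intro disjI2[OF disjI2[OF disjI1]] conjI; linarith)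
      next
        case 4 with R show ?thesis by (intro disjI2[OF disjI2[OF disjI2[OF disjI1]]] conjI; linarith)
      next
        case 5 with R show ?thesis by (intro disjI2[OF disjI2[OF disjI2[OF disjI2]]] conjI; linarith)
      qed
    qed
    have "p \<in> \<Union>(subdivide t) \<longleftrightarrow> p \<in> pieceA a b c \<or> p \<in> pieceB a b c \<or> p \<in> pieceC a b c \<or> p \<in> pieceD a b c \<or> p \<in> pieceE a b c"
      by (auto simp: t subdivide_triangle)
    also have "\<dots> \<longleftrightarrow> 0 \<le> x \<and> 0 \<le> y \<and> x + y \<le> 1"
      unfolding p loc_in_pieceA[OF t(1)] loc_in_pieceB[OF t(1)] loc_in_pieceC[OF t(1)]
        loc_in_pieceD[OF t(1)] loc_in_pieceE[OF t(1)] by (rule lin)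
    finally show ?thesis using R by simp
  qed
  then show ?thesis by blast
qed

lemma subdivide_disjoint:
  assumes "tile t" shows "patch (subdivide t)"
proof -
  obtain a b c where t: "rtri a b c" "t = triangle a b c" using assms by (rule tileE)
  note i = loc_in_pieceA(2)[OF t(1)] loc_in_pieceB(2)[OF t(1)] loc_in_pieceC(2)[OF t(1)]
    loc_in_pieceD(2)[OF t(1)] loc_in_pieceE(2)[OF t(1)]
  have dis: "A \<inter> B = {}" if *: "\<And>x y. loc a b c x y \<in> A \<Longrightarrow> loc a b c x y \<in> B \<Longrightarrow> False" for A B
  proof -
    have False if "p \<in> A" "p \<in> B" for p
    proof -
      obtain x y where "p = loc a b c x y" using t(1) by (rule loc_surj)
      then show False using * that by blast
    qed
    then show ?thesis by blast
  qed
  have dAB: "interior (pieceA a b c) \<inter> interior (pieceB a b c) = {}"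
    by (rule dis) (unfold i, linarith)
  have dAC: "interior (pieceA a b c) \<inter> interior (pieceC a b c) = {}"
    by (rule dis) (unfold i, linarith)
  have dAD: "interior (pieceA a b c) \<inter> interior (pieceD a b c) = {}"
    by (rule dis) (unfold i, linarith)
  have dAE: "interior (pieceA a b c) \<inter> interior (pieceE a b c) = {}"
    by (rule dis) (unfold i, linarith)
  have dBC: "interior (pieceB a b c) \<inter> interior (pieceC a b c) = {}"
    by (rule dis) (unfold i, linarith)
  have dBD: "interior (pieceB a b c) \<inter> interior (pieceD a b c) = {}"
    by (rule dis) (unfold i, linarith)
  have dBE: "interior (pieceB a b c) \<inter> interior (pieceE a b c) = {}"
    by (rule dis) (unfold i, linarith)
  have dCD: "interior (pieceC a b c) \<inter> interior (pieceD a b c) = {}"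
    by (rule dis) (unfold i, linarith)
  have dCE: "interior (pieceC a b c) \<inter> interior (pieceE a b c) = {}"
    by (rule dis) (unfold i, linarith)
  have dDE: "interior (pieceD a b c) \<inter> interior (pieceE a b c) = {}"
    by (rule dis) (unfold i, linarith)
  show ?thesis
    using subdivide_tiles[OF assms] dAB dAC dAD dAE dBC dBD dBE dCD dCE dDE
    unfolding patch_def by (auto simp: t subdivide_triangle Int_commute)
qed

subsection \<open>Local finiteness\<close>

lemma tile_diameter:
  assumes "tile t" "x \<in> t" "y \<in> t" shows "dist x y \<le> 3"
proof -
  obtain a b c where t: "rtri a b c" "t = triangle a b c" using assms(1) by (rule tileE)
  obtain s u where x: "0 \<le> s" "0 \<le> u" "s + u \<le> 1" "x = a + s *\<^sub>R (b - a) + u *\<^sub>R (c - a)"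
    using assms(2) unfolding t(2) triangle_iff by blast
  obtain s' u' where y: "0 \<le> s'" "0 \<le> u'" "s' + u' \<le> 1" "y = a + s' *\<^sub>R (b - a) + u' *\<^sub>R (c - a)"
    using assms(3) unfolding t(2) triangle_iff by blast
  have n: "norm (b - a) = 1" "norm (c - a) = 2"
    using rtri_dist[OF t(1)] by (auto simp: dist_norm norm_minus_commute)
  have "x - y = (s - s') *\<^sub>R (b - a) + (u - u') *\<^sub>R (c - a)"
    unfolding x(4) y(4) by (simp add: algebra_simps)
  then have "dist x y \<le> \<bar>s - s'\<bar> * norm (b - a) + \<bar>u - u'\<bar> * norm (c - a)"
    by (metis dist_norm norm_scaleR norm_triangle_ineq)
  also have "\<dots> \<le> 1 * 1 + 1 * 2"
    unfolding n using x y by (intro add_mono mult_right_mono) auto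
  finally show ?thesis by simp
qed

lemma tile_inball:
  assumes "tile t" shows "\<exists>z. ball z (1/4) \<subseteq> t"
proof -
  obtain a b c where t: "rtri a b c" "t = triangle a b c" using assms(1) by (rule tileE)
  \<comment> \<open>This point has distances 3/10 and 2/5 from the legs and
    \<open>1 / sqrt 5\<close> from the hypotenuse, all above 1/4.\<close>
  define z where "z = a + (3/10) *\<^sub>R (b - a) + (1/5) *\<^sub>R (c - a)"
  have n: "norm (b - a) = 1" "norm (c - a) = 2"
    using rtri_dist[OF t(1)] by (auto simp: dist_norm norm_minus_commute)
  have o: "(b - a) \<bullet> (b - a) = 1" "(c - a) \<bullet> (c - a) = 4" "(b - a) \<bullet> (c - a) = 0" "(c - a) \<bullet> (b - a) = 0"
    using t(1) by (auto simp: rtri_def inner_commute)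
  have "x \<in> t" if "dist z x < 1/4" for x
  proof -
    define s where "s = (x - a) \<bullet> (b - a)"
    define u where "u = (x - a) \<bullet> (c - a) / 4"
    have x: "x = a + s *\<^sub>R (b - a) + u *\<^sub>R (c - a)"
      unfolding s_def u_def by (rule rtri_coord[OF t(1)])
    have "x - z = (s - 3/10) *\<^sub>R (b - a) + (u - 1/5) *\<^sub>R (c - a)"
      unfolding x z_def by (simp add: scaleR_diff_left)
    then have d: "(x - z) \<bullet> (b - a) = s - 3/10" "(x - z) \<bullet> (c - a) = 4 * u - 4/5"
      by (simp_all add: inner_add_left o right_diff_distrib)
    have "\<bar>(x - z) \<bullet> (b - a)\<bar> \<le> norm (x - z) * norm (b - a)"
      "\<bar>(x - z) \<bullet> (c - a)\<bar> \<le> norm (x - z) * norm (c - a)"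
      by (rule Cauchy_Schwarz_ineq2)+
    then have 1: "\<bar>s - 3/10\<bar> \<le> norm (x - z)" and 2: "\<bar>4 * u - 4/5\<bar> \<le> norm (x - z) * 2"
      unfolding d n by simp_all
    have 3: "norm (x - z) < 1/4" using that by (simp add: dist_norm norm_minus_commute)
    have "s - 3/10 > -1/4" "s - 3/10 < 1/4" using 1 3 by linarith+
    moreover have "4 * u - 4/5 > -1/2" "4 * u - 4/5 < 1/2" using 2 3 by linarith+
    ultimately have "0 \<le> s" "0 \<le> u" "s + u \<le> 1" by linarith+
    then show "x \<in> t" unfolding t(2) triangle_iff using x by blast
  qed
  then show ?thesis by (auto simp: subset_iff)
qed

text \<open>The centres of the inscribed balls are at least 1/4 apart, since otherwise one centre
  would be interior to two tiles; a bounded set with this property is finite. Finiteness is what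
  allows the legality condition, which speaks of finite patches, to be applied to a ball.\<close>

lemma patch_locally_finite:
  assumes "patch T" shows "finite {t \<in> T. t \<inter> ball p r \<noteq> {}}"
proof -
  define N where "N = {t \<in> T. t \<inter> ball p r \<noteq> {}}"
  have "\<exists>z. \<forall>t\<in>T. ball (z t) (1/4) \<subseteq> t"
    using tile_inball patch_tile[OF assms] by metis
  then obtain z where z: "\<And>t. t \<in> T \<Longrightarrow> ball (z t) (1/4) \<subseteq> t" by blast
  have sep: "s = t" if "s \<in> T" "t \<in> T" "dist (z s) (z t) < 1/4" for s t
  proof -
    have "z t \<in> interior s" "z t \<in> interior t"
      using z[OF that(1)] z[OF that(2)] that(3)
      by (auto simp: interior_maximal intro!: subsetD[OF interior_maximal[of "ball _ (1/4)"]])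
    then show ?thesis using patch_overlap[OF assms that(1,2)] by blast
  qed
  have "uniform_discrete (z ` N)"
    unfolding uniform_discrete_def using sep by (intro exI[of _ "1/4"]) (auto simp: N_def)
  moreover have "z ` N \<subseteq> cball p (r + 3)"
  proof
    fix q assume "q \<in> z ` N"
    then obtain t where "t \<in> T" "q = z t" "t \<inter> ball p r \<noteq> {}" by (auto simp: N_def)
    then obtain y where t: "t \<in> T" "q = z t" "y \<in> t" "dist p y < r" by auto
    then have "dist y q \<le> 3" using z[of t] by (auto intro!: tile_diameter[OF patch_tile[OF assms]])
    then show "q \<in> cball p (r + 3)" using t(4) dist_triangle[of p q y] by simp
  qed
  then have "bounded (z ` N)" using bounded_cball bounded_subset by blast
  ultimately have "finite (z ` N)" by (simp flip: uniform_discrete_finite_iff)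
  moreover have "inj_on z N" using sep by (auto simp: inj_on_def N_def)
  ultimately show ?thesis using finite_imageD N_def by blast
qed

subsection \<open>The substitution on patches\<close>

lemma interior_scale: "r \<noteq> 0 \<Longrightarrow> interior ((\<lambda>x :: real^2. r *\<^sub>R x) ` S) = (\<lambda>x. r *\<^sub>R x) ` interior S"
  by (rule interior_injective_linear_image) (auto simp: inj_def)

lemma subdivide_subset: "tile t \<Longrightarrow> p \<in> subdivide t \<Longrightarrow> p \<subseteq> (\<lambda>x. sqrt 5 *\<^sub>R x) ` t"
  using subdivide_cover by blast

lemma patch_subst:
  assumes "patch W" shows "patch (pinwheel_subst W)"
proof -
  have "p = q" if p: "p \<in> subdivide s" "s \<in> W" and q: "q \<in> subdivide t" "t \<in> W"
      and o: "interior p \<inter> interior q \<noteq> {}" for p q s t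
  proof -
    note st = patch_tile[OF assms p(2)] patch_tile[OF assms q(2)]
    have "interior p \<subseteq> (\<lambda>x. sqrt 5 *\<^sub>R x) ` interior s" "interior q \<subseteq> (\<lambda>x. sqrt 5 *\<^sub>R x) ` interior t"
      using interior_mono[OF subdivide_subset[OF st(1) p(1)]] interior_mono[OF subdivide_subset[OF st(2) q(1)]]
      by (simp_all add: interior_scale)
    moreover obtain x where "x \<in> interior p" "x \<in> interior q" using o by blast
    ultimately obtain y z where "y \<in> interior s" "z \<in> interior t" "x = sqrt 5 *\<^sub>R y" "x = sqrt 5 *\<^sub>R z"
      by blast
    then have "interior s \<inter> interior t \<noteq> {}" by auto
    then have "s = t" using patch_overlap[OF assms p(2) q(2)] by blast
    then show "p = q" using patch_overlap[OF subdivide_disjoint[OF st(1)], of p q] p q o by simp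
  qed
  then show ?thesis
    using subdivide_tiles patch_tile[OF assms] unfolding patch_def pinwheel_subst_def by blast
qed

lemma subst_cover:
  assumes "\<forall>t\<in>W. tile t" shows "\<Union>(pinwheel_subst W) = (\<lambda>x. sqrt 5 *\<^sub>R x) ` \<Union>W"
proof -
  have "\<Union>(pinwheel_subst W) = (\<Union>t\<in>W. \<Union>(subdivide t))" by (auto simp: pinwheel_subst_def)
  also have "\<dots> = (\<Union>t\<in>W. (\<lambda>x. sqrt 5 *\<^sub>R x) ` t)" using subdivide_cover assms by simp
  finally show ?thesis by blast
qed

lemma subst_mono: "V \<subseteq> W \<Longrightarrow> pinwheel_subst V \<subseteq> pinwheel_subst W"
  by (auto simp: pinwheel_subst_def)

lemma subst_pow_mono: "V \<subseteq> W \<Longrightarrow> (pinwheel_subst ^^ n) V \<subseteq> (pinwheel_subst ^^ n) W"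
  by (induction n) (auto intro!: subst_mono)

lemma patch_subst_pow: "patch W \<Longrightarrow> patch ((pinwheel_subst ^^ n) W)"
  by (induction n) (auto intro: patch_subst)

lemma subst_pow_cover:
  assumes "patch W" shows "\<Union>((pinwheel_subst ^^ n) W) = (\<lambda>x. (sqrt 5) ^ n *\<^sub>R x) ` \<Union>W"
proof (induction n)
  case (Suc n)
  then show ?case
    using subst_cover[of "(pinwheel_subst ^^ n) W"] patch_subst_pow[OF assms, of n]
    by (simp add: patch_def image_image)
qed simp

text \<open>The conjugate of \<open>f\<close> by the dilation, so that substituting after
  \<open>shrink f\<close> is the same as applying \<open>f\<close> after substituting. For
  orthogonal maps it is \<open>f\<close> itself, since they commute with the dilation about the
  origin.\<close>

definition shrink :: "(real^2 \<Rightarrow> real^2) \<Rightarrow> real^2 \<Rightarrow> real^2" where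
  "shrink f x = (1 / sqrt 5) *\<^sub>R f (sqrt 5 *\<^sub>R x)"

lemma shrink_isometry: "isometry f \<Longrightarrow> isometry (shrink f)"
  using isometry_rescale[of f "1 / sqrt 5"] by (simp add: shrink_def[abs_def])

lemma shrink_orth: "orthogonal_transformation g \<Longrightarrow> shrink g = g"
  by (simp add: shrink_def[abs_def] orthogonal_transformation_def linear_scale)

lemma subdivide_shrink:
  assumes "isometry f" "tile t"
  shows "subdivide (shrink f ` t) = (`) f ` subdivide t"
proof -
  obtain a b c where t: "rtri a b c" "t = triangle a b c" using assms(2) by (rule tileE)
  have "rtri (shrink f a) (shrink f b) (shrink f c)"
    using isometry_rtri[OF shrink_isometry[OF assms(1)]] t by simp
  moreover have "loc (shrink f a) (shrink f b) (shrink f c) x y = f (loc a b c x y)" for x y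
  proof -
    have "loc (shrink f a) (shrink f b) (shrink f c) x y = sqrt 5 *\<^sub>R shrink f (a + x *\<^sub>R (b - a) + y *\<^sub>R (c - a))"
      unfolding loc_def isometry_affine[OF shrink_isometry[OF assms(1)]] ..
    then show ?thesis by (simp add: shrink_def loc_def)
  qed
  ultimately show ?thesis
    unfolding t(2) isometry_triangle[OF shrink_isometry[OF assms(1)]]
    by (simp add: subdivide_triangle t(1) piece_defs isometry_triangle[OF assms(1)])
qed

lemma subst_act:
  assumes "isometry f" "\<forall>t\<in>W. tile t"
  shows "pinwheel_subst (act (shrink f) W) = act f (pinwheel_subst W)"
  using subdivide_shrink[OF assms(1)] assms(2) by (auto simp: pinwheel_subst_def act_def)

lemma act_mono: "V \<subseteq> W \<Longrightarrow> act f V \<subseteq> act f W"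
  by (auto simp: act_def)

lemma act_comp: "act f (act g W) = act (f \<circ> g) W"
  by (simp add: act_def image_image image_comp)

lemma act_tiles: "isometry f \<Longrightarrow> (\<forall>t\<in>act f W. tile t) \<longleftrightarrow> (\<forall>t\<in>W. tile t)"
  by (simp add: act_def tile_image)

lemma subst_pow_act_orth:
  assumes "orthogonal_transformation g" "patch W"
  shows "(pinwheel_subst ^^ n) (act g W) = act g ((pinwheel_subst ^^ n) W)"
proof (induction n)
  case (Suc n)
  have "\<forall>t\<in>(pinwheel_subst ^^ n) W. tile t"
    using patch_subst_pow[OF assms(2)] by (simp add: patch_def)
  then show ?case
    using Suc subst_act[OF isometry_orth[OF assms(1)]] by (simp add: shrink_orth[OF assms(1)])
qed simp

subsection \<open>Recognizability\<close>

lemma loc_from_pieceC: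
  "loc a b c x y = loc a b c (2/5) (1/10) + (2 * x + 2 * y - 1) *\<^sub>R (loc a b c (4/5) (1/5) - loc a b c (2/5) (1/10))
     + (2 * y - x / 2) *\<^sub>R (loc a b c 0 (1/2) - loc a b c (2/5) (1/10))"
  unfolding loc_combine by (rule arg_cong2[of _ _ _ _ "loc a b c"]) (simp_all add: field_simps)

text \<open>If \<open>C\<close> of the first tile is \<open>C\<close> of the second, the frames
  coincide and so do the tiles. In the other four cases a neighbour \<open>A\<close> or
  \<open>B\<close> in the first tile shares an interior point with a piece of the second, so the two
  would be equal; but the right-angle vertices of \<open>A\<close> and \<open>B\<close> are vertices
  of \<open>C\<close>, so their position in the second tile is known, and it is the wrong
  one.\<close>

lemma recognizability_aux:
  assumes "rtri a b c" "rtri a' b' c'" "patch W"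
    "subdivide (triangle a b c) \<subseteq> W" "subdivide (triangle a' b' c') \<subseteq> W"
    "pieceC a b c \<in> subdivide (triangle a' b' c')"
  shows "triangle a b c = triangle a' b' c'"
proof -
  note sub = subdivide_triangle[OF assms(1)] subdivide_triangle[OF assms(2)]
  note r = rtri_pieces[OF assms(1)] rtri_pieces[OF assms(2)]
  have eq: "s = t" if "s \<in> subdivide (triangle a b c)" "t \<in> subdivide (triangle a' b' c')"
     "loc a b c x y \<in> interior s" "loc a' b' c' x' y' \<in> interior t" "loc a b c x y = loc a' b' c' x' y'" for s t x y x' y'
    using patch_overlap[OF assms(3), of s t] that assms(4,5) by (metis disjoint_iff subsetD)
  have comb: "loc a b c x y = loc a' b' c' (x1 + (2 * x + 2 * y - 1) * (x2 - x1) + (2 * y - x / 2) * (x3 - x1))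
       (y1 + (2 * x + 2 * y - 1) * (y2 - y1) + (2 * y - x / 2) * (y3 - y1))"
    if "loc a b c (2/5) (1/10) = loc a' b' c' x1 y1" "loc a b c (4/5) (1/5) = loc a' b' c' x2 y2"
       "loc a b c 0 (1/2) = loc a' b' c' x3 y3" for x y x1 y1 x2 y2 x3 y3
    by (subst loc_from_pieceC) (simp only: that loc_combine)
  note ne = loc_eq_iff[OF assms(2)]
  consider "pieceC a b c = pieceA a' b' c'" | "pieceC a b c = pieceB a' b' c'" | "pieceC a b c = pieceC a' b' c'"
    | "pieceC a b c = pieceD a' b' c'" | "pieceC a b c = pieceE a' b' c'"
    using assms(6) unfolding sub by blast
  then show ?thesis
  proof cases
    case 1
    note p = triangle_inj[OF r(3) r(6) 1[unfolded piece_defs]]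
    \<comment> \<open>The witness lies in \<open>B\<close> just across the long leg shared with
      \<open>C\<close>. The identification sends this leg to the long leg of the second
      \<open>A\<close>, beyond which the second \<open>B\<close> lies. In the other cases the
      witness lies in \<open>A\<close>, across the line of the short leg of
      \<open>C\<close>.\<close>
    have "pieceB a b c = pieceB a' b' c'"
      by (rule eq[OF _ _ _ _ comb[OF p, of "2/25" "37/100"]]) (simp_all add: sub loc_in_pieceB[OF assms(1)] loc_in_pieceB[OF assms(2)])
    from triangle_inj(1)[OF r(2) r(7) this[unfolded piece_defs]] p show ?thesis by (simp add: ne)
  next
    case 2
    note p = triangle_inj[OF r(3) r(7) 2[unfolded piece_defs]]
    have "pieceA a b c = pieceA a' b' c'"
      by (rule eq[OF _ _ _ _ comb[OF p, of "11/25" "3/50"]]) (simp_all add: sub loc_in_pieceA[OF assms(1)] loc_in_pieceA[OF assms(2)])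
    from triangle_inj(1)[OF r(1) r(6) this[unfolded piece_defs]] p show ?thesis by (simp add: ne)
  next
    case 3
    note p = triangle_inj[OF r(3) r(8) 3[unfolded piece_defs]]
    have "loc a b c x y = loc a' b' c' x y" for x y
      unfolding comb[OF p, of x y] by (rule arg_cong2[of _ _ _ _ "loc a' b' c'"]) (simp_all add: field_simps)
    from this[of 0 0] this[of 1 0] this[of 0 1] show ?thesis by (simp add: loc_def)
  next
    case 4
    note p = triangle_inj[OF r(3) r(9) 4[unfolded piece_defs]]
    have "pieceA a b c = pieceE a' b' c'"
      by (rule eq[OF _ _ _ _ comb[OF p, of "13/25" "2/25"]]) (simp_all add: sub loc_in_pieceA[OF assms(1)] loc_in_pieceE[OF assms(2)])
    from triangle_inj(1)[OF r(1) r(10) this[unfolded piece_defs]] p show ?thesis by (simp add: ne)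
  next
    case 5
    note p = triangle_inj[OF r(3) r(10) 5[unfolded piece_defs]]
    have "pieceA a b c = pieceD a' b' c'"
      by (rule eq[OF _ _ _ _ comb[OF p, of "13/25" "2/25"]]) (simp_all add: sub loc_in_pieceA[OF assms(1)] loc_in_pieceD[OF assms(2)])
    from triangle_inj(1)[OF r(1) r(9) this[unfolded piece_defs]] p show ?thesis by (simp add: ne)
  qed
qed

lemma recognizability:
  assumes "patch W" "tile q" "subdivide q \<subseteq> pinwheel_subst W" shows "q \<in> W"
proof -
  obtain a b c where q: "rtri a b c" "q = triangle a b c" using assms(2) by (rule tileE)
  have "pieceC a b c \<in> subdivide q" by (simp add: q subdivide_triangle)
  then obtain s where s: "s \<in> W" "pieceC a b c \<in> subdivide s"
    using assms(3) by (auto simp: pinwheel_subst_def)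
  obtain a' b' c' where s': "rtri a' b' c'" "s = triangle a' b' c'"
    using patch_tile[OF assms(1) s(1)] by (rule tileE)
  have "subdivide s \<subseteq> pinwheel_subst W" using s(1) by (auto simp: pinwheel_subst_def)
  then have "triangle a b c = triangle a' b' c'"
    using recognizability_aux[OF q(1) s'(1) patch_subst[OF assms(1)]] assms(3) s(2) q(2) s'(2) by simp
  with q s s' show ?thesis by simp
qed

section \<open>Tilings compared with supertiles\<close>

lemma Omega_patch: "T \<in> Omega \<Longrightarrow> patch T"
  and Omega_cover: "T \<in> Omega \<Longrightarrow> \<Union>T = UNIV"
  by (simp_all add: Omega_def tiling_iff)

text \<open>Finitely many tiles of \<open>T\<close> meet the ball, and legality places a copy of
  them in a supertile. They already fill the ball, which leaves no room there for other tiles of the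
  supertile, so both agree near the point.\<close>

lemma Omega_local:
  assumes "T \<in> Omega" "0 < r"
  obtains f t n where "isometry f" "tile t" "ball (f p) r \<subseteq> \<Union>((pinwheel_subst ^^ n) {t})"
    "\<forall>y. y \<inter> ball (f p) r \<noteq> {} \<longrightarrow> (y \<in> (pinwheel_subst ^^ n) {t} \<longleftrightarrow> y \<in> act f T)"
proof -
  define N where "N = {x \<in> T. x \<inter> ball p r \<noteq> {}}"
  have "finite N" "N \<subseteq> T" using patch_locally_finite[OF Omega_patch[OF assms(1)]] by (auto simp: N_def)
  then obtain f t n where f: "isometry f" "tile t" "act f N \<subseteq> (pinwheel_subst ^^ n) {t}"
    using assms(1) unfolding Omega_def by blast
  have ball: "ball (f p) r = f ` ball p r"
  proof -
    have "y \<in> f ` ball p r" if "dist (f p) y < r" for y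
    proof -
      obtain x where "y = f x" using isometry_bij[OF f(1)] by (auto simp: bij_def)
      then show ?thesis using that f(1) by (auto simp: isometry_def)
    qed
    then show ?thesis using f(1) by (auto simp: isometry_def)
  qed
  have "ball p r \<subseteq> \<Union>N"
  proof
    fix x assume x: "x \<in> ball p r"
    have "x \<in> \<Union>T" using Omega_cover[OF assms(1)] by simp
    then obtain t where "t \<in> T" "x \<in> t" by blast
    then have "t \<in> N" using x by (auto simp: N_def)
    then show "x \<in> \<Union>N" using \<open>x \<in> t\<close> by blast
  qed
  then have c: "ball (f p) r \<subseteq> \<Union>(act f N)" unfolding ball act_def by blast
  have "y \<in> (pinwheel_subst ^^ n) {t} \<longleftrightarrow> y \<in> act f T" if y: "y \<inter> ball (f p) r \<noteq> {}" for y
  proof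
    assume "y \<in> (pinwheel_subst ^^ n) {t}"
    then have "y \<in> act f N"
      using patch_meets_open[OF patch_subst_pow[OF patch_sing[OF f(2)]] _ f(3) open_ball c] y by blast
    then show "y \<in> act f T" using act_mono[OF \<open>N \<subseteq> T\<close>] by blast
  next
    assume "y \<in> act f T"
    then obtain x where x: "x \<in> T" "y = f ` x" by (auto simp: act_def)
    then have "f ` (x \<inter> ball p r) \<noteq> {}"
      using y by (simp add: ball image_Int[OF isometry_inj[OF f(1)]])
    then have "x \<in> N" using x by (auto simp: N_def)
    then show "y \<in> (pinwheel_subst ^^ n) {t}" using f(3) x by (auto simp: act_def)
  qed
  moreover have "ball (f p) r \<subseteq> \<Union>((pinwheel_subst ^^ n) {t})" using c Union_mono[OF f(3)] by (rule order_trans)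
  ultimately show thesis using that f(1,2) by blast
qed

text \<open>By recognizability the only candidate for a preimage of \<open>T\<close> under \<open>\<sigma>\<close> is the set of all tiles
  whose subdivision lies in \<open>T\<close>.\<close>

definition desubst :: "(real^2) set set \<Rightarrow> (real^2) set set" where
  "desubst T = {q. tile q \<and> subdivide q \<subseteq> T}"

lemma shrink_onto:
  assumes "isometry f" "tile s" obtains q where "tile q" "shrink f ` q = s"
proof -
  note i = shrink_isometry[OF assms(1)]
  have e: "shrink f ` (inv_into UNIV (shrink f) ` s) = s"
    using bij_is_surj[OF isometry_bij[OF i]] by (simp add: image_f_inv_f)
  moreover have "tile (inv_into UNIV (shrink f) ` s)"
    using assms(2) tile_image[OF i, of "inv_into UNIV (shrink f) ` s"] e by simp
  ultimately show thesis using that by blast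
qed

lemma image_subset_act: "inj f \<Longrightarrow> (`) f ` S \<subseteq> act f T \<longleftrightarrow> S \<subseteq> T"
  unfolding act_def by (auto simp: inj_image_eq_iff subset_iff)

text \<open>Inside a supertile \<open>x\<close> is a piece of some tile \<open>s\<close> one level
  up. The radius 20 is so large that a single tile cannot fill the ball and that all pieces of
  \<open>s\<close> meet it; there supertile and tiling agree, so \<open>s\<close>, carried back by
  \<open>shrink f\<close>, lies in \<open>desubst T\<close>.\<close>

lemma desubst_covers:
  assumes "T \<in> Omega" "x \<in> T"
  obtains q where "q \<in> desubst T" "x \<in> subdivide q"
proof -
  have xt: "tile x" using Omega_patch[OF assms(1)] assms(2) by (rule patch_tile)
  then obtain p where p: "p \<in> x" using tile_interior_nonempty interior_subset by blast
  obtain f t n where f: "isometry f" "tile t" "ball (f p) 20 \<subseteq> \<Union>((pinwheel_subst ^^ n) {t})"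
    and loc: "\<forall>y. y \<inter> ball (f p) 20 \<noteq> {} \<longrightarrow> (y \<in> (pinwheel_subst ^^ n) {t} \<longleftrightarrow> y \<in> act f T)"
    using assms(1) zero_less_numeral by (rule Omega_local[where p = p and r = 20])
  have fp: "f p \<in> f ` x" "f p \<in> ball (f p) 20" using p by auto
  have "f ` x \<in> act f T" using assms(2) by (auto simp: act_def)
  then have fx: "f ` x \<in> (pinwheel_subst ^^ n) {t}" using loc[rule_format, of "f ` x"] fp by blast
  have "n \<noteq> 0"
  proof
    assume "n = 0"
    then have "ball (f p) 20 \<subseteq> t" using f(3) by simp
    moreover have "f p + 10 *\<^sub>R axis 1 1 \<in> ball (f p) 20"
      by (simp add: dist_norm)
    ultimately have "dist (f p) (f p + 10 *\<^sub>R axis 1 1) \<le> 3" using fp by (intro tile_diameter[OF f(2)]) auto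
    then show False by (simp add: dist_norm)
  qed
  then obtain m where m: "n = Suc m" using not0_implies_Suc by blast
  obtain s where s: "s \<in> (pinwheel_subst ^^ m) {t}" "f ` x \<in> subdivide s"
    using fx by (auto simp: m pinwheel_subst_def)
  have st: "tile s" using patch_tile[OF patch_subst_pow[OF patch_sing[OF f(2)]] s(1)] .
  have sub: "subdivide s \<subseteq> act f T"
  proof
    fix y assume y: "y \<in> subdivide s"
    have "y \<in> (pinwheel_subst ^^ n) {t}" using y s(1) by (auto simp: m pinwheel_subst_def)
    moreover have "y \<inter> ball (f p) 20 \<noteq> {}"
    proof -
      obtain z where z: "z \<in> y" using tile_interior_nonempty[OF subdivide_tiles[OF st y]] interior_subset by blast
      obtain z' where z': "z' \<in> s" "z = sqrt 5 *\<^sub>R z'" using z subdivide_subset[OF st y] by blast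
      obtain p' where p': "p' \<in> s" "f p = sqrt 5 *\<^sub>R p'" using fp(1) subdivide_subset[OF st s(2)] by blast
      have "sqrt 5 \<le> sqrt 9" by (rule real_sqrt_le_mono) simp
      also have "sqrt 9 = (3::real)" using real_sqrt_abs[of 3] by simp
      finally have "sqrt 5 * dist p' z' \<le> 3 * 3"
        using tile_diameter[OF st p'(1) z'(1)] by (intro mult_mono) auto
      then have "dist (f p) z < 20"
        unfolding z'(2) p'(2) by (simp add: dist_norm flip: scaleR_diff_right)
      with z show ?thesis by auto
    qed
    ultimately show "y \<in> act f T" using loc[rule_format, of y] by simp
  qed
  obtain q where q: "tile q" "shrink f ` q = s" using f(1) st by (rule shrink_onto)
  have e: "subdivide s = (`) f ` subdivide q" using subdivide_shrink[OF f(1) q(1)] q(2) by simp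
  have "subdivide q \<subseteq> T" using sub unfolding e image_subset_act[OF isometry_inj[OF f(1)]] .
  moreover have "x \<in> subdivide q"
    using s(2) unfolding e by (auto simp: inj_image_eq_iff[OF isometry_inj[OF f(1)]])
  ultimately show thesis using that q(1) by (auto simp: desubst_def)
qed

lemma subst_desubst:
  assumes "T \<in> Omega" shows "pinwheel_subst (desubst T) = T"
proof
  show "pinwheel_subst (desubst T) \<subseteq> T" by (auto simp: pinwheel_subst_def desubst_def)
  show "T \<subseteq> pinwheel_subst (desubst T)"
  proof
    fix x assume "x \<in> T"
    with assms obtain q where "q \<in> desubst T" "x \<in> subdivide q" by (rule desubst_covers)
    then show "x \<in> pinwheel_subst (desubst T)" by (auto simp: pinwheel_subst_def)
  qed
qed

lemma card_subdivide:
  assumes "tile t" obtains p q where "p \<in> subdivide t" "q \<in> subdivide t" "p \<noteq> q"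
proof -
  obtain a b c where t: "rtri a b c" "t = triangle a b c" using assms by (rule tileE)
  have "pieceA a b c \<noteq> pieceB a b c"
    using triangle_inj(1)[OF rtri_pieces(1,2)[OF t(1) ] ] t(1) unfolding piece_defs
    by (auto simp: loc_eq_iff rtri_pieces)
  then show thesis using that[of "pieceA a b c" "pieceB a b c"] by (simp add: t subdivide_triangle)
qed

text \<open>The patch obtained by substituting \<open>Q\<close> lies in \<open>T\<close> and so
  embeds into a supertile of some order \<open>n\<close>; \<open>n\<close> is positive because two
  pieces do not fit into one tile. Recognizability lowers this to an embedding of \<open>Q\<close>
  by \<open>shrink f\<close> into order \<open>n - 1\<close>.\<close>

lemma desubst_embeds:
  assumes "T \<in> Omega" "finite Q" "Q \<subseteq> desubst T"
  obtains f t n where "isometry f" "tile t" "act f Q \<subseteq> (pinwheel_subst ^^ n) {t}"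
proof (cases "Q = {}")
  case True
  have "isometry id" "tile (triangle (pt 0 0) (pt 1 0) (pt 0 2))"
    by (auto simp: isometry_def tile_def intro!: exI[of _ id])
  then show thesis using that[of id _ 0] True by (auto simp: act_def)
next
  case False
  then obtain q where q: "q \<in> Q" by blast
  have Qt: "\<forall>q\<in>Q. tile q" using assms(3) by (auto simp: desubst_def)
  have "finite (pinwheel_subst Q)" "pinwheel_subst Q \<subseteq> T"
    using assms(2,3) Qt subdivide_finite unfolding pinwheel_subst_def by (auto simp: desubst_def)
  then obtain f t n where f: "isometry f" "tile t" "act f (pinwheel_subst Q) \<subseteq> (pinwheel_subst ^^ n) {t}"
    using assms(1) unfolding Omega_def by blast
  have "n \<noteq> 0"
  proof
    assume "n = 0"
    obtain x y where xy: "x \<in> subdivide q" "y \<in> subdivide q" "x \<noteq> y"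
      using card_subdivide Qt q by blast
    then have "f ` x \<in> {t}" "f ` y \<in> {t}"
      using f(3) q \<open>n = 0\<close> by (auto simp: act_def pinwheel_subst_def)
    then show False using xy(3) by (auto simp: inj_image_eq_iff[OF isometry_inj[OF f(1)]])
  qed
  then obtain m where m: "n = Suc m" using not0_implies_Suc by blast
  have "act (shrink f) Q \<subseteq> (pinwheel_subst ^^ m) {t}"
  proof
    fix y assume "y \<in> act (shrink f) Q"
    then obtain x where x: "x \<in> Q" "y = shrink f ` x" by (auto simp: act_def)
    have "subdivide y \<subseteq> pinwheel_subst ((pinwheel_subst ^^ m) {t})"
      using f(3) x Qt by (auto simp: m subdivide_shrink[OF f(1)] act_def pinwheel_subst_def)
    moreover have "tile y" using x Qt by (simp add: tile_image[OF shrink_isometry[OF f(1)]])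
    ultimately show "y \<in> (pinwheel_subst ^^ m) {t}"
      by (intro recognizability patch_subst_pow patch_sing f)
  qed
  then show thesis using that shrink_isometry[OF f(1)] f(2) by blast
qed

lemma desubst_Omega:
  assumes "T \<in> Omega" shows "desubst T \<in> Omega"
proof -
  have t: "\<forall>t\<in>desubst T. tile t" by (simp add: desubst_def)
  have "interior p \<inter> interior q = {}" if "p \<in> desubst T" "q \<in> desubst T" "p \<noteq> q" for p q
  proof -
    obtain f t n where f: "isometry f" "tile t" "act f {p, q} \<subseteq> (pinwheel_subst ^^ n) {t}"
      using desubst_embeds[OF assms, of "{p, q}"] \<open>p \<in> _\<close> \<open>q \<in> _\<close> by auto
    have "patch (act f {p, q})"
      using patch_subset[OF patch_subst_pow[OF patch_sing[OF f(2)]] f(3)] .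
    then have "patch {p, q}" by (simp add: patch_act[OF f(1)])
    then show ?thesis using \<open>p \<noteq> q\<close> by (simp add: patch_def)
  qed
  moreover have "\<Union>(desubst T) = UNIV"
  proof -
   have "x \<in> \<Union>(desubst T)" for x
   proof -
    have "sqrt 5 *\<^sub>R x \<in> \<Union>T" using Omega_cover[OF assms] by simp
    then obtain y where "y \<in> T" "sqrt 5 *\<^sub>R x \<in> y" by blast
    moreover from assms \<open>y \<in> T\<close> obtain q where q: "q \<in> desubst T" "y \<in> subdivide q" by (rule desubst_covers)
    ultimately have "sqrt 5 *\<^sub>R x \<in> (\<lambda>x. sqrt 5 *\<^sub>R x) ` q"
      using subdivide_subset t by blast
    then have "x \<in> q" by auto
    with q show ?thesis by blast
  qed
  then show ?thesis by blast
  qed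
  ultimately have "tiling (desubst T)" using t by (simp add: tiling_def)
  moreover have "\<exists>f t n. isometry f \<and> tile t \<and> act f Q \<subseteq> (pinwheel_subst ^^ n) {t}"
    if "finite Q \<and> Q \<subseteq> desubst T" for Q
  proof -
    have "finite Q" "Q \<subseteq> desubst T" using that by auto
    with assms obtain f t n where "isometry f" "tile t" "act f Q \<subseteq> (pinwheel_subst ^^ n) {t}"
      by (rule desubst_embeds)
    then show ?thesis by blast
  qed
  ultimately show ?thesis by (simp add: Omega_def)
qed

text \<open>\<open>desubst\<close> is determined by \<open>T\<close> without choices, and
  subdivision commutes with orthogonal maps, so symmetries are inherited.\<close>

lemma desubst_act:
  assumes "orthogonal_transformation g" "act g T = T"
  shows "act g (desubst T) = desubst T"
proof -
  note i = isometry_orth[OF assms(1)]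
  have s: "subdivide (g ` q) \<subseteq> T \<longleftrightarrow> subdivide q \<subseteq> T" if "tile q" for q
    using subdivide_shrink[OF i that] image_subset_act[OF isometry_inj[OF i], of "subdivide q" T]
    by (simp add: shrink_orth[OF assms(1)] assms(2))
  have "q \<in> act g (desubst T)" if "q \<in> desubst T" for q
  proof -
    have "tile q" using that by (simp add: desubst_def)
    with i obtain p where "tile p" "shrink g ` p = q" by (rule shrink_onto)
    then have p: "tile p" "g ` p = q" by (simp_all add: shrink_orth[OF assms(1)])
    then have "p \<in> desubst T" using that s[of p] by (simp add: desubst_def)
    with p show ?thesis by (auto simp: act_def)
  qed
  moreover have "g ` q \<in> desubst T" if "q \<in> desubst T" for q
    using that s[of q] by (simp add: desubst_def tile_image[OF i])
  ultimately show ?thesis unfolding act_def by blast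
qed

subsection \<open>Corners\<close>

text \<open>Tiles with a vertex at \<open>v\<close>, of angle \<open>arctan (1/2)\<close> for \<open>alpha\<close>, \<open>arctan 2\<close> for \<open>beta\<close> and
  \<open>\<pi>/2\<close> for \<open>right\<close>. The unit vectors \<open>r\<close> and \<open>s\<close> give the directions of the leg and of the
  hypotenuse at \<open>v\<close>.\<close>

definition alpha :: "real^2 \<Rightarrow> real^2 \<Rightarrow> real^2 \<Rightarrow> (real^2) set" where
  "alpha v r s = triangle (v + 2 *\<^sub>R r) (v + sqrt 5 *\<^sub>R s) v"

definition beta :: "real^2 \<Rightarrow> real^2 \<Rightarrow> real^2 \<Rightarrow> (real^2) set" where
  "beta v r s = triangle (v + r) v (v + sqrt 5 *\<^sub>R s)"

definition right :: "real^2 \<Rightarrow> real^2 \<Rightarrow> real^2 \<Rightarrow> (real^2) set" where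
  "right v e n = triangle v (v + e) (v + 2 *\<^sub>R n)"

definition diag :: "real^2 \<Rightarrow> real^2 \<Rightarrow> real^2" where
  "diag e n = (1 / sqrt 5) *\<^sub>R (2 *\<^sub>R e + n)"

text \<open>In an orthonormal frame \<open>e\<close>, \<open>n\<close> the ray in direction \<open>diag e n\<close> cuts the quadrant between \<open>e\<close>
  and \<open>n\<close> into an \<open>alpha\<close> and a \<open>beta\<close> corner. The flag \<open>h\<close> tells whether the hypotenuses or the
  legs of the two tiles lie on the boundary of the quadrant.\<close>

definition alphaQ :: "bool \<Rightarrow> real^2 \<Rightarrow> real^2 \<Rightarrow> real^2 \<Rightarrow> (real^2) set" where
  "alphaQ h v e n = (if h then alpha v (diag e n) e else alpha v e (diag e n))"

definition betaQ :: "bool \<Rightarrow> real^2 \<Rightarrow> real^2 \<Rightarrow> real^2 \<Rightarrow> (real^2) set" where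
  "betaQ h v e n = (if h then beta v (diag e n) n else beta v n (diag e n))"

text \<open>Half discs filled by two \<open>alpha\<close> and two \<open>beta\<close> corners. The first pattern is the one at the point
  \<open>M2\<close> of a subdivided tile; the others arise from \<open>F\<close> and from \<open>M1\<close> one step later. The first two
  alternatives in \<open>half_star\<close> below are the patterns at \<open>F\<close> and \<open>M1\<close> themselves.\<close>

definition fan :: "bool \<Rightarrow> real^2 \<Rightarrow> real^2 \<Rightarrow> real^2 \<Rightarrow> (real^2) set set \<Rightarrow> bool" where
  "fan h v e n W \<longleftrightarrow>
    {alphaQ h v e (- n), alphaQ h v e n, betaQ h v e n, betaQ h v (- e) n} \<subseteq> W \<or>
    {alphaQ h v e n, betaQ h v e n, betaQ h v (- e) n, alphaQ h v (- e) n} \<subseteq> W \<or>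
    {alphaQ h v e n, alphaQ h v e (- n), betaQ h v e n, betaQ h v e (- n)} \<subseteq> W"

definition half_star :: "(real^2) set set \<Rightarrow> real^2 \<Rightarrow> bool" where
  "half_star W v \<longleftrightarrow> (\<exists>e n. frame e n \<and>
    ({right v e n, betaQ False v (- e) n, alphaQ False v (- e) n} \<subseteq> W \<or>
     {right v n e, right v n (- e)} \<subseteq> W \<or> (\<exists>h. fan h v e n W)))"

definition non_vertex :: "(real^2) set set \<Rightarrow> real^2 \<Rightarrow> bool" where
  "non_vertex W v \<longleftrightarrow> (\<exists>u\<in>W. tile u \<and> v \<in> u \<and> \<not> v extreme_point_of u)"

lemma frame_swap: "frame e n \<Longrightarrow> frame n e"
  and frame_neg: "frame e n \<Longrightarrow> frame (- e) n" "frame e n \<Longrightarrow> frame e (- n)"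
  by (auto simp: frame_def inner_commute)

lemma sqrt5_diag: "sqrt 5 *\<^sub>R diag e n = 2 *\<^sub>R e + n"
  by (simp add: diag_def)

lemma diag_inner:
  assumes "frame e n"
  shows "diag e n \<bullet> diag e n = 1" "diag e n \<bullet> e = 2 / sqrt 5" "diag e n \<bullet> n = 1 / sqrt 5"
proof -
  have "(2 *\<^sub>R e + n) \<bullet> (2 *\<^sub>R e + n) = 5"
    using assms by (simp add: frame_def inner_add_left inner_add_right inner_commute[of n e])
  then show "diag e n \<bullet> diag e n = 1" by (simp add: diag_def)
  show "diag e n \<bullet> e = 2 / sqrt 5" "diag e n \<bullet> n = 1 / sqrt 5"
    using assms by (simp_all add: diag_def frame_def inner_add_left inner_commute[of n e])
qed

section \<open>Corners under one subdivision\<close>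

lemma rtri_alpha:
  assumes "r \<bullet> r = 1" "s \<bullet> s = 1" "r \<bullet> s = 2 / sqrt 5"
  shows "rtri (v + 2 *\<^sub>R r) (v + sqrt 5 *\<^sub>R s) v"
proof -
  have "sqrt 5 * (2 / sqrt 5) = 2" by simp
  then show ?thesis using assms
    by (simp add: rtri_def inner_diff_left inner_diff_right inner_commute[of s r] field_simps)
qed

lemma rtri_beta:
  assumes "r \<bullet> r = 1" "s \<bullet> s = 1" "r \<bullet> s = 1 / sqrt 5"
  shows "rtri (v + r) v (v + sqrt 5 *\<^sub>R s)"
  using assms by (simp add: rtri_def inner_diff_left inner_diff_right inner_commute[of s r] field_simps)

text \<open>The corner at the end of the long leg is left to piece \<open>E\<close>, whose long leg
  lies on the dilated hypotenuse and whose hypotenuse lies on the dilated long leg. So the angle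
  survives with \<open>r\<close> and \<open>s\<close> exchanged; for \<open>beta\<close> the same
  happens with piece \<open>A\<close>.\<close>

lemma subdivide_alpha:
  assumes "r \<bullet> r = 1" "s \<bullet> s = 1" "r \<bullet> s = 2 / sqrt 5"
  shows "alpha (sqrt 5 *\<^sub>R v) s r \<in> subdivide (alpha v r s)"
proof -
  have "alpha (sqrt 5 *\<^sub>R v) s r = pieceE (v + 2 *\<^sub>R r) (v + sqrt 5 *\<^sub>R s) v"
    unfolding alpha_def pieceE_def loc_def
    by (rule arg_cong3[of _ _ _ _ _ _ triangle]) (simp_all add: vec_eq_iff field_simps)
  then show ?thesis
    unfolding alpha_def[of v] subdivide_triangle[OF rtri_alpha[OF assms]] by simp
qed

lemma subdivide_beta:
  assumes "r \<bullet> r = 1" "s \<bullet> s = 1" "r \<bullet> s = 1 / sqrt 5"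
  shows "beta (sqrt 5 *\<^sub>R v) s r \<in> subdivide (beta v r s)"
proof -
  have "beta (sqrt 5 *\<^sub>R v) s r = pieceA (v + r) v (v + sqrt 5 *\<^sub>R s)"
    unfolding beta_def pieceA_def loc_def
    by (rule arg_cong3[of _ _ _ _ _ _ triangle]) (simp_all add: vec_eq_iff field_simps)
  then show ?thesis
    unfolding beta_def[of v] subdivide_triangle[OF rtri_beta[OF assms]] by simp
qed

lemma rtri_right: "frame e n \<Longrightarrow> rtri v (v + e) (v + 2 *\<^sub>R n)"
  by (rule frame_rtri)

text \<open>The segment from R to F runs in direction \<open>diag e n\<close> and cuts the right
  angle; the pieces \<open>A\<close> and \<open>B\<close> beside it have their hypotenuses on the
  dilated legs, which fixes the flag to \<open>True\<close>.\<close>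

lemma subdivide_right:
  assumes "frame e n"
  shows "alphaQ True (sqrt 5 *\<^sub>R v) e n \<in> subdivide (right v e n)"
    "betaQ True (sqrt 5 *\<^sub>R v) e n \<in> subdivide (right v e n)"
proof -
  have "alphaQ True (sqrt 5 *\<^sub>R v) e n = pieceA v (v + e) (v + 2 *\<^sub>R n)"
    unfolding alphaQ_def alpha_def pieceA_def loc_def diag_def if_True
    by (rule arg_cong3[of _ _ _ _ _ _ triangle]) (simp_all add: vec_eq_iff field_simps)
  moreover have "betaQ True (sqrt 5 *\<^sub>R v) e n = pieceB v (v + e) (v + 2 *\<^sub>R n)"
    unfolding betaQ_def beta_def pieceB_def loc_def diag_def if_True
    by (rule arg_cong3[of _ _ _ _ _ _ triangle]) (simp_all add: vec_eq_iff field_simps)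
  ultimately show "alphaQ True (sqrt 5 *\<^sub>R v) e n \<in> subdivide (right v e n)"
    "betaQ True (sqrt 5 *\<^sub>R v) e n \<in> subdivide (right v e n)"
    unfolding right_def subdivide_triangle[OF rtri_right[OF assms]] by simp_all
qed

lemma subdivide_alphaQ:
  assumes "frame e n" shows "alphaQ (\<not> h) (sqrt 5 *\<^sub>R v) e n \<in> subdivide (alphaQ h v e n)"
  using assms diag_inner[OF assms] by (auto simp: alphaQ_def frame_def inner_commute intro!: subdivide_alpha)

lemma subdivide_betaQ:
  assumes "frame e n" shows "betaQ (\<not> h) (sqrt 5 *\<^sub>R v) e n \<in> subdivide (betaQ h v e n)"
  using assms diag_inner[OF assms] by (auto simp: betaQ_def frame_def inner_commute intro!: subdivide_beta)

lemma subst_memI: "t \<in> W \<Longrightarrow> p \<in> subdivide t \<Longrightarrow> p \<in> pinwheel_subst W"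
  by (auto simp: pinwheel_subst_def)

lemma fan_subst:
  assumes "frame e n" "fan h v e n W" shows "fan (\<not> h) (sqrt 5 *\<^sub>R v) e n (pinwheel_subst W)"
proof -
  have f: "frame e n" "frame e (- n)" "frame (- e) n" using assms(1) frame_neg by auto
  have a: "alphaQ h v e' n' \<in> W \<Longrightarrow> alphaQ (\<not> h) (sqrt 5 *\<^sub>R v) e' n' \<in> pinwheel_subst W"
    and b: "betaQ h v e' n' \<in> W \<Longrightarrow> betaQ (\<not> h) (sqrt 5 *\<^sub>R v) e' n' \<in> pinwheel_subst W"
    if "frame e' n'" for e' n'
    by (erule subst_memI, rule subdivide_alphaQ[OF that] subdivide_betaQ[OF that])+
  show ?thesis using assms(2) unfolding fan_def insert_subset
    by (elim disjE conjE) (simp_all add: a[OF f(1)] a[OF f(2)] a[OF f(3)] b[OF f(1)] b[OF f(2)] b[OF f(3)])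
qed

text \<open>Right angles split, so the two patterns containing them become the second and the third
  alternative of \<open>fan\<close>; a fan stays a fan with its flag reversed.\<close>

lemma half_star_subst:
  assumes "half_star W v"
  shows "\<exists>h e n. frame e n \<and> fan h (sqrt 5 *\<^sub>R v) e n (pinwheel_subst W)"
proof -
  obtain e n where f: "frame e n" and c: "{right v e n, betaQ False v (- e) n, alphaQ False v (- e) n} \<subseteq> W \<or>
     {right v n e, right v n (- e)} \<subseteq> W \<or> (\<exists>h. fan h v e n W)"
    using assms unfolding half_star_def by blast
  from c show ?thesis
  proof (elim disjE exE)
    assume *: "{right v e n, betaQ False v (- e) n, alphaQ False v (- e) n} \<subseteq> W"
    have "{alphaQ True (sqrt 5 *\<^sub>R v) e n, betaQ True (sqrt 5 *\<^sub>R v) e n,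
        betaQ True (sqrt 5 *\<^sub>R v) (- e) n, alphaQ True (sqrt 5 *\<^sub>R v) (- e) n} \<subseteq> pinwheel_subst W"
      using * subdivide_right[OF f, of v] subdivide_alphaQ[OF frame_neg(1)[OF f], of False v]
        subdivide_betaQ[OF frame_neg(1)[OF f], of False v] by (auto intro: subst_memI)
    then show ?thesis using f unfolding fan_def by blast
  next
    assume *: "{right v n e, right v n (- e)} \<subseteq> W"
    have "{alphaQ True (sqrt 5 *\<^sub>R v) n e, alphaQ True (sqrt 5 *\<^sub>R v) n (- e),
        betaQ True (sqrt 5 *\<^sub>R v) n e, betaQ True (sqrt 5 *\<^sub>R v) n (- e)} \<subseteq> pinwheel_subst W"
      using * subdivide_right[OF frame_swap[OF f], of v] subdivide_right[OF frame_neg(2)[OF frame_swap[OF f]], of v]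
      by (auto intro: subst_memI)
    then show ?thesis using frame_swap[OF f] unfolding fan_def by blast
  next
    fix h assume "fan h v e n W"
    then show ?thesis using fan_subst[OF f] f by blast
  qed
qed

lemma alphaQ_False: "alphaQ False v e n = triangle (v + 2 *\<^sub>R e) (v + (2 *\<^sub>R e + n)) v"
  by (simp add: alphaQ_def alpha_def sqrt5_diag)

lemma betaQ_False: "betaQ False v e n = triangle (v + n) v (v + (2 *\<^sub>R e + n))"
  by (simp add: betaQ_def beta_def sqrt5_diag)

text \<open>A point that is no vertex of \<open>u\<close> can become a vertex of a piece only at F,
  M1, M2 or M3. At F and M1, on the hypotenuse, and at M2, on the long leg, the pieces fill a half
  disc, with one pattern of \<open>half_star\<close> for each.\<close>

lemma non_vertex_subst:
  assumes "non_vertex W v"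
  shows "non_vertex (pinwheel_subst W) (sqrt 5 *\<^sub>R v) \<or> half_star (pinwheel_subst W) (sqrt 5 *\<^sub>R v)"
proof -
  let ?W = "pinwheel_subst W"
  let ?v = "sqrt 5 *\<^sub>R v"
  obtain u where u: "u \<in> W" "tile u" "v \<in> u" "\<not> v extreme_point_of u" using assms unfolding non_vertex_def by blast
  obtain a b c where t: "rtri a b c" "u = triangle a b c" using u(2) by (rule tileE)
  have nv: "v \<notin> {a, b, c}" using u(4) extreme_triangle[OF t(1)] t(2) by simp
  note r = rtri_pieces[OF t(1)]
  have sub: "p \<in> ?W" if "p \<in> {pieceA a b c, pieceB a b c, pieceC a b c, pieceD a b c, pieceE a b c}" for p
    using that u(1) t by (auto intro: subst_memI simp: subdivide_triangle)
  have "?v \<in> \<Union>(subdivide u)" using u(3) subdivide_cover[OF u(2)] by simp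
  then obtain p where p: "p \<in> subdivide u" "?v \<in> p" by blast
  show ?thesis
  proof (cases "?v extreme_point_of p")
    case False
    then show ?thesis
      using p subst_memI[OF u(1)] subdivide_tiles[OF u(2)] unfolding non_vertex_def by blast
  next
    case True
    have "?v \<in> {loc a b c 0 0, loc a b c 1 0, loc a b c 0 1} \<or> ?v = loc a b c (4/5) (1/5) \<or>
       ?v = loc a b c (2/5) (3/5) \<or> ?v = loc a b c 0 (1/2) \<or> ?v = loc a b c (2/5) (1/10)"
      using p(1) True unfolding t(2) subdivide_triangle[OF t(1)] piece_defs
      using r[THEN extreme_triangle] by auto
    moreover have "?v \<notin> {loc a b c 0 0, loc a b c 1 0, loc a b c 0 1}"
      using nv by (simp add: loc_def)
    ultimately consider "?v = loc a b c (4/5) (1/5)" | "?v = loc a b c (2/5) (3/5)"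
      | "?v = loc a b c 0 (1/2)" | "?v = loc a b c (2/5) (1/10)" by blast
    then show ?thesis
    proof cases
      case 1
      define e where "e = loc a b c 1 0 - loc a b c (4/5) (1/5)"
      define n where "n = (1/2) *\<^sub>R (loc a b c 0 0 - loc a b c (4/5) (1/5))"
      have "frame e n" unfolding e_def n_def by (rule rtri_frame[OF r(1)])
      moreover have "right ?v e n = pieceA a b c" "betaQ False ?v (- e) n = pieceC a b c"
        "alphaQ False ?v (- e) n = pieceD a b c"
        unfolding right_def alphaQ_False betaQ_False piece_defs 1
        by (rule arg_cong3[of _ _ _ _ _ _ triangle]; simp add: e_def n_def loc_def vec_eq_iff; simp add: field_simps)+
      then have "{right ?v e n, betaQ False ?v (- e) n, alphaQ False ?v (- e) n} \<subseteq> ?W" using sub by simp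
      ultimately show ?thesis unfolding half_star_def by blast
    next
      case 2
      define n where "n = loc a b c 0 (1/2) - loc a b c (2/5) (3/5)"
      define e where "e = (1/2) *\<^sub>R (loc a b c (4/5) (1/5) - loc a b c (2/5) (3/5))"
      have "frame n e" unfolding e_def n_def by (rule rtri_frame[OF r(4)])
      then have "frame e n" by (rule frame_swap)
      moreover have "right ?v n e = pieceD a b c" "right ?v n (- e) = pieceE a b c"
        unfolding right_def piece_defs 2
        by (rule arg_cong3[of _ _ _ _ _ _ triangle]; simp add: e_def n_def loc_def vec_eq_iff; simp add: field_simps)+
      then have "{right ?v n e, right ?v n (- e)} \<subseteq> ?W" using sub by simp
      ultimately show ?thesis unfolding half_star_def by blast
    next
      case 3
      define n where "n = loc a b c (4/5) (1/5) - loc a b c (2/5) (1/10)"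
      define e where "e = - (1/2) *\<^sub>R (loc a b c 0 (1/2) - loc a b c (2/5) (1/10))"
      have "frame n (- e)" using rtri_frame[OF r(3)] by (simp add: e_def n_def)
      then have "frame e n" using frame_swap[OF frame_neg(2)[of n "- e"]] by simp
      moreover have "alphaQ False ?v e (- n) = pieceB a b c" "alphaQ False ?v e n = pieceC a b c"
        "betaQ False ?v e n = pieceD a b c" "betaQ False ?v (- e) n = pieceE a b c"
        unfolding alphaQ_False betaQ_False piece_defs 3
        by (rule arg_cong3[of _ _ _ _ _ _ triangle]; simp add: e_def n_def loc_def vec_eq_iff; simp add: field_simps)+
      then have "fan False ?v e n ?W" using sub by (simp add: fan_def)
      ultimately show ?thesis unfolding half_star_def by blast
    next
      case 4
      \<comment> \<open>M3 is the midpoint of the long leg of piece \<open>A\<close>, hence no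
        vertex of that piece.\<close>
      have "?v \<in> pieceA a b c" unfolding 4 loc_in_pieceA[OF t(1)] by simp
      moreover have "\<not> ?v extreme_point_of pieceA a b c"
        unfolding 4 pieceA_def extreme_triangle[OF r(1)] by (simp add: loc_eq_iff[OF t(1)])
      moreover have "pieceA a b c \<in> ?W" "tile (pieceA a b c)"
        using sub tile_triangle[OF r(1)] by (auto simp: pieceA_def)
      ultimately show ?thesis unfolding non_vertex_def by blast
    qed
  qed
qed


lemma half_star_fan: "frame e n \<Longrightarrow> fan h v e n W \<Longrightarrow> half_star W v"
  unfolding half_star_def by blast

text \<open>Either the point keeps avoiding the vertices of some tile, or a half star appears at
  some level; from then on it persists, since each step turns it into a fan and fans are half
  stars.\<close>

lemma subst_pow_vertex:
  assumes "tile t" "v \<in> t" "\<not> v extreme_point_of t"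
  shows "non_vertex ((pinwheel_subst ^^ n) {t}) (sqrt 5 ^ n *\<^sub>R v) \<or> half_star ((pinwheel_subst ^^ n) {t}) (sqrt 5 ^ n *\<^sub>R v)"
proof (induction n)
  case 0
  then show ?case using assms by (simp add: non_vertex_def)
next
  case (Suc n)
  then show ?case
    using non_vertex_subst[of "(pinwheel_subst ^^ n) {t}" "sqrt 5 ^ n *\<^sub>R v"]
      half_star_subst[of "(pinwheel_subst ^^ n) {t}" "sqrt 5 ^ n *\<^sub>R v"] half_star_fan by auto
qed

section \<open>Transfer from supertiles to tilings\<close>

lemma half_star_act:
  assumes g: "isometry g" and hs: "half_star W v" shows "half_star (act g W) (g v)"
proof -
  define L where "L x = g (v + x) - g v" for x
  have gL: "g (v + x) = g v + L x" for x by (simp add: L_def)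
  have "isometry (\<lambda>x. g (v + x) - g v)" using g by (simp add: isometry_def dist_norm)
  then have L: "orthogonal_transformation L"
    using isometry_linear_part[of L] by (simp add: L_def[abs_def])
  then have l: "L (x + y) = L x + L y" "L (r *\<^sub>R x) = r *\<^sub>R L x" "L (- x) = - L x" "L x \<bullet> L y = x \<bullet> y" for x y r
    by (simp_all add: orthogonal_transformation_def linear_add linear_scale linear_neg)
  have im: "g ` right v e n = right (g v) (L e) (L n)" "g ` alphaQ h v e n = alphaQ h (g v) (L e) (L n)"
    "g ` betaQ h v e n = betaQ h (g v) (L e) (L n)" for h e n
    by (simp_all add: right_def alphaQ_def betaQ_def alpha_def beta_def diag_def isometry_triangle[OF g] gL l)
  have fr: "frame (L e) (L n) \<longleftrightarrow> frame e n" for e n by (simp add: frame_def l)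
  have mem: "g ` t \<in> act g W \<longleftrightarrow> t \<in> W" for t
    by (auto simp: act_def inj_image_eq_iff[OF isometry_inj[OF g]])
  have fan: "fan h (g v) (L e) (L n) (act g W) \<longleftrightarrow> fan h v e n W" for h e n
    by (simp only: fan_def insert_subset l(3)[symmetric] im[symmetric] mem empty_subsetI)
  obtain e n where f: "frame e n" and c: "{right v e n, betaQ False v (- e) n, alphaQ False v (- e) n} \<subseteq> W \<or>
     {right v n e, right v n (- e)} \<subseteq> W \<or> (\<exists>h. fan h v e n W)"
    using hs unfolding half_star_def by blast
  have imm: "right (g v) (L e) (L n) \<in> act g W \<longleftrightarrow> right v e n \<in> W"
    "alphaQ h (g v) (L e) (L n) \<in> act g W \<longleftrightarrow> alphaQ h v e n \<in> W"
    "betaQ h (g v) (L e) (L n) \<in> act g W \<longleftrightarrow> betaQ h v e n \<in> W" for h e n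
    by (simp_all only: im[symmetric] mem)
  from c have "{right (g v) (L e) (L n), betaQ False (g v) (- L e) (L n), alphaQ False (g v) (- L e) (L n)} \<subseteq> act g W \<or>
     {right (g v) (L n) (L e), right (g v) (L n) (- L e)} \<subseteq> act g W \<or> (\<exists>h. fan h (g v) (L e) (L n) (act g W))"
    by (simp only: insert_subset l(3)[symmetric] imm fan empty_subsetI)
  moreover have "frame (L e) (L n)" using f fr by simp
  ultimately show ?thesis unfolding half_star_def by (intro exI[of _ "L e"] exI[of _ "L n"] conjI)
qed

lemma vertex_mem: "v \<in> right v e n" "v \<in> alphaQ h v e n" "v \<in> betaQ h v e n"
  by (auto simp: right_def alphaQ_def betaQ_def alpha_def beta_def triangle_def hull_inc)

lemma half_star_local:
  assumes "half_star W v" shows "half_star {y \<in> W. v \<in> y} v"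
  using assms unfolding half_star_def fan_def insert_subset mem_Collect_eq by (simp add: vertex_mem)

lemma half_star_mono: "half_star V v \<Longrightarrow> V \<subseteq> W \<Longrightarrow> half_star W v"
  unfolding half_star_def fan_def by (meson subset_trans)

text \<open>A copy of the ball around the origin sits inside \<open>sqrt 5 ^ n\<close> times the
  tile \<open>t\<close>, so its centre comes from an interior point of \<open>t\<close>, which is no
  vertex at level 0. The pattern found at level \<open>n\<close> involves only tiles containing the
  centre, and these are shared with \<open>T\<close>.\<close>

lemma Omega_vertex:
  assumes "T \<in> Omega" shows "non_vertex T 0 \<or> half_star T 0"
proof -
  obtain f t n where f: "isometry f" "tile t" "ball (f 0) 1 \<subseteq> \<Union>((pinwheel_subst ^^ n) {t})"
    and loc: "\<forall>y. y \<inter> ball (f 0) 1 \<noteq> {} \<longrightarrow> (y \<in> (pinwheel_subst ^^ n) {t} \<longleftrightarrow> y \<in> act f T)"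
    using assms zero_less_one by (rule Omega_local[where p = 0 and r = 1])
  let ?S = "(pinwheel_subst ^^ n) {t}"
  have mem: "y \<in> act f T" if "y \<in> ?S" "f 0 \<in> y" for y
  proof -
    have "y \<inter> ball (f 0) 1 \<noteq> {}" using that(2) centre_in_ball[of "f 0" 1] zero_less_one by blast
    then show ?thesis using loc[rule_format, of y] that(1) by simp
  qed
  have "ball (f 0) 1 \<subseteq> (\<lambda>x. sqrt 5 ^ n *\<^sub>R x) ` t"
    using f(3) subst_pow_cover[OF patch_sing[OF f(2)], of n] by simp
  then have "f 0 \<in> interior ((\<lambda>x. sqrt 5 ^ n *\<^sub>R x) ` t)"
    using interior_maximal[OF _ open_ball] centre_in_ball[of "f 0" 1] zero_less_one by blast
  then obtain w where w: "w \<in> interior t" "f 0 = sqrt 5 ^ n *\<^sub>R w"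
    by (auto simp: interior_scale)
  have "non_vertex ?S (f 0) \<or> half_star ?S (f 0)"
    unfolding w(2) using w(1) extreme_point_not_in_interior[of w t] interior_subset[of t]
    by (intro subst_pow_vertex f) auto
  then show ?thesis
  proof
    assume "non_vertex ?S (f 0)"
    then obtain u where u: "u \<in> ?S" "tile u" "f 0 \<in> u" "\<not> f 0 extreme_point_of u"
      unfolding non_vertex_def by blast
    have "u \<in> act f T" using u(1,3) by (rule mem)
    then obtain x where x: "x \<in> T" "u = f ` x" by (auto simp: act_def)
    have xt: "tile x" using Omega_patch[OF assms] x(1) by (rule patch_tile)
    then obtain a b c where t: "rtri a b c" "x = triangle a b c" by (rule tileE)
    have "f 0 \<notin> {f a, f b, f c}"
      using u(4) extreme_triangle[of "f a" "f b" "f c"] t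
      by (simp add: x(2) isometry_triangle[OF f(1)] isometry_rtri[OF f(1)])
    then have "\<not> 0 extreme_point_of x" unfolding t(2) extreme_triangle[OF t(1)] by auto
    moreover have "0 \<in> x" using u(3) x(2) isometry_inj[OF f(1)] by (auto dest: injD)
    ultimately show ?thesis using x(1) xt unfolding non_vertex_def by blast
  next
    assume "half_star ?S (f 0)"
    then have "half_star (act f T) (f 0)"
      using half_star_mono[OF half_star_local] mem by blast
    then have "half_star (act (inv_into UNIV f) (act f T)) (inv_into UNIV f (f 0))"
      by (rule half_star_act[OF isometry_inv[OF f(1)]])
    moreover have "inv_into UNIV f \<circ> f = id" using isometry_inj[OF f(1)] by simp
    ultimately show ?thesis
      using isometry_inj[OF f(1)] by (simp add: act_comp) (simp add: act_def)
  qed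
qed

subsection \<open>Stars\<close>

definition star :: "bool \<Rightarrow> real^2 \<Rightarrow> real^2 \<Rightarrow> (real^2) set set" where
  "star h e n = (\<Union>e'\<in>{e, - e}. \<Union>n'\<in>{n, - n}. {alphaQ h 0 e' n', betaQ h 0 e' n'})"

lemma sqrt5_bounds: "2 \<le> sqrt 5" "sqrt 5 \<le> 3"
  using real_sqrt_le_mono[of 4 5] real_sqrt_le_mono[of 5 9] real_sqrt_abs[of 2] real_sqrt_abs[of 3] by simp_all

text \<open>The ray \<open>p = 2 * q\<close> has direction \<open>diag e n\<close>. The bound 1/2 is
  small enough for the crude estimates \<open>2 \<le> sqrt 5\<close> and
  \<open>sqrt 5 \<le> 3\<close> to give coordinates along the two sides at the origin with sum at
  most 1.\<close>

lemma quadrant_cover: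
  assumes "0 \<le> p" "p \<le> 1/2" "0 \<le> q" "q \<le> 1/2"
  shows "2 * q \<le> p \<Longrightarrow> p *\<^sub>R e + q *\<^sub>R n \<in> alphaQ h 0 e n"
    "p \<le> 2 * q \<Longrightarrow> p *\<^sub>R e + q *\<^sub>R n \<in> betaQ h 0 e n"
proof -
  have tri: "x \<in> triangle 0 b c" if "0 \<le> s" "0 \<le> t" "s + t \<le> 1" "x = s *\<^sub>R b + t *\<^sub>R c" for x b c s t
    unfolding triangle_iff using that by auto
  have sq: "sqrt 5 * y \<le> 3 * y" "y / sqrt 5 \<le> y / 2" if "0 \<le> y" for y
    using that sqrt5_bounds by (auto intro!: mult_right_mono divide_left_mono simp del: divide_le_eq_numeral1 le_divide_eq_numeral1)
  have d: "(sqrt 5 * y) *\<^sub>R diag e n = y *\<^sub>R (2 *\<^sub>R e + n)" "(y / sqrt 5) *\<^sub>R (sqrt 5 *\<^sub>R z) = y *\<^sub>R z" for y and z :: "real^2"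
    by (simp_all add: mult.commute[of _ y] flip: sqrt5_diag)
  show "p *\<^sub>R e + q *\<^sub>R n \<in> alphaQ h 0 e n" if c: "2 * q \<le> p"
  proof (cases h)
    case True
    have "alphaQ h 0 e n = triangle 0 (2 *\<^sub>R diag e n) (sqrt 5 *\<^sub>R e)"
      using True by (simp add: alphaQ_def alpha_def triangle_perm(2)[of _ _ 0] triangle_perm(1)[of _ 0])
    moreover have "p *\<^sub>R e + q *\<^sub>R n = (sqrt 5 * (q / 2)) *\<^sub>R (2 *\<^sub>R diag e n) + ((p - 2 * q) / sqrt 5) *\<^sub>R (sqrt 5 *\<^sub>R e)"
    proof -
      have "(sqrt 5 * (q / 2)) *\<^sub>R (2 *\<^sub>R diag e n) = (sqrt 5 * q) *\<^sub>R diag e n" by simp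
      then show ?thesis unfolding d by (simp only: d) (simp add: scaleR_right_distrib scaleR_left_diff_distrib)
    qed
    moreover have "sqrt 5 * (q / 2) + (p - 2 * q) / sqrt 5 \<le> 1"
    proof -
      have "sqrt 5 * (q / 2) + (p - 2 * q) / sqrt 5 \<le> 3 * (q / 2) + (p - 2 * q) / 2"
        by (intro add_mono sq) (use c assms in auto)
      also have "\<dots> \<le> 1" using c assms by (simp add: field_simps)
      finally show ?thesis .
    qed
    moreover have "0 \<le> sqrt 5 * (q / 2)" "0 \<le> (p - 2 * q) / sqrt 5" using c assms by simp_all
    ultimately show ?thesis using tri by metis
  next
    case False
    have "alphaQ h 0 e n = triangle 0 (2 *\<^sub>R e) (2 *\<^sub>R e + n)"
      using False by (simp add: alphaQ_False triangle_perm(2)[of _ _ 0] triangle_perm(1)[of _ 0])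
    moreover have "p *\<^sub>R e + q *\<^sub>R n = (p / 2 - q) *\<^sub>R (2 *\<^sub>R e) + q *\<^sub>R (2 *\<^sub>R e + n)"
      by (simp add: scaleR_right_distrib scaleR_left_diff_distrib)
    moreover have "0 \<le> p / 2 - q" "p / 2 - q + q \<le> 1" using c assms by simp_all
    ultimately show ?thesis using tri assms(3) by metis
  qed
  show "p *\<^sub>R e + q *\<^sub>R n \<in> betaQ h 0 e n" if c: "p \<le> 2 * q"
  proof (cases h)
    case True
    have "betaQ h 0 e n = triangle 0 (diag e n) (sqrt 5 *\<^sub>R n)"
      using True by (simp add: betaQ_def beta_def triangle_perm(1)[of _ 0])
    moreover have "p *\<^sub>R e + q *\<^sub>R n = (sqrt 5 * (p / 2)) *\<^sub>R diag e n + ((q - p / 2) / sqrt 5) *\<^sub>R (sqrt 5 *\<^sub>R n)"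
      unfolding d by (simp add: scaleR_right_distrib scaleR_left_diff_distrib)
    moreover have "sqrt 5 * (p / 2) + (q - p / 2) / sqrt 5 \<le> 1"
    proof -
      have "sqrt 5 * (p / 2) + (q - p / 2) / sqrt 5 \<le> 3 * (p / 2) + (q - p / 2) / 2"
        by (intro add_mono sq) (use c assms in auto)
      also have "\<dots> \<le> 1" using c assms by (simp add: field_simps)
      finally show ?thesis .
    qed
    moreover have "0 \<le> sqrt 5 * (p / 2)" "0 \<le> (q - p / 2) / sqrt 5" using c assms by simp_all
    ultimately show ?thesis using tri by metis
  next
    case False
    have "betaQ h 0 e n = triangle 0 n (2 *\<^sub>R e + n)"
      using False by (simp add: betaQ_False triangle_perm(1)[of _ 0])
    moreover have "p *\<^sub>R e + q *\<^sub>R n = (q - p / 2) *\<^sub>R n + (p / 2) *\<^sub>R (2 *\<^sub>R e + n)"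
      by (simp add: scaleR_right_distrib scaleR_left_diff_distrib)
    moreover have "0 \<le> p / 2" "0 \<le> q - p / 2" "q - p / 2 + p / 2 \<le> 1" using c assms by simp_all
    ultimately show ?thesis using tri by metis
  qed
qed

lemma frame_ball:
  assumes "frame e n" "x \<in> ball 0 (1/2)"
  obtains p q where "x = p *\<^sub>R e + q *\<^sub>R n" "\<bar>p\<bar> \<le> 1/2" "\<bar>q\<bar> \<le> 1/2" "p = x \<bullet> e" "q = x \<bullet> n"
proof -
  have "norm e = 1" "norm n = 1" using assms(1) by (auto simp: frame_def norm_eq_1)
  then have "\<bar>x \<bullet> e\<bar> \<le> 1/2" "\<bar>x \<bullet> n\<bar> \<le> 1/2"
    using Cauchy_Schwarz_ineq2[of x e] Cauchy_Schwarz_ineq2[of x n] assms(2) by auto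
  then show thesis using that frame_expand[OF assms(1)] by blast
qed

lemma star_cover:
  assumes "frame e n" shows "ball 0 (1/2) \<subseteq> \<Union>(star h e n)"
proof
  fix x :: "real^2" assume "x \<in> ball 0 (1/2)"
  with assms obtain p q where x: "x = p *\<^sub>R e + q *\<^sub>R n" "\<bar>p\<bar> \<le> 1/2" "\<bar>q\<bar> \<le> 1/2" by (rule frame_ball)
  define e' where "e' = (if 0 \<le> p then e else - e)"
  define n' where "n' = (if 0 \<le> q then n else - n)"
  have "x = \<bar>p\<bar> *\<^sub>R e' + \<bar>q\<bar> *\<^sub>R n'" by (simp add: x(1) e'_def n'_def)
  then have "x \<in> alphaQ h 0 e' n' \<union> betaQ h 0 e' n'"
    using quadrant_cover[of "\<bar>p\<bar>" "\<bar>q\<bar>" e' n' h] x(2,3) by (cases "2 * \<bar>q\<bar> \<le> \<bar>p\<bar>") auto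
  then show "x \<in> \<Union>(star h e n)" unfolding star_def e'_def n'_def by (auto split: if_splits)
qed

text \<open>The four tiles of a fan are half of the star, and \<open>uminus\<close> maps them to the
  other half. The normals of the half discs are \<open>e + 2 *\<^sub>R n\<close>, \<open>n\<close>
  and \<open>e\<close> in the three alternatives; the first half disc is bounded by the line in
  direction \<open>diag e (- n)\<close>.\<close>

lemma fan_cover:
  assumes "frame e n" "fan h 0 e n W"
  obtains Q m where "Q \<subseteq> W" "Q \<subseteq> star h e n" "m \<noteq> 0" "{x \<in> ball 0 (1/2). 0 < x \<bullet> m} \<subseteq> \<Union>Q"
    "star h e n \<subseteq> Q \<union> act uminus Q"
proof -
  have neg: "uminus ` alphaQ h 0 e n = alphaQ h 0 (- e) (- n)" "uminus ` betaQ h 0 e n = betaQ h 0 (- e) (- n)" for h e n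
  proof -
    have i: "isometry uminus" by (simp add: isometry_def dist_norm norm_minus_commute)
    have d: "diag (- e) (- n) = - diag e n" for e n by (simp add: diag_def scaleR_right_diff_distrib scaleR_right_distrib)
    show "uminus ` alphaQ h 0 e n = alphaQ h 0 (- e) (- n)" "uminus ` betaQ h 0 e n = betaQ h 0 (- e) (- n)"
      by (simp_all add: alphaQ_def betaQ_def alpha_def beta_def isometry_triangle[OF i] d)
  qed
  have nz: "e \<noteq> 0" "n \<noteq> 0" "e + 2 *\<^sub>R n \<noteq> 0"
  proof -
    show "e \<noteq> 0" "n \<noteq> 0" using assms(1) by (auto simp: frame_def)
    have "(e + 2 *\<^sub>R n) \<bullet> e = 1" using assms(1) by (simp add: frame_def inner_add_left inner_add_right inner_commute)
    then show "e + 2 *\<^sub>R n \<noteq> 0" by auto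
  qed
  have cov: "{x \<in> ball 0 (1/2). 0 < x \<bullet> m} \<subseteq> \<Union>Q"
    if ex: "\<And>p q. 0 < (p *\<^sub>R e + q *\<^sub>R n) \<bullet> m \<Longrightarrow> let e' = (if 0 \<le> p then e else - e); n' = (if 0 \<le> q then n else - n) in
      (2 * \<bar>q\<bar> \<le> \<bar>p\<bar> \<longrightarrow> alphaQ h 0 e' n' \<in> Q) \<and> (\<bar>p\<bar> \<le> 2 * \<bar>q\<bar> \<longrightarrow> betaQ h 0 e' n' \<in> Q)" for m Q
  proof
    fix x assume "x \<in> {x \<in> ball 0 (1/2). 0 < x \<bullet> m}"
    then have xb: "x \<in> ball 0 (1/2)" and xm: "0 < x \<bullet> m" by auto
    from assms(1) xb obtain p q where x: "x = p *\<^sub>R e + q *\<^sub>R n" "\<bar>p\<bar> \<le> 1/2" "\<bar>q\<bar> \<le> 1/2"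
      by (rule frame_ball)
    define e' where "e' = (if 0 \<le> p then e else - e)"
    define n' where "n' = (if 0 \<le> q then n else - n)"
    have "x = \<bar>p\<bar> *\<^sub>R e' + \<bar>q\<bar> *\<^sub>R n'" by (simp add: x(1) e'_def n'_def)
    then show "x \<in> \<Union>Q"
      using ex[of p q] xm quadrant_cover[of "\<bar>p\<bar>" "\<bar>q\<bar>" e' n' h] x
      unfolding e'_def[symmetric] n'_def[symmetric] Let_def
      by (cases "2 * \<bar>q\<bar> \<le> \<bar>p\<bar>") auto
  qed
  have fr: "e \<bullet> e = 1" "n \<bullet> n = 1" "e \<bullet> n = 0" "n \<bullet> e = 0" using assms(1) by (auto simp: frame_def inner_commute)
  from assms(2) consider
     (1) "{alphaQ h 0 e (- n), alphaQ h 0 e n, betaQ h 0 e n, betaQ h 0 (- e) n} \<subseteq> W"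
   | (2) "{alphaQ h 0 e n, betaQ h 0 e n, betaQ h 0 (- e) n, alphaQ h 0 (- e) n} \<subseteq> W"
   | (3) "{alphaQ h 0 e n, alphaQ h 0 e (- n), betaQ h 0 e n, betaQ h 0 e (- n)} \<subseteq> W"
    unfolding fan_def by blast
  then show thesis
  proof cases
    case 1
    show thesis
    proof (rule that[OF 1 _ nz(3)])
      show "{x \<in> ball 0 (1/2). 0 < x \<bullet> (e + 2 *\<^sub>R n)} \<subseteq> \<Union>{alphaQ h 0 e (- n), alphaQ h 0 e n, betaQ h 0 e n, betaQ h 0 (- e) n}"
        by (rule cov) (auto simp: fr inner_add_left inner_add_right Let_def)
    qed (auto simp: star_def act_def neg)
  next
    case 2
    show thesis
    proof (rule that[OF 2 _ nz(2)])
      show "{x \<in> ball 0 (1/2). 0 < x \<bullet> n} \<subseteq> \<Union>{alphaQ h 0 e n, betaQ h 0 e n, betaQ h 0 (- e) n, alphaQ h 0 (- e) n}"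
        by (rule cov) (auto simp: fr inner_add_left inner_add_right Let_def)
    qed (auto simp: star_def act_def neg)
  next
    case 3
    show thesis
    proof (rule that[OF 3 _ nz(1)])
      show "{x \<in> ball 0 (1/2). 0 < x \<bullet> e} \<subseteq> \<Union>{alphaQ h 0 e n, alphaQ h 0 e (- n), betaQ h 0 e n, betaQ h 0 e (- n)}"
        by (rule cov) (auto simp: fr inner_add_left inner_add_right Let_def)
    qed (auto simp: star_def act_def neg)
  qed
qed

lemma alphaQ_tri:
  assumes "frame e n"
  obtains a b where "rtri a b 0" "alphaQ h 0 e n = triangle a b 0"
    "a = (if h then 2 *\<^sub>R diag e n else 2 *\<^sub>R e)" "b = (if h then sqrt 5 *\<^sub>R e else sqrt 5 *\<^sub>R diag e n)"
proof (cases h)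
  case True
  show thesis
    by (rule that[of "2 *\<^sub>R diag e n" "sqrt 5 *\<^sub>R e"])
      (use True rtri_alpha[of "diag e n" e 0] diag_inner[OF assms] assms in \<open>simp_all add: alphaQ_def alpha_def frame_def\<close>)
next
  case False
  show thesis
    by (rule that[of "2 *\<^sub>R e" "sqrt 5 *\<^sub>R diag e n"])
      (use False rtri_alpha[of e "diag e n" 0] diag_inner[OF assms] assms in \<open>simp_all add: alphaQ_def alpha_def frame_def inner_commute\<close>)
qed

lemma betaQ_tri:
  assumes "frame e n"
  obtains a c where "rtri a 0 c" "betaQ h 0 e n = triangle a 0 c"
    "a = (if h then diag e n else n)" "c = (if h then sqrt 5 *\<^sub>R n else sqrt 5 *\<^sub>R diag e n)"
proof (cases h)
  case True
  show thesis
    by (rule that[of "diag e n" "sqrt 5 *\<^sub>R n"])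
      (use True rtri_beta[of "diag e n" n 0] diag_inner[OF assms] assms in \<open>simp_all add: betaQ_def beta_def frame_def\<close>)
next
  case False
  show thesis
    by (rule that[of n "sqrt 5 *\<^sub>R diag e n"])
      (use False rtri_beta[of n "diag e n" 0] diag_inner[OF assms] assms in \<open>simp_all add: betaQ_def beta_def frame_def inner_commute\<close>)
qed

lemma diag_eq: "diag e n = diag e' n' \<longleftrightarrow> 2 *\<^sub>R e + n = 2 *\<^sub>R e' + n'"
  by (simp add: diag_def)

lemma alphaQ_inj:
  assumes "frame e n" "frame e' n'" "alphaQ h 0 e n = alphaQ h 0 e' n'" shows "e = e' \<and> n = n'"
proof -
  obtain a b where 1: "rtri a b 0" "alphaQ h 0 e n = triangle a b 0"
    "a = (if h then 2 *\<^sub>R diag e n else 2 *\<^sub>R e)" "b = (if h then sqrt 5 *\<^sub>R e else sqrt 5 *\<^sub>R diag e n)"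
    using assms(1) by (rule alphaQ_tri)
  obtain a' b' where 2: "rtri a' b' 0" "alphaQ h 0 e' n' = triangle a' b' 0"
    "a' = (if h then 2 *\<^sub>R diag e' n' else 2 *\<^sub>R e')" "b' = (if h then sqrt 5 *\<^sub>R e' else sqrt 5 *\<^sub>R diag e' n')"
    using assms(2) by (rule alphaQ_tri)
  have "a = a'" "b = b'" using triangle_inj[OF 1(1) 2(1)] 1(2) 2(2) assms(3) by auto
  then show ?thesis using 1(3,4) 2(3,4) by (auto simp: diag_eq split: if_splits)
qed

lemma betaQ_inj:
  assumes "frame e n" "frame e' n'" "betaQ h 0 e n = betaQ h 0 e' n'" shows "e = e' \<and> n = n'"
proof -
  obtain a b where 1: "rtri a 0 b" "betaQ h 0 e n = triangle a 0 b"
    "a = (if h then diag e n else n)" "b = (if h then sqrt 5 *\<^sub>R n else sqrt 5 *\<^sub>R diag e n)"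
    using assms(1) by (rule betaQ_tri)
  obtain a' b' where 2: "rtri a' 0 b'" "betaQ h 0 e' n' = triangle a' 0 b'"
    "a' = (if h then diag e' n' else n')" "b' = (if h then sqrt 5 *\<^sub>R n' else sqrt 5 *\<^sub>R diag e' n')"
    using assms(2) by (rule betaQ_tri)
  have "a = a'" "b = b'" using triangle_inj[OF 1(1) 2(1)] 1(2) 2(2) assms(3) by auto
  then show ?thesis using 1(3,4) 2(3,4) by (auto simp: diag_eq split: if_splits)
qed

lemma alphaQ_neq_betaQ:
  assumes "frame e n" "frame e' n'" shows "alphaQ h 0 e n \<noteq> betaQ h' 0 e' n'"
proof
  assume eq: "alphaQ h 0 e n = betaQ h' 0 e' n'"
  obtain a b where 1: "rtri a b 0" "alphaQ h 0 e n = triangle a b 0" using assms(1) by (rule alphaQ_tri)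
  obtain a' b' where 2: "rtri a' 0 b'" "betaQ h' 0 e' n' = triangle a' 0 b'" using assms(2) by (rule betaQ_tri)
  have "b = 0" using triangle_inj[OF 1(1) 2(1)] 1(2) 2(2) eq by auto
  then show False using rtri_dist(3)[OF 1(1)] by simp
qed

lemma orth_Q:
  assumes "orthogonal_transformation g"
  shows "g ` alphaQ h 0 e n = alphaQ h 0 (g e) (g n)" "g ` betaQ h 0 e n = betaQ h 0 (g e) (g n)"
    "frame (g e) (g n) \<longleftrightarrow> frame e n"
proof -
  have l: "g (x + y) = g x + g y" "g (r *\<^sub>R x) = r *\<^sub>R g x" "g 0 = 0" "g x \<bullet> g y = x \<bullet> y" for x y r
    using assms by (simp_all add: orthogonal_transformation_def linear_add linear_scale linear_0)
  show "g ` alphaQ h 0 e n = alphaQ h 0 (g e) (g n)" "g ` betaQ h 0 e n = betaQ h 0 (g e) (g n)"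
    by (simp_all add: alphaQ_def betaQ_def alpha_def beta_def diag_def isometry_triangle[OF isometry_orth[OF assms]] l)
  show "frame (g e) (g n) \<longleftrightarrow> frame e n" by (simp add: frame_def l)
qed

text \<open>The origin ends the long leg of an \<open>alpha\<close> tile and the short leg of a
  \<open>beta\<close> tile, so \<open>g\<close> keeps the kind, and within a kind the vertices
  determine the frame. Hence one matched pair of tiles fixes \<open>g\<close> up to signs on the
  axes.\<close>

lemma star_rigid:
  assumes "frame e n" "orthogonal_transformation g" "s \<in> star h e n" "t \<in> star h e n" "g ` s = t"
  shows "g e \<in> {e, - e} \<and> g n \<in> {n, - n}"
proof -
  obtain e1 n1 where 1: "e1 \<in> {e, - e}" "n1 \<in> {n, - n}" "s = alphaQ h 0 e1 n1 \<or> s = betaQ h 0 e1 n1"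
    using assms(3) unfolding star_def by blast
  obtain e2 n2 where 2: "e2 \<in> {e, - e}" "n2 \<in> {n, - n}" "t = alphaQ h 0 e2 n2 \<or> t = betaQ h 0 e2 n2"
    using assms(4) unfolding star_def by blast
  have f: "frame e1 n1" "frame e2 n2" using 1(1,2) 2(1,2) assms(1) by (auto intro: frame_neg)
  have fg: "frame (g e1) (g n1)" using f(1) orth_Q(3)[OF assms(2)] by simp
  have "g e1 = e2 \<and> g n1 = n2"
    using 1(3) 2(3) assms(5) orth_Q(1,2)[OF assms(2)] alphaQ_inj[OF fg f(2)] betaQ_inj[OF fg f(2)]
      alphaQ_neq_betaQ[OF fg f(2)] alphaQ_neq_betaQ[OF f(2) fg] by metis
  moreover have "g (- x) = - g x" for x
    using assms(2) by (simp add: orthogonal_transformation_def linear_neg)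
  ultimately show ?thesis using 1(1,2) 2(1,2) by (auto simp: minus_equation_iff)
qed

lemma star_frames:
  assumes "frame e n" "t \<in> star h e n"
  obtains e' n' where "frame e' n'" "e' \<in> {e, - e}" "n' \<in> {n, - n}" "t = alphaQ h 0 e' n' \<or> t = betaQ h 0 e' n'"
proof -
  obtain e1 n1 where 1: "e1 \<in> {e, - e}" "n1 \<in> {n, - n}" "t = alphaQ h 0 e1 n1 \<or> t = betaQ h 0 e1 n1"
    using assms(2) unfolding star_def by blast
  then show thesis using that[of e1 n1] assms(1) frame_neg by auto
qed

lemma star_finite: "finite (star h e n)"
  by (simp add: star_def)

subsection \<open>Symmetries are involutions\<close>

lemma orth_inner: "orthogonal_transformation g \<Longrightarrow> g x \<bullet> g y = x \<bullet> y"
  by (simp add: orthogonal_transformation_def)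

text \<open>The half discs with normals \<open>m\<close> and \<open>g m\<close> meet in a nonempty
  open set \<open>U\<close>, because the normals are not opposite. Inside \<open>U\<close> some tile
  of \<open>Q\<close> overlaps the image of some tile of \<open>Q\<close>; both belong to
  \<open>T\<close>, so they coincide.\<close>

lemma half_disc_overlap:
  assumes "patch T" "orthogonal_transformation g" "act g T = T" "Q \<subseteq> T" "finite Q" "m \<noteq> 0" "0 < r"
    "{x \<in> ball 0 r. 0 < x \<bullet> m} \<subseteq> \<Union>Q" "g m \<noteq> - m"
  obtains s t where "s \<in> Q" "t \<in> Q" "g ` s = t"
proof -
  define H where "H = {x \<in> ball 0 r. 0 < x \<bullet> m}"
  define U where "U = H \<inter> {x. 0 < x \<bullet> g m}"
  have lin: "linear g" using assms(2) by (simp add: orthogonal_transformation_def)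
  have oH: "open {x. 0 < x \<bullet> v}" for v :: "real^2"
    using open_halfspace_gt[of 0 v] by (simp add: inner_commute)
  have "U = ball 0 r \<inter> {x. 0 < x \<bullet> m} \<inter> {x. 0 < x \<bullet> g m}" by (auto simp: U_def H_def)
  then have "open U" using oH by (simp add: open_Int)
  have ig: "m \<bullet> g m + m \<bullet> m \<noteq> 0"
  proof
    assume a: "m \<bullet> g m + m \<bullet> m = 0"
    have "(g m + m) \<bullet> (g m + m) = g m \<bullet> g m + 2 * (m \<bullet> g m) + m \<bullet> m"
      by (simp add: inner_add_left inner_add_right inner_commute)
    also have "\<dots> = 0" using a by (simp add: orth_inner[OF assms(2)])
    finally have "g m + m = 0" by simp
    then show False using assms(9) by (simp add: eq_neg_iff_add_eq_0)
  qed
  have "\<bar>m \<bullet> g m\<bar> \<le> norm m * norm (g m)" by (rule Cauchy_Schwarz_ineq2)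
  also have "\<dots> = m \<bullet> m" using assms(2) by (simp add: orthogonal_transformation_norm dot_square_norm power2_eq_square)
  finally have pos: "0 < m \<bullet> g m + m \<bullet> m" using ig by linarith
  \<comment> \<open>The sum of two nonzero vectors of equal length that are not opposite has
    positive inner product with both; scaled by \<open>d\<close> it lies in the ball.\<close>
  define w where "w = m + g m"
  have w: "0 < w \<bullet> m" "0 < w \<bullet> g m"
    using pos inner_commute[of "g m" m] by (simp_all add: w_def inner_add_left orth_inner[OF assms(2)])
  define d where "d = r / (2 * (norm w + 1))"
  have nw: "0 < norm w + 1" using norm_ge_zero[of w] by linarith
  have d: "0 < d" using assms(7) nw by (simp add: d_def)
  have "norm (d *\<^sub>R w) = r * (norm w / (2 * (norm w + 1)))" using assms(7) nw by (simp add: d_def)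
  also have "norm w < 2 * (norm w + 1)" using norm_ge_zero[of w] by argo
  then have "r * (norm w / (2 * (norm w + 1))) < r * 1"
    using nw assms(7) by (intro mult_strict_left_mono) (simp_all add: divide_less_eq_1_pos)
  finally have "d *\<^sub>R w \<in> U" using d w by (simp add: U_def H_def)
  then have ne: "U \<noteq> {}" by blast
  have Qt: "\<forall>t\<in>Q. tile t" using assms(1,4) patch_tile by blast
  have "U \<subseteq> \<Union>Q" using assms(8) by (auto simp: U_def H_def)
  then obtain t where t: "t \<in> Q" "U \<inter> interior t \<noteq> {}"
    using open_subset_Union_tiles[OF assms(5) Qt \<open>open U\<close> ne] by blast
  have "U \<subseteq> \<Union>(act g Q)"
  proof
    fix x assume x: "x \<in> U"
    obtain y where y: "x = g y" using orthogonal_transformation_surj[OF assms(2)] by (auto simp: surj_def)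
    have "norm y = norm x" unfolding y using assms(2) by (simp add: orthogonal_transformation_norm)
    then have "y \<in> {x \<in> ball 0 r. 0 < x \<bullet> m}"
      using x orth_inner[OF assms(2), of y m] by (simp add: U_def H_def y)
    then have "y \<in> \<Union>Q" by (rule subsetD[OF assms(8)])
    then show "x \<in> \<Union>(act g Q)" by (auto simp: act_def y)
  qed
  moreover have "\<forall>t\<in>act g Q. tile t" using Qt act_tiles[OF isometry_orth[OF assms(2)]] by blast
  moreover have "finite (act g Q)" using assms(5) by (simp add: act_def)
  moreover have "open (U \<inter> interior t)" using \<open>open U\<close> by auto
  ultimately obtain s where s: "s \<in> act g Q" "U \<inter> interior t \<inter> interior s \<noteq> {}"
    using open_subset_Union_tiles[of "act g Q" "U \<inter> interior t"] t(2) by blast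
  have "s \<in> T" using s(1) act_mono[OF assms(4), of g] assms(3) by blast
  then have "s = t" using patch_overlap[OF assms(1), of s t] t(1) assms(4) s(2) by blast
  then show thesis using that s(1) t(1) by (auto simp: act_def)
qed

lemma non_vertex_half_disc:
  assumes "non_vertex T 0"
  obtains u m r where "u \<in> T" "tile u" "m \<noteq> 0" "0 < r" "{x \<in> ball 0 r. 0 < x \<bullet> m} \<subseteq> u"
proof -
  obtain u where u: "u \<in> T" "tile u" "0 \<in> u" "\<not> 0 extreme_point_of u" using assms unfolding non_vertex_def by blast
  obtain a b c where t: "rtri a b c" "u = triangle a b c" using u(2) by (rule tileE)
  have nv: "0 \<noteq> a" "0 \<noteq> b" "0 \<noteq> c" using u(4) extreme_triangle[OF t(1)] t(2) by auto
  define U where "U = b - a"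
  define V where "V = c - a"
  have o: "U \<bullet> U = 1" "V \<bullet> V = 4" "U \<bullet> V = 0" "V \<bullet> U = 0" "norm U = 1" "norm V = 2"
    using t(1) rtri_dist[OF t(1)] by (auto simp: rtri_def U_def V_def inner_commute dist_norm norm_minus_commute)
  obtain s p where sp: "0 \<le> s" "0 \<le> p" "s + p \<le> 1" "0 = a + s *\<^sub>R U + p *\<^sub>R V"
    using u(3) unfolding t(2) triangle_iff U_def V_def by blast
  have x: "x = a + (s + x \<bullet> U) *\<^sub>R U + (p + x \<bullet> V / 4) *\<^sub>R V" for x
  proof -
    have "(0 - a) \<bullet> U = s" "(0 - a) \<bullet> V = 4 * p"
    proof -
      have "a + (s *\<^sub>R U + p *\<^sub>R V) = 0" using sp(4) by (simp add: add.assoc)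
      then have "0 - a = s *\<^sub>R U + p *\<^sub>R V" using minus_unique by auto
      then show "(0 - a) \<bullet> U = s" "(0 - a) \<bullet> V = 4 * p" by (simp_all only: inner_add_left inner_scaleR_left o)
    qed
    then have "(x - a) \<bullet> U = s + x \<bullet> U" "(x - a) \<bullet> V = 4 * p + x \<bullet> V" by (simp_all add: inner_diff_left)
    then show ?thesis using rtri_coord[OF t(1), of x] by (simp add: U_def V_def add_divide_distrib)
  qed
  have bd: "\<bar>x \<bullet> U\<bar> \<le> norm x" "\<bar>x \<bullet> V / 4\<bar> \<le> norm x" for x
    using Cauchy_Schwarz_ineq2[of x U] Cauchy_Schwarz_ineq2[of x V] norm_ge_zero[of x] by (auto simp: o)
  have mem: "x \<in> u" if "0 \<le> s + x \<bullet> U" "0 \<le> p + x \<bullet> V / 4" "s + x \<bullet> U + (p + x \<bullet> V / 4) \<le> 1" for x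
    unfolding t(2) triangle_iff using that x[of x] unfolding U_def V_def by blast
  have nz: "U \<noteq> 0" "V \<noteq> 0" using o by auto
  have vert: "\<not> (s = 0 \<and> p = 0)" "\<not> (s = 0 \<and> p = 1)" "\<not> (s = 1 \<and> p = 0)"
    using sp(4) nv by (auto simp: U_def V_def)
  \<comment> \<open>\<open>s = 0\<close> puts the origin on the long leg, with inward normal
    \<open>U\<close>; \<open>p = 0\<close> puts it on the short leg, with inward normal
    \<open>V\<close>.\<close>
  show thesis
  proof (cases "s = 0")
    case True
    then have p: "0 < p" "p < 1" using vert sp by auto
    have "{x \<in> ball 0 (min p (1 - p) / 2). 0 < x \<bullet> U} \<subseteq> u"
    proof safe
      fix x assume "x \<in> ball 0 (min p (1 - p) / 2)" "0 < x \<bullet> U"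
      then show "x \<in> u" using bd[of x] True by (intro mem) (auto simp: min_def split: if_splits)
    qed
    then show thesis using that[OF u(1,2) nz(1), of "min p (1 - p) / 2"] p by simp
  next
    case False
    then have s: "0 < s" using sp by simp
    show thesis
    proof (cases "p = 0")
      case True
      then have s1: "s < 1" using vert sp by auto
      have "{x \<in> ball 0 (min s (1 - s) / 2). 0 < x \<bullet> V} \<subseteq> u"
      proof safe
        fix x assume "x \<in> ball 0 (min s (1 - s) / 2)" "0 < x \<bullet> V"
        then show "x \<in> u" using bd[of x] True by (intro mem) (auto simp: min_def split: if_splits)
      qed
      then show thesis using that[OF u(1,2) nz(2), of "min s (1 - s) / 2"] s s1 by simp
    next
      case False
      then have p: "0 < p" using sp by simp
      \<comment> \<open>The inward normal of the hypotenuse: \<open>x \<bullet> m\<close> is the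
        decrease of \<open>s + p\<close> along \<open>x\<close>. The case includes points interior
        to the tile.\<close>
      define m where "m = - U - (1/4) *\<^sub>R V"
      have "m \<bullet> U = -1" by (simp add: m_def inner_diff_left o)
      then have "m \<noteq> 0" by auto
      moreover have "{x \<in> ball 0 (min s p). 0 < x \<bullet> m} \<subseteq> u"
      proof safe
        fix x assume "x \<in> ball 0 (min s p)" "0 < x \<bullet> m"
        then show "x \<in> u" using bd[of x] sp(3) by (intro mem) (auto simp: m_def inner_diff_right)
      qed
      ultimately show thesis using that[OF u(1,2), of m "min s p"] s p by simp
    qed
  qed
qed

lemma tile_rigid:
  assumes "tile u" "orthogonal_transformation g" "g ` u = u" shows "g = id"
proof -
  obtain a b c where t: "rtri a b c" "u = triangle a b c" using assms(1) by (rule tileE)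
  note i = isometry_orth[OF assms(2)]
  have "triangle (g a) (g b) (g c) = triangle a b c"
    using assms(3) by (simp add: t isometry_triangle[OF i])
  then have g: "g a = a" "g b = b" "g c = c"
    using triangle_inj[of "g a" "g b" "g c" a b c] isometry_rtri[OF i, of a b c] t(1) by blast+
  have "g x = x" for x
  proof -
    obtain s r where "x = a + s *\<^sub>R (b - a) + r *\<^sub>R (c - a)" using t(1) by (rule rtri_coordE)
    then show ?thesis using isometry_affine[OF i, of a s b r c] g by simp
  qed
  then show ?thesis by auto
qed

definition perp :: "real^2 \<Rightarrow> real^2" where "perp x = pt (- (x $ 2)) (x $ 1)"

lemma frame_perp: "e \<bullet> e = 1 \<Longrightarrow> frame e (perp e)"
  by (simp add: frame_def perp_def inner_vec_def sum_2)

lemma orth_frame_image: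
  assumes "frame e n" "orthogonal_transformation g" "g e \<in> {e, - e}" shows "g n \<in> {n, - n}"
proof -
  have "g n \<bullet> e = 0"
    using assms(1,3) orth_inner[OF assms(2), of n e] by (auto simp: frame_def inner_commute)
  then have n: "g n = (g n \<bullet> n) *\<^sub>R n" using frame_expand[OF assms(1), of "g n"] by simp
  have "g n \<bullet> g n = 1" using assms(1) by (simp add: orth_inner[OF assms(2)] frame_def)
  then have "(g n \<bullet> n) * (g n \<bullet> n) = 1"
    using assms(1) n by (metis frame_def inner_commute inner_scaleR_left)
  then have "g n \<bullet> n = 1 \<or> g n \<bullet> n = -1" by (simp add: square_eq_1_iff)
  then show ?thesis using n by auto
qed

lemma orth_frame_involution:
  assumes "frame e n" "orthogonal_transformation g" "g e \<in> {e, - e}" shows "g \<circ> g = id"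
proof -
  have lin: "linear g" using assms(2) by (simp add: orthogonal_transformation_def)
  have "g (g e) = e" "g (g n) = n"
    using assms(3) orth_frame_image[OF assms] by (auto simp: linear_neg[OF lin])
  then have gg: "g (g (p *\<^sub>R e + q *\<^sub>R n)) = p *\<^sub>R e + q *\<^sub>R n" for p q
    by (simp add: linear_add[OF lin] linear_scale[OF lin])
  have "g (g x) = x" for x using gg[of "x \<bullet> e" "x \<bullet> n"] unfolding frame_expand[OF assms(1), of x, symmetric] .
  then show ?thesis by auto
qed

lemma negated_vector_involution:
  fixes m :: "real^2"
  assumes "orthogonal_transformation g" "m \<noteq> 0" "g m = - m" shows "g \<circ> g = id"
proof -
  define e where "e = (1 / norm m) *\<^sub>R m"
  have f: "frame e (perp e)"
  proof (rule frame_perp)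
    show "e \<bullet> e = 1" using assms(2) by (simp add: e_def dot_square_norm power2_eq_square)
  qed
  have "g e = - e" using assms by (simp add: e_def orthogonal_transformation_def linear_scale)
  then show ?thesis using orth_frame_involution[OF f assms(1)] by blast
qed

lemma desubst_vertex_fan:
  assumes "T \<in> Omega" "\<not> non_vertex (desubst T) 0"
  obtains h e n where "frame e n" "fan h 0 e n T"
proof -
  have "half_star (desubst T) 0" using Omega_vertex[OF desubst_Omega[OF assms(1)]] assms(2) by blast
  from half_star_subst[OF this] show thesis using that subst_desubst[OF assms(1)] by auto
qed

lemma symmetry_involution:
  assumes "T \<in> Omega" "orthogonal_transformation g" "act g T = T" shows "g \<circ> g = id"
proof (cases "non_vertex (desubst T) 0")
  case True
  then obtain u m r where u: "u \<in> desubst T" "tile u" "m \<noteq> 0" "0 < r" "{x \<in> ball 0 r. 0 < x \<bullet> m} \<subseteq> u"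
    by (rule non_vertex_half_disc)
  show ?thesis
  proof (cases "g m = - m")
    case True
    then show ?thesis using negated_vector_involution assms(2) u(3) by blast
  next
    case False
    have "g ` u = u"
      using half_disc_overlap[OF Omega_patch[OF desubst_Omega[OF assms(1)]] assms(2) desubst_act[OF assms(2,3)],
        of "{u}" m r] u False by auto
    then show ?thesis using tile_rigid[OF u(2) assms(2)] by simp
  qed
next
  case False
  with assms(1) obtain h e n where f: "frame e n" "fan h 0 e n T" by (rule desubst_vertex_fan)
  then obtain Q m where Q: "Q \<subseteq> T" "Q \<subseteq> star h e n" "m \<noteq> 0" "{x \<in> ball 0 (1/2). 0 < x \<bullet> m} \<subseteq> \<Union>Q"
    by (rule fan_cover)
  show ?thesis
  proof (cases "g m = - m")
    case True
    then show ?thesis using negated_vector_involution assms(2) Q(3) by blast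
  next
    case False
    have "finite Q" using Q(2) star_finite finite_subset by blast
    then obtain s t where "s \<in> Q" "t \<in> Q" "g ` s = t"
      using half_disc_overlap[OF Omega_patch[OF assms(1)] assms(2,3) Q(1) _ Q(3) _ Q(4) False] by auto
    then have "g e \<in> {e, - e}" using star_rigid[OF f(1) assms(2)] Q(2) by blast
    then show ?thesis using orth_frame_involution[OF f(1) assms(2)] by blast
  qed
qed

section \<open>Groups of orthogonal involutions\<close>

lemma orth_of_frame:
  assumes "frame p q" shows "orthogonal_transformation (\<lambda>x :: real^2. (x $ 1) *\<^sub>R p + (x $ 2) *\<^sub>R q)"
  using isometry_linear_part[OF isometry_to_frame[OF assms, of 0]] by simp

lemma act_id: "act id T = T" "act (\<lambda>x. x) T = T"
  by (simp_all add: act_def)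

text \<open>Involutions closed under composition commute. An element \<open>r\<close> other than the
  identity and \<open>uminus\<close> is a reflection, and whatever commutes with it preserves its
  mirror line, spanned by \<open>p\<close>.\<close>

lemma common_axis:
  assumes G: "\<And>g. g \<in> G \<Longrightarrow> orthogonal_transformation g" "\<And>g h. g \<in> G \<Longrightarrow> h \<in> G \<Longrightarrow> g \<circ> h \<in> G"
    "\<And>g. g \<in> G \<Longrightarrow> g \<circ> g = id"
  obtains p :: "real^2" where "p \<bullet> p = 1" "\<And>g. g \<in> G \<Longrightarrow> g p \<in> {p, - p}"
proof (cases "\<forall>g\<in>G. g = id \<or> g = uminus")
  case True
  then show thesis using that[of "pt 1 0"] by (force simp: inner_vec_def sum_2)
next
  case False
  then obtain r where r: "r \<in> G" "r \<noteq> id" "r \<noteq> uminus" by blast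
  note ro = G(1)[OF r(1)]
  have rl: "linear r" using ro by (simp add: orthogonal_transformation_def)
  have rr: "r (r x) = x" for x using G(3)[OF r(1)] by (metis comp_apply id_apply)
  have "\<exists>x. r x \<noteq> - x" using r(3) by (metis ext)
  then obtain x where "r x \<noteq> - x" by blast
  define y where "y = x + r x"
  have "y \<noteq> 0" using \<open>r x \<noteq> - x\<close> by (metis add.inverse_unique y_def)
  have ry: "r y = y" by (simp add: y_def linear_add[OF rl] rr add.commute)
  define p where "p = (1 / norm y) *\<^sub>R y"
  have p: "p \<bullet> p = 1" using \<open>y \<noteq> 0\<close> by (simp add: p_def dot_square_norm power2_eq_square)
  have rp: "r p = p" by (simp add: p_def linear_scale[OF rl] ry)
  define q where "q = perp p"
  have f: "frame p q" unfolding q_def by (rule frame_perp[OF p])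
  have "r q \<in> {q, - q}" using orth_frame_image[OF f ro] rp by simp
  moreover have "r q \<noteq> q"
  proof
    assume rq: "r q = q"
    have "r x = x" for x
    proof -
      have "r ((x \<bullet> p) *\<^sub>R p + (x \<bullet> q) *\<^sub>R q) = (x \<bullet> p) *\<^sub>R p + (x \<bullet> q) *\<^sub>R q"
        by (simp add: linear_add[OF rl] linear_scale[OF rl] rp rq)
      then show ?thesis unfolding frame_expand[OF f, of x, symmetric] .
    qed
    then show False using r(2) by auto
  qed
  ultimately have rq: "r q = - q" by blast
  have "g p \<in> {p, - p}" if g: "g \<in> G" for g
  proof -
    have gg: "g (g z) = z" for z using G(3)[OF g] by (metis comp_apply id_apply)
    have "(g \<circ> r) \<circ> (g \<circ> r) = id" using G(2,3) g r(1) by blast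
    then have "g (r (g (r z))) = z" for z by (metis comp_apply id_apply)
    then have "r (g (r z)) = g z" for z by (metis gg)
    then have rg: "r (g p) = g p" using rp by metis
    have "g p \<bullet> q = r (g p) \<bullet> r q" by (simp add: orth_inner[OF ro])
    then have "g p \<bullet> q = 0" by (simp add: rg rq)
    then have gp: "g p = (g p \<bullet> p) *\<^sub>R p" using frame_expand[OF f, of "g p"] by simp
    have "g p \<bullet> g p = 1" using p by (simp add: orth_inner[OF G(1)[OF g]])
    then have "(g p \<bullet> p) * (g p \<bullet> p) = 1" using p gp by (metis inner_commute inner_scaleR_left)
    then have "g p \<bullet> p = 1 \<or> g p \<bullet> p = -1" by (simp add: square_eq_1_iff)
    then show ?thesis using gp by auto
  qed
  then show thesis using that p by blast
qed

lemma stabilizer_conjugate: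
  assumes "T \<in> Omega"
  shows "\<exists>k K. k \<in> carrier O2 \<and> subgroup K O2 \<and> K \<subseteq> H1 \<and>
            stabilizer O2 act T = (\<lambda>h. k \<otimes>\<^bsub>O2\<^esub> h \<otimes>\<^bsub>O2\<^esub> inv\<^bsub>O2\<^esub> k) ` K"
proof -
  interpret group O2 by (rule group_O2)
  have m: "g \<otimes>\<^bsub>O2\<^esub> h = g \<circ> h" "\<one>\<^bsub>O2\<^esub> = id" "g \<in> carrier O2 \<longleftrightarrow> orthogonal_transformation g" for g h
    by (auto simp: O2_def)
  define G where "G = stabilizer O2 act T"
  have Gi: "g \<in> G \<longleftrightarrow> orthogonal_transformation g \<and> act g T = T" for g
    by (simp add: G_def stabilizer_def m)
  have Gc: "g \<circ> h \<in> G" if "g \<in> G" "h \<in> G" for g h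
    using that by (simp add: Gi orthogonal_transformation_compose act_comp[symmetric])
  have Gs: "g \<circ> g = id" if "g \<in> G" for g
    using that symmetry_involution[OF assms] by (simp add: Gi)
  have G1: "id \<in> G" using one_closed by (simp add: Gi act_id m)
  obtain p where p: "p \<bullet> p = 1" "\<And>g. g \<in> G \<Longrightarrow> g p \<in> {p, - p}"
    using common_axis[of G] Gi Gc Gs by metis
  define q where "q = perp p"
  have f: "frame p q" unfolding q_def by (rule frame_perp[OF p(1)])
  \<comment> \<open>\<open>k\<close> carries the coordinate axes to the common axes \<open>p\<close>
    and \<open>q\<close> of the stabilizer, so conjugating back makes every symmetry a change of
    signs of the coordinates.\<close>
  define k where "k x = (x $ 1) *\<^sub>R p + (x $ 2) *\<^sub>R q" for x :: "real^2"
  have k: "k \<in> carrier O2" unfolding m k_def[abs_def] by (rule orth_of_frame[OF f])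
  define k' where "k' = inv\<^bsub>O2\<^esub> k"
  have k': "k' \<in> carrier O2" "k \<circ> k' = id" "k' \<circ> k = id"
    using k inv_closed r_inv l_inv unfolding k'_def m(1,2)[symmetric] by auto
  have kk: "k (k' x) = x" "k' (k x) = x" for x using k' by (metis comp_apply id_apply)+
  define K where "K = {h \<in> carrier O2. k \<circ> h \<circ> k' \<in> G}"
  have "K \<subseteq> H1"
  proof
    fix h assume "h \<in> K"
    then have g: "k \<circ> h \<circ> k' \<in> G" by (simp add: K_def)
    define g where "g = k \<circ> h \<circ> k'"
    have go: "orthogonal_transformation g" using g by (simp add: g_def Gi)
    then have gl: "linear g" by (simp add: orthogonal_transformation_def)
    have gp: "g p \<in> {p, - p}" by (rule p(2)) (simp only: g_def g)
    have gq: "g q \<in> {q, - q}" by (rule orth_frame_image[OF f go gp])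
    have h: "h x = k' (g (k x))" for x by (simp add: g_def kk)
    have gk: "g (k x) = (x $ 1) *\<^sub>R g p + (x $ 2) *\<^sub>R g q" for x
      by (simp add: k_def linear_add[OF gl] linear_scale[OF gl])
    have "g p = p \<and> g q = q \<Longrightarrow> h = id" "g p = p \<and> g q = - q \<Longrightarrow> h = refl_x"
      "g p = - p \<and> g q = q \<Longrightarrow> h = refl_y" "g p = - p \<and> g q = - q \<Longrightarrow> h = uminus"
    proof -
      have e: "k x = g (k y) \<Longrightarrow> h y = x" for x y by (metis h kk(2))
      show "g p = p \<and> g q = q \<Longrightarrow> h = id" "g p = p \<and> g q = - q \<Longrightarrow> h = refl_x"
        "g p = - p \<and> g q = q \<Longrightarrow> h = refl_y" "g p = - p \<and> g q = - q \<Longrightarrow> h = uminus"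
        by (rule ext, rule e, simp add: gk, simp add: k_def refl_x_def refl_y_def)+
    qed
    then show "h \<in> H1" using gp gq unfolding H1_eq by blast
  qed
  moreover have "subgroup K O2"
  proof (rule subgroup.intro)
    show "K \<subseteq> carrier O2" by (auto simp: K_def)
    show "\<one>\<^bsub>O2\<^esub> \<in> K" using k' G1 one_closed by (simp add: K_def m)
    fix x y assume x: "x \<in> K" and y: "y \<in> K"
    have "k \<circ> (x \<circ> y) \<circ> k' = (k \<circ> x \<circ> k') \<circ> (k \<circ> y \<circ> k')" by (auto simp: kk)
    then show "x \<otimes>\<^bsub>O2\<^esub> y \<in> K"
      using x y Gc m_closed[of x y] by (simp add: K_def m(1))
  next
    fix x assume x: "x \<in> K"
    have "(k \<circ> x \<circ> k') \<circ> (k \<circ> x \<circ> k') = id" using x Gs by (simp add: K_def)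
    then have "k (x (x (k' y))) = y" for y by (metis comp_apply id_apply kk(2))
    then have "x (x z) = z" for z by (metis kk)
    then have "x \<otimes>\<^bsub>O2\<^esub> x = \<one>\<^bsub>O2\<^esub>" by (auto simp: m)
    then have "inv\<^bsub>O2\<^esub> x = x" using x by (intro inv_equality) (auto simp: K_def)
    then show "inv\<^bsub>O2\<^esub> x \<in> K" using x by simp
  qed
  moreover have "G = (\<lambda>h. k \<otimes>\<^bsub>O2\<^esub> h \<otimes>\<^bsub>O2\<^esub> inv\<^bsub>O2\<^esub> k) ` K"
  proof
    show "G \<subseteq> (\<lambda>h. k \<otimes>\<^bsub>O2\<^esub> h \<otimes>\<^bsub>O2\<^esub> inv\<^bsub>O2\<^esub> k) ` K"
    proof
      fix g assume g: "g \<in> G"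
      then have "k' \<circ> g \<circ> k \<in> carrier O2" using k k' m_closed by (simp add: Gi m orthogonal_transformation_compose)
      moreover have "k \<circ> (k' \<circ> g \<circ> k) \<circ> k' = g" by (auto simp: kk)
      ultimately show "g \<in> (\<lambda>h. k \<otimes>\<^bsub>O2\<^esub> h \<otimes>\<^bsub>O2\<^esub> inv\<^bsub>O2\<^esub> k) ` K"
        using g unfolding k'_def[symmetric] m(1) by (intro image_eqI[of _ _ "k' \<circ> g \<circ> k"]) (simp_all add: K_def)
    qed
    show "(\<lambda>h. k \<otimes>\<^bsub>O2\<^esub> h \<otimes>\<^bsub>O2\<^esub> inv\<^bsub>O2\<^esub> k) ` K \<subseteq> G"
      unfolding k'_def[symmetric] m(1) by (auto simp: K_def)
  qed
  ultimately show ?thesis using k unfolding G_def by blast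
qed

subsection \<open>Tilings with full symmetry\<close>

text \<open>The four candidate vertex stars of a fully symmetric tiling: \<open>h\<close> says
  whether hypotenuses or legs lie on the coordinate axes, and \<open>b\<close> which coordinate axis
  borders the \<open>alpha\<close> corners.\<close>

definition seed :: "bool \<Rightarrow> bool \<Rightarrow> (real^2) set set" where
  "seed h b = (if b then star h (pt 1 0) (pt 0 1) else star h (pt 0 1) (pt 1 0))"

definition symmetric_tiling :: "(real^2) set set \<Rightarrow> bool" where
  "symmetric_tiling T \<longleftrightarrow> T \<in> Omega \<and> (\<forall>h\<in>H1. act h T = T)"

lemma orth_H1: "g \<in> H1 \<Longrightarrow> orthogonal_transformation g"
  using group.generate_incl[OF group_O2, of "{refl_x, refl_y}"] refl_O2 by (auto simp: H1_def O2_def)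

lemma refl_pt:
  "refl_x (pt a b) = pt a (- b)" "refl_y (pt a b) = pt (- a) b" "- pt a b = pt (- a) (- b)"
  by (simp_all add: refl_x_def refl_y_def vec_eq_iff forall_2)

lemma refl_eq_minus: "refl_x v = - v \<longleftrightarrow> v $ 1 = 0" "refl_y v = - v \<longleftrightarrow> v $ 2 = 0"
   "refl_x v = v \<longleftrightarrow> v $ 2 = 0" "refl_y v = v \<longleftrightarrow> v $ 1 = 0"
  by (auto simp: refl_x_def refl_y_def vec_eq_iff forall_2)

lemma frame_axes: "frame (pt 1 0) (pt 0 1)" "frame (pt 0 1) (pt 1 0)"
  by (simp_all add: frame_def inner_vec_def sum_2)

lemma star_neg: "star h (- e) n = star h e n" "star h e (- n) = star h e n"
  by (auto simp: star_def)

lemma star_axes: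
  assumes "frame e n" "e $ 1 = 0 \<or> e $ 2 = 0" shows "\<exists>b. star h e n = seed h b"
proof -
  have eq: "e$1 * e$1 + e$2 * e$2 = 1" "n$1 * n$1 + n$2 * n$2 = 1" "e$1 * n$1 + e$2 * n$2 = 0"
    using assms(1) by (auto simp: frame_def inner_vec_def sum_2)
  consider "e $ 1 = 0" "n $ 2 = 0" "e $ 2 = 1 \<or> e $ 2 = -1" "n $ 1 = 1 \<or> n $ 1 = -1"
    | "e $ 2 = 0" "n $ 1 = 0" "e $ 1 = 1 \<or> e $ 1 = -1" "n $ 2 = 1 \<or> n $ 2 = -1"
    using assms(2) eq by (auto simp: square_eq_1_iff)
  then show ?thesis
  proof cases
    case 1
    then have "e \<in> {pt 0 1, - pt 0 1}" "n \<in> {pt 1 0, - pt 1 0}" by (auto simp: vec_eq_iff forall_2)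
    then have "star h e n = seed h False" by (auto simp: seed_def star_neg)
    then show ?thesis ..
  next
    case 2
    then have "e \<in> {pt 1 0, - pt 1 0}" "n \<in> {pt 0 1, - pt 0 1}" by (auto simp: vec_eq_iff forall_2)
    then have "star h e n = seed h True" by (auto simp: seed_def star_neg)
    then show ?thesis ..
  qed
qed

lemma symmetric_desubst:
  assumes "symmetric_tiling T" shows "symmetric_tiling (desubst T)"
  using assms desubst_Omega desubst_act orth_H1 by (simp add: symmetric_tiling_def)

lemma refl_H1: "refl_x \<in> H1" "refl_y \<in> H1" "uminus \<in> H1"
  by (simp_all add: H1_eq)

text \<open>A nontrivial symmetry fixes no tile, so both reflections would have to negate the normal
  of the half disc, and then both of its coordinates vanish.\<close>

lemma symmetric_vertex:
  assumes "symmetric_tiling T" shows "\<not> non_vertex T 0"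
proof
  assume "non_vertex T 0"
  then obtain u m r where u: "u \<in> T" "tile u" "m \<noteq> 0" "0 < r" "{x \<in> ball 0 r. 0 < x \<bullet> m} \<subseteq> u"
    by (rule non_vertex_half_disc)
  have T: "T \<in> Omega" "\<And>h. h \<in> H1 \<Longrightarrow> act h T = T" using assms by (auto simp: symmetric_tiling_def)
  have "g m = - m" if "g \<in> H1" "g \<noteq> id" for g
  proof (rule ccontr)
    assume "g m \<noteq> - m"
    then have "g ` u = u"
      using half_disc_overlap[OF Omega_patch[OF T(1)] orth_H1[OF that(1)] T(2)[OF that(1)], of "{u}" m r] u by auto
    then show False using tile_rigid[OF u(2) orth_H1[OF that(1)]] that(2) by simp
  qed
  moreover have "refl_x \<noteq> id" "refl_y \<noteq> id"
    by (auto simp: fun_eq_iff refl_eq_minus intro!: exI[of _ "pt 1 1"])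
  ultimately have "refl_x m = - m" "refl_y m = - m" using refl_H1 by blast+
  then have "m $ 1 = 0" "m $ 2 = 0" by (simp_all only: refl_eq_minus)
  then have "m = 0" by (simp add: vec_eq_iff forall_2)
  with u(3) show False by simp
qed

lemma zero_mem_star: "t \<in> star h e n \<Longrightarrow> 0 \<in> t"
  using vertex_mem(2,3)[of 0] by (auto simp: star_def)

text \<open>The star fills a ball around the origin, so it accounts for all tiles of
  \<open>T\<close> that contain the origin.\<close>

lemma star_contains:
  assumes "patch T" "frame e n" "star h e n \<subseteq> T" "t \<in> T" "0 \<in> t" shows "t \<in> star h e n"
  using patch_meets_open[OF assms(1,4,3) open_ball star_cover[OF assms(2)]] assms(5)
  by (metis IntI centre_in_ball empty_iff half_gt_zero zero_less_one)

lemma symmetric_seed: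
  assumes "symmetric_tiling T" shows "\<exists>h b. seed h b \<subseteq> T"
proof -
  have T: "T \<in> Omega" "\<And>h. h \<in> H1 \<Longrightarrow> act h T = T" using assms by (auto simp: symmetric_tiling_def)
  from T(1) symmetric_vertex[OF symmetric_desubst[OF assms]] obtain h e n where f: "frame e n" "fan h 0 e n T"
    by (rule desubst_vertex_fan)
  then obtain Q m where Q: "Q \<subseteq> T" "star h e n \<subseteq> Q \<union> act uminus Q" by (rule fan_cover)
  then have s: "star h e n \<subseteq> T" using T(2)[OF refl_H1(3)] act_mono[OF Q(1), of uminus] by blast
  have a: "alphaQ h 0 e n \<in> star h e n" by (simp add: star_def)
  \<comment> \<open>The reflected tile contains the origin and so is again in the star; rigidity
    forces the reflection to preserve the axes of the star, which must therefore be the coordinate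
    axes.\<close>
  have "refl_x ` alphaQ h 0 e n \<in> act refl_x T" using a s by (auto simp: act_def)
  then have "refl_x ` alphaQ h 0 e n \<in> T" using T(2)[OF refl_H1(1)] by simp
  moreover have "refl_x 0 = 0" by (simp add: refl_eq_minus)
  then have "0 \<in> refl_x ` alphaQ h 0 e n" using vertex_mem(2) by (metis imageI)
  ultimately have "refl_x ` alphaQ h 0 e n \<in> star h e n"
    by (rule star_contains[OF Omega_patch[OF T(1)] f(1) s])
  then have "refl_x e \<in> {e, - e}" using star_rigid[OF f(1) orth_H1[OF refl_H1(1)] a] by blast
  then have "e $ 1 = 0 \<or> e $ 2 = 0" by (auto simp: refl_eq_minus)
  then show ?thesis using star_axes[OF f(1)] s by metis
qed

text \<open>Each tile of the star is a piece of a piece of itself: the flag is reversed twice while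
  the origin and the frame stay in place.\<close>

lemma star_subst2:
  assumes "frame e n" shows "star h e n \<subseteq> (pinwheel_subst ^^ 2) (star h e n)"
proof -
  have "t \<in> pinwheel_subst (pinwheel_subst (star h e n))" if t: "t \<in> star h e n" for t
  proof -
    from assms t obtain e' n' where f: "frame e' n'" and t': "t = alphaQ h 0 e' n' \<or> t = betaQ h 0 e' n'"
      by (rule star_frames)
    have "\<exists>s. s \<in> subdivide t \<and> t \<in> subdivide s"
      using t' subdivide_alphaQ[OF f, of h 0] subdivide_alphaQ[OF f, of "\<not> h" 0]
        subdivide_betaQ[OF f, of h 0] subdivide_betaQ[OF f, of "\<not> h" 0] by auto
    then show ?thesis using t subst_memI by blast
  qed
  then show ?thesis by (auto simp: numeral_2_eq_2)
qed

lemma seed_star: obtains e n where "frame e n" "\<And>h. seed h b = star h e n"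
  using frame_axes that by (cases b) (auto simp: seed_def)

lemma seed_unique:
  assumes "patch T" "seed h b \<subseteq> T" "seed h' b' \<subseteq> T" shows "seed h b = seed h' b'"
proof -
  obtain e n where 1: "frame e n" "\<And>h. seed h b = star h e n" using seed_star by blast
  obtain e' n' where 2: "frame e' n'" "\<And>h. seed h b' = star h e' n'" using seed_star by blast
  show ?thesis
    using star_contains[OF assms(1) 1(1), of h] star_contains[OF assms(1) 2(1), of h'] assms(2,3) zero_mem_star
    unfolding 1 2 by blast
qed

lemma subst2_desubst2:
  assumes "T \<in> Omega" shows "(pinwheel_subst ^^ 2) (desubst (desubst T)) = T"
  using subst_desubst[OF assms] subst_desubst[OF desubst_Omega[OF assms]] by (simp add: numeral_2_eq_2)

text \<open>The double desubstitution contains some seed; two substitutions reproduce that seed in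
  \<open>T\<close>, where only one seed fits, so it is the given one.\<close>

lemma seed_desubst2:
  assumes "symmetric_tiling T" "seed h b \<subseteq> T" shows "seed h b \<subseteq> desubst (desubst T)"
proof -
  have T: "T \<in> Omega" using assms(1) by (simp add: symmetric_tiling_def)
  obtain h' b' where s: "seed h' b' \<subseteq> desubst (desubst T)"
    using symmetric_seed[OF symmetric_desubst[OF symmetric_desubst[OF assms(1)]]] by blast
  obtain e n where 1: "frame e n" "\<And>h. seed h b' = star h e n" using seed_star by blast
  have "seed h' b' \<subseteq> (pinwheel_subst ^^ 2) (seed h' b')" unfolding 1 by (rule star_subst2[OF 1(1)])
  also have "\<dots> \<subseteq> (pinwheel_subst ^^ 2) (desubst (desubst T))" by (rule subst_pow_mono[OF s])
  also have "\<dots> = T" by (rule subst2_desubst2[OF T])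
  finally have "seed h b = seed h' b'" by (intro seed_unique[OF Omega_patch[OF T] assms(2)])
  with s show ?thesis by simp
qed

section \<open>The limit tilings generated by the seeds\<close>

definition limit_tiling :: "bool \<Rightarrow> bool \<Rightarrow> (real^2) set set" where
  "limit_tiling h b = (\<Union>k. (pinwheel_subst ^^ (2 * k)) (seed h b))"

lemma seed_pow_cover:
  assumes "patch (seed h b)" shows "ball 0 (5 ^ k / 2) \<subseteq> \<Union>((pinwheel_subst ^^ (2 * k)) (seed h b))"
proof
  fix x :: "real^2" assume x: "x \<in> ball 0 (5 ^ k / 2)"
  obtain e n where 1: "frame e n" "\<And>h. seed h b = star h e n" using seed_star by blast
  have s: "sqrt 5 ^ (2 * k) = 5 ^ k" by (simp add: power_mult)
  have "norm ((1 / 5 ^ k) *\<^sub>R x) < 1 / 2" using x by (simp add: field_simps)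
  then have "(1 / 5 ^ k) *\<^sub>R x \<in> ball 0 (1 / 2)" by simp
  then have "(1 / 5 ^ k) *\<^sub>R x \<in> \<Union>(seed h b)" using star_cover[OF 1(1), of h] unfolding 1 by blast
  then have "5 ^ k *\<^sub>R ((1 / 5 ^ k) *\<^sub>R x) \<in> (\<lambda>x. 5 ^ k *\<^sub>R x) ` \<Union>(seed h b)" by (rule imageI)
  then show "x \<in> \<Union>((pinwheel_subst ^^ (2 * k)) (seed h b))"
    unfolding subst_pow_cover[OF assms] s by simp
qed

lemma ball5: obtains k :: nat where "(x :: real^2) \<in> ball 0 (5 ^ k / 2)"
proof -
  obtain k where "2 * norm x < 5 ^ k" using real_arch_pow[of 5 "2 * norm x"] by auto
  then show thesis using that[of k] by simp
qed

lemma symmetric_eq_limit: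
  assumes "symmetric_tiling T" "seed h b \<subseteq> T" shows "T = limit_tiling h b"
proof -
  have T: "T \<in> Omega" using assms(1) by (simp add: symmetric_tiling_def)
  have ps: "patch (seed h b)" using patch_subset[OF Omega_patch[OF T] assms(2)] .
  have sub: "(pinwheel_subst ^^ (2 * k)) (seed h b) \<subseteq> T" for k
    using assms
  \<comment> \<open>\<open>T\<close> is arbitrary because the hypothesis is applied to the double
    desubstitution, which contains the same seed.\<close>
  proof (induction k arbitrary: T)
    case (Suc k)
    have TO: "T \<in> Omega" using Suc.prems(1) by (simp add: symmetric_tiling_def)
    have "(pinwheel_subst ^^ (2 * k)) (seed h b) \<subseteq> desubst (desubst T)"
      using Suc by (intro Suc.IH symmetric_desubst seed_desubst2)
    then have "(pinwheel_subst ^^ 2) ((pinwheel_subst ^^ (2 * k)) (seed h b)) \<subseteq> (pinwheel_subst ^^ 2) (desubst (desubst T))"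
      by (rule subst_pow_mono)
    then show ?case using subst2_desubst2[OF TO] by (simp add: numeral_2_eq_2)
  qed simp
  have "t \<in> limit_tiling h b" if t: "t \<in> T" for t
  proof -
    obtain x where x: "x \<in> t" using tile_interior_nonempty[OF patch_tile[OF Omega_patch[OF T] t]] interior_subset by blast
    obtain k where "x \<in> ball 0 (5 ^ k / 2)" by (rule ball5)
    then have "t \<in> (pinwheel_subst ^^ (2 * k)) (seed h b)"
      using patch_meets_open[OF Omega_patch[OF T] t sub open_ball seed_pow_cover[OF ps]] x by blast
    then show ?thesis by (auto simp: limit_tiling_def)
  qed
  then show ?thesis using sub by (auto simp: limit_tiling_def)
qed

text \<open>\<open>T\<close> and its double desubstitution contain the same seed and are therefore
  the same limit tiling; substituting twice gives back \<open>T\<close>.\<close>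

lemma symmetric_fixed:
  assumes "symmetric_tiling T" shows "(pinwheel_subst ^^ 2) T = T"
proof -
  obtain h b where s: "seed h b \<subseteq> T" using symmetric_seed[OF assms] by blast
  have "T = limit_tiling h b" using symmetric_eq_limit[OF assms s] .
  also have "\<dots> = desubst (desubst T)"
    using symmetric_eq_limit[OF symmetric_desubst[OF symmetric_desubst[OF assms]] seed_desubst2[OF assms s]] by simp
  finally show ?thesis using subst2_desubst2[of T] assms by (simp add: symmetric_tiling_def)
qed

section \<open>Occurrence of the stars in supertiles\<close>

lemma rhombus_half:
  assumes "frame u w" "triangle z (z + u) (z + 2 *\<^sub>R w) \<in> W"
  shows "right (5 *\<^sub>R z + 8 *\<^sub>R w) u w \<in> (pinwheel_subst ^^ 2) W" "right (5 *\<^sub>R z + 8 *\<^sub>R w) u (- w) \<in> (pinwheel_subst ^^ 2) W"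
proof -
  note r = frame_rtri[OF assms(1), of z]
  \<comment> \<open>These are the vertices of piece \<open>E\<close>, whose hypotenuse lies on the
    dilated long leg. The point M1 of its own subdivision is three fifths of the way from
    \<open>b\<close> to \<open>c\<close>, which after the second dilation is
    \<open>5 *\<^sub>R z + 8 *\<^sub>R w\<close>; there the pieces \<open>D\<close> and
    \<open>E\<close> have their right angles, both on the same side of the leg.\<close>
  define a where "a = loc z (z + u) (z + 2 *\<^sub>R w) (2/5) (3/5)"
  define b where "b = loc z (z + u) (z + 2 *\<^sub>R w) 0 (1/2)"
  define c where "c = loc z (z + u) (z + 2 *\<^sub>R w) 0 1"
  have rE: "rtri a b c" unfolding a_def b_def c_def by (rule rtri_pieces(5)[OF r])
  have "triangle a b c \<in> subdivide (triangle z (z + u) (z + 2 *\<^sub>R w))"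
    unfolding subdivide_triangle[OF r] pieceE_def a_def b_def c_def by simp
  then have E: "triangle a b c \<in> pinwheel_subst W" by (rule subst_memI[OF assms(2)])
  define p where "p = z + (2/5) *\<^sub>R u + (6/5) *\<^sub>R w"
  define q where "q = - (2/5) *\<^sub>R u - (1/5) *\<^sub>R w"
  define r where "r = - (2/5) *\<^sub>R u + (4/5) *\<^sub>R w"
  have "a = sqrt 5 *\<^sub>R p" "b = sqrt 5 *\<^sub>R (p + q)" "c = sqrt 5 *\<^sub>R (p + r)"
    unfolding a_def b_def c_def loc_def
    by (rule arg_cong[of _ _ "(*\<^sub>R) (sqrt 5)"], simp add: vec_eq_iff p_def q_def r_def field_simps)+
  then have l: "loc a b c x y = 5 *\<^sub>R (p + x *\<^sub>R q + y *\<^sub>R r)" for x y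
    by (simp add: loc_def scaleR_right_distrib mult.commute mult.left_commute)
  have D: "pieceD a b c = right (5 *\<^sub>R z + 8 *\<^sub>R w) u (- w)" "pieceE a b c = right (5 *\<^sub>R z + 8 *\<^sub>R w) u w"
    unfolding pieceD_def pieceE_def right_def l
    by (rule arg_cong3[of _ _ _ _ _ _ triangle]; simp add: vec_eq_iff p_def q_def r_def field_simps)+
  have "pieceD a b c \<in> pinwheel_subst (pinwheel_subst W)" "pieceE a b c \<in> pinwheel_subst (pinwheel_subst W)"
    by (rule subst_memI[OF E], simp add: subdivide_triangle[OF rE])+
  then show "right (5 *\<^sub>R z + 8 *\<^sub>R w) u w \<in> (pinwheel_subst ^^ 2) W" "right (5 *\<^sub>R z + 8 *\<^sub>R w) u (- w) \<in> (pinwheel_subst ^^ 2) W"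
    by (simp_all add: D numeral_2_eq_2)
qed

text \<open>Pieces \<open>B\<close> and \<open>C\<close> of a subdivided tile are mirror images in a common long leg. Two steps later this
  leg carries a vertex with four right angles, symmetric about the leg and its normal.\<close>

lemma rhombus_exists:
  obtains t v e n where "tile t" "frame e n"
    "\<forall>e'\<in>{e, - e}. \<forall>n'\<in>{n, - n}. right v e' n' \<in> (pinwheel_subst ^^ 3) {t}"
proof -
  have r: "rtri (pt 0 0) (pt 1 0) (pt 0 2)" by (simp add: rtri_def inner_vec_def sum_2)
  define t where "t = triangle (pt 0 0) (pt 1 0) (pt 0 2)"
  let ?l = "loc (pt 0 0) (pt 1 0) (pt 0 2)"
  define z where "z = ?l (2/5) (1/10)"
  define e where "e = ?l (4/5) (1/5) - z"
  define n where "n = (1/2) *\<^sub>R (?l 0 (1/2) - z)"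
  have f: "frame e n" unfolding e_def n_def z_def by (rule rtri_frame[OF rtri_pieces(3)[OF r]])
  have "triangle z (z + e) (z + 2 *\<^sub>R n) = pieceC (pt 0 0) (pt 1 0) (pt 0 2)"
    by (simp add: e_def n_def z_def pieceC_def)
  moreover have "triangle z (z + (- e)) (z + 2 *\<^sub>R n) = pieceB (pt 0 0) (pt 1 0) (pt 0 2)"
    unfolding pieceB_def
    by (rule arg_cong3[of _ _ _ _ _ _ triangle]; simp add: e_def n_def z_def; simp add: loc_def vec_eq_iff; simp add: field_simps)
  ultimately have "triangle z (z + e) (z + 2 *\<^sub>R n) \<in> pinwheel_subst {t}"
    "triangle z (z + (- e)) (z + 2 *\<^sub>R n) \<in> pinwheel_subst {t}"
    by (simp_all add: pinwheel_subst_def t_def subdivide_triangle[OF r])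
  from rhombus_half[OF f this(1)] rhombus_half[OF frame_neg(1)[OF f] this(2)]
  have "\<forall>e'\<in>{e, - e}. \<forall>n'\<in>{n, - n}. right (5 *\<^sub>R z + 8 *\<^sub>R n) e' n' \<in> (pinwheel_subst ^^ 3) {t}"
    by (simp add: numeral_2_eq_2 numeral_3_eq_3)
  moreover have "tile t" unfolding t_def by (rule tile_triangle[OF r])
  ultimately show thesis using f by (intro that)
qed

lemma frame_image_Q:
  assumes "frame (L x) (L y)" "linear L" "isometry (\<lambda>x. v + L x)"
  shows "(\<lambda>x. v + L x) ` alphaQ h 0 x y = alphaQ h v (L x) (L y)" "(\<lambda>x. v + L x) ` betaQ h 0 x y = betaQ h v (L x) (L y)"
  by (simp_all add: alphaQ_def betaQ_def alpha_def beta_def diag_def isometry_triangle[OF assms(3)]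
      linear_add[OF assms(2)] linear_scale[OF assms(2)] linear_0[OF assms(2)])

lemma star_legal:
  obtains t v e n k where "tile t" "frame e n"
    "\<forall>e'\<in>{e, - e}. \<forall>n'\<in>{n, - n}. alphaQ h v e' n' \<in> (pinwheel_subst ^^ k) {t} \<and> betaQ h v e' n' \<in> (pinwheel_subst ^^ k) {t}"
proof -
  obtain t v e n where t: "tile t" "frame e n"
    and rh: "\<forall>e'\<in>{e, - e}. \<forall>n'\<in>{n, - n}. right v e' n' \<in> (pinwheel_subst ^^ 3) {t}"
    by (rule rhombus_exists)
  have fr: "frame e' n'" if "e' \<in> {e, - e}" "n' \<in> {n, - n}" for e' n'
    using that t(2) frame_neg by auto
  have T: "alphaQ True (sqrt 5 *\<^sub>R v) e' n' \<in> (pinwheel_subst ^^ 4) {t}" "betaQ True (sqrt 5 *\<^sub>R v) e' n' \<in> (pinwheel_subst ^^ 4) {t}"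
    if "e' \<in> {e, - e}" "n' \<in> {n, - n}" for e' n'
    using subst_memI[OF rh[rule_format, OF that]] subdivide_right[OF fr[OF that]] by (simp_all add: eval_nat_numeral)
  define v' where "v' = sqrt 5 *\<^sub>R (sqrt 5 *\<^sub>R v)"
  have F: "alphaQ False v' e' n' \<in> (pinwheel_subst ^^ 5) {t}" "betaQ False v' e' n' \<in> (pinwheel_subst ^^ 5) {t}"
    if "e' \<in> {e, - e}" "n' \<in> {n, - n}" for e' n'
    using subst_memI[OF T(1)[OF that] subdivide_alphaQ[OF fr[OF that]]] subst_memI[OF T(2)[OF that] subdivide_betaQ[OF fr[OF that]]]
    unfolding v'_def by (simp_all add: eval_nat_numeral)
  show thesis
  proof (cases h)
    case True
    show thesis by (rule that[OF t, of "sqrt 5 *\<^sub>R v" 4]) (simp add: True T)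
  next
    case False
    show thesis by (rule that[OF t, of v' 5]) (simp add: False F)
  qed
qed

text \<open>Legality is up to isometry, so one star of each kind in a supertile serves both values
  of \<open>b\<close>: \<open>L\<close> sends the coordinate axes to the frame in one order or the
  other.\<close>

lemma seed_legal:
  obtains f t k where "isometry f" "tile t" "act f (seed h b) \<subseteq> (pinwheel_subst ^^ k) {t}"
proof -
  obtain t v e n k where t: "tile t" "frame e n"
    and m: "\<forall>e'\<in>{e, - e}. \<forall>n'\<in>{n, - n}. alphaQ h v e' n' \<in> (pinwheel_subst ^^ k) {t} \<and> betaQ h v e' n' \<in> (pinwheel_subst ^^ k) {t}"
    by (rule star_legal[of h])
  define L where "L x = (if b then (x $ 1) *\<^sub>R e + (x $ 2) *\<^sub>R n else (x $ 1) *\<^sub>R n + (x $ 2) *\<^sub>R e)" for x :: "real^2"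
  have L: "orthogonal_transformation L"
    using orth_of_frame[OF t(2)] orth_of_frame[OF frame_swap[OF t(2)]] by (cases b) (simp_all add: L_def[abs_def])
  then have lin: "linear L" by (simp add: orthogonal_transformation_def)
  have i: "isometry (\<lambda>x. v + L x)" using isometry_orth[OF L] by (simp add: isometry_def)
  define x where "x = (if b then pt 1 0 else pt 0 1)"
  define y where "y = (if b then pt 0 1 else pt 1 0)"
  have xy: "L x = e" "L y = n" "L (- x) = - e" "L (- y) = - n" "seed h b = star h x y"
    by (simp_all add: L_def x_def y_def seed_def)
  have "act (\<lambda>x. v + L x) (seed h b) \<subseteq> (pinwheel_subst ^^ k) {t}"
  proof
    fix p assume "p \<in> act (\<lambda>x. v + L x) (seed h b)"
    then obtain e' n' where *: "e' \<in> {x, - x}" "n' \<in> {y, - y}"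
       "p = (\<lambda>x. v + L x) ` alphaQ h 0 e' n' \<or> p = (\<lambda>x. v + L x) ` betaQ h 0 e' n'"
      unfolding xy(5) star_def act_def by blast
    have 1: "L e' \<in> {e, - e}" "L n' \<in> {n, - n}" using *(1,2) xy by auto
    then have "frame (L e') (L n')" using t(2) frame_neg by auto
    from *(3) show "p \<in> (pinwheel_subst ^^ k) {t}"
      unfolding frame_image_Q[OF \<open>frame (L e') (L n')\<close> lin i] using m 1 by blast
  qed
  then show thesis using that i t(1) by blast
qed

text \<open>Disjointness of the eight tiles is inherited from a supertile that contains a copy of
  them.\<close>

lemma seed_patch: "patch (seed h b)"
proof -
  obtain f t k where f: "isometry f" "tile t" "act f (seed h b) \<subseteq> (pinwheel_subst ^^ k) {t}" by (rule seed_legal)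
  have "patch (act f (seed h b))" using patch_subset[OF patch_subst_pow[OF patch_sing[OF f(2)]] f(3)] .
  then show ?thesis by (simp add: patch_act[OF f(1)])
qed

text \<open>A general isometry does not commute with the dilation, so it is replaced by a rescaled
  one at every step.\<close>

lemma subst_pow_act:
  assumes "isometry f" "patch W"
  shows "\<exists>f'. isometry f' \<and> act f' ((pinwheel_subst ^^ k) W) = (pinwheel_subst ^^ k) (act f W)"
proof (induction k)
  case 0
  then show ?case using assms(1) by auto
next
  case (Suc k)
  then obtain f' where f': "isometry f'" "act f' ((pinwheel_subst ^^ k) W) = (pinwheel_subst ^^ k) (act f W)" by blast
  define g where "g x = sqrt 5 *\<^sub>R f' ((1 / sqrt 5) *\<^sub>R x)" for x
  have g: "isometry g" unfolding g_def using isometry_rescale[OF f'(1), of "sqrt 5"] by simp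
  have "shrink g = f'" by (simp add: shrink_def[abs_def] g_def)
  moreover have "\<forall>t\<in>(pinwheel_subst ^^ k) W. tile t" using patch_subst_pow[OF assms(2)] by (simp add: patch_def)
  ultimately have "act g ((pinwheel_subst ^^ Suc k) W) = (pinwheel_subst ^^ Suc k) (act f W)"
    using subst_act[OF g, of "(pinwheel_subst ^^ k) W"] f'(2) by simp
  then show ?case using g by blast
qed

section \<open>Legality and symmetry of the limit tilings\<close>

lemma seed_pow_mono:
  assumes "j \<le> k" shows "(pinwheel_subst ^^ (2 * j)) (seed h b) \<subseteq> (pinwheel_subst ^^ (2 * k)) (seed h b)"
  using assms
proof (induction rule: dec_induct)
  case (step m)
  obtain e n where 1: "frame e n" "\<And>h. seed h b = star h e n" using seed_star by blast
  have "(pinwheel_subst ^^ (2 * m)) (seed h b) \<subseteq> (pinwheel_subst ^^ (2 * m)) ((pinwheel_subst ^^ 2) (seed h b))"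
    unfolding 1 by (rule subst_pow_mono[OF star_subst2[OF 1(1)]])
  also have "\<dots> = (pinwheel_subst ^^ (2 * Suc m)) (seed h b)"
    using funpow_add[of "2 * m" 2 pinwheel_subst] by simp
  finally show ?case using step by blast
qed simp

lemma limit_finite_subset:
  assumes "finite Q" "Q \<subseteq> limit_tiling h b" shows "\<exists>k. Q \<subseteq> (pinwheel_subst ^^ (2 * k)) (seed h b)"
  using assms
proof (induction rule: finite_induct)
  case (insert q Q)
  then obtain k where k: "Q \<subseteq> (pinwheel_subst ^^ (2 * k)) (seed h b)" by blast
  obtain j where j: "q \<in> (pinwheel_subst ^^ (2 * j)) (seed h b)" using insert by (auto simp: limit_tiling_def)
  have "insert q Q \<subseteq> (pinwheel_subst ^^ (2 * max j k)) (seed h b)"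
    using k j seed_pow_mono[of k "max j k" h b] seed_pow_mono[of j "max j k" h b] by auto
  then show ?case by blast
qed simp

text \<open>A finite set of tiles lies in one stage of the increasing union, and stage
  \<open>k\<close> of a seed found in a supertile of order \<open>m\<close> embeds into a supertile
  of order \<open>2 * k + m\<close>.\<close>

lemma limit_Omega: "limit_tiling h b \<in> Omega"
proof -
  have ps: "patch ((pinwheel_subst ^^ (2 * k)) (seed h b))" for k by (rule patch_subst_pow[OF seed_patch])
  have "patch {p, q}" if "p \<in> limit_tiling h b" "q \<in> limit_tiling h b" for p q
    using limit_finite_subset[of "{p, q}"] that patch_subset[OF ps] by blast
  then have "patch (limit_tiling h b)" unfolding patch_def by blast
  moreover have "x \<in> \<Union>(limit_tiling h b)" for x
  proof -
    obtain k where "x \<in> ball 0 (5 ^ k / 2)" by (rule ball5)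
    then have "x \<in> \<Union>((pinwheel_subst ^^ (2 * k)) (seed h b))" using seed_pow_cover[OF seed_patch] by blast
    then obtain p where p: "p \<in> (pinwheel_subst ^^ (2 * k)) (seed h b)" "x \<in> p" by blast
    then have "p \<in> limit_tiling h b" by (auto simp: limit_tiling_def)
    with p(2) show ?thesis by blast
  qed
  then have "\<Union>(limit_tiling h b) = UNIV" by blast
  moreover have "\<exists>f t n. isometry f \<and> tile t \<and> act f Q \<subseteq> (pinwheel_subst ^^ n) {t}"
    if Q: "finite Q \<and> Q \<subseteq> limit_tiling h b" for Q
  proof -
    obtain k where k: "Q \<subseteq> (pinwheel_subst ^^ (2 * k)) (seed h b)" using limit_finite_subset Q by blast
    obtain f t m where f: "isometry f" "tile t" "act f (seed h b) \<subseteq> (pinwheel_subst ^^ m) {t}" by (rule seed_legal)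
    obtain f' where f': "isometry f'" "act f' ((pinwheel_subst ^^ (2 * k)) (seed h b)) = (pinwheel_subst ^^ (2 * k)) (act f (seed h b))"
      using subst_pow_act[OF f(1) seed_patch] by blast
    have "act f' Q \<subseteq> (pinwheel_subst ^^ (2 * k)) (act f (seed h b))"
      using act_mono[OF k, of f'] f'(2) by simp
    also have "\<dots> \<subseteq> (pinwheel_subst ^^ (2 * k)) ((pinwheel_subst ^^ m) {t})" by (rule subst_pow_mono[OF f(3)])
    also have "\<dots> = (pinwheel_subst ^^ (2 * k + m)) {t}" by (simp add: funpow_add)
    finally show ?thesis using f'(1) f(2) by blast
  qed
  ultimately show ?thesis by (simp add: Omega_def tiling_iff)
qed

lemma act_star:
  assumes "orthogonal_transformation g" shows "act g (star h e n) = star h (g e) (g n)"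
proof -
  have "g (- x) = - g x" for x using assms by (simp add: orthogonal_transformation_def linear_neg)
  then show ?thesis by (simp add: star_def act_def image_UN orth_Q[OF assms])
qed

lemma act_seed:
  assumes "g \<in> H1" shows "act g (seed h b) = seed h b"
proof -
  have g: "g (pt 1 0) \<in> {pt 1 0, - pt 1 0}" "g (pt 0 1) \<in> {pt 0 1, - pt 0 1}"
    using assms by (auto simp: H1_eq refl_pt)
  then show ?thesis by (auto simp: seed_def act_star[OF orth_H1[OF assms]] star_neg)
qed

lemma symmetric_limit: "symmetric_tiling (limit_tiling h b)"
proof -
  have "act g (limit_tiling h b) = limit_tiling h b" if g: "g \<in> H1" for g
  proof -
    have "act g (limit_tiling h b) = (\<Union>k. act g ((pinwheel_subst ^^ (2 * k)) (seed h b)))"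
      unfolding act_def limit_tiling_def by (rule image_UN)
    then show ?thesis
      by (simp add: subst_pow_act_orth[OF orth_H1[OF g] seed_patch, symmetric] act_seed[OF g] limit_tiling_def)
  qed
  then show ?thesis by (simp add: symmetric_tiling_def limit_Omega)
qed

lemma seed_limit: "seed h b \<subseteq> limit_tiling h b"
  unfolding limit_tiling_def by (rule subsetI, rule UN_I[of 0]) simp_all

section \<open>Distinctness and number of the limit tilings\<close>

lemma seed_inj:
  assumes "seed h b = seed h' b'" shows "h = h' \<and> b = b'"
proof -
  define e where "e b = (if b then pt 1 0 else pt 0 1)" for b
  define n where "n b = (if b then pt 0 1 else pt 1 0)" for b
  have s: "seed h b = star h (e b) (n b)" for h b by (simp add: seed_def e_def n_def)
  have f: "frame (e b) (n b)" for b by (simp add: e_def n_def frame_axes)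
  have "alphaQ h 0 (e b) (n b) \<in> star h (e b) (n b)" by (simp add: star_def)
  then have "alphaQ h 0 (e b) (n b) \<in> star h' (e b') (n b')" using assms by (simp only: s)
  with f[of b'] obtain e' n' where 1: "frame e' n'" "e' \<in> {e b', - e b'}" "n' \<in> {n b', - n b'}"
     "alphaQ h 0 (e b) (n b) = alphaQ h' 0 e' n' \<or> alphaQ h 0 (e b) (n b) = betaQ h' 0 e' n'"
    by (rule star_frames)
  then have eq: "alphaQ h 0 (e b) (n b) = alphaQ h' 0 e' n'" using alphaQ_neq_betaQ[OF f 1(1)] by blast
  \<comment> \<open>A direction \<open>diag\<close> has both coordinates nonzero and so never is a
    coordinate direction. If the flags differed, comparing the long legs of a common
    \<open>alpha\<close> tile would equate the two.\<close>
  have ax: "diag e1 n1 \<noteq> e2" if "e1 \<in> {e b1, - e b1}" "n1 \<in> {n b1, - n b1}" "e2 \<in> {e b2, - e b2}" for e1 n1 e2 b1 b2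
  proof
    assume "diag e1 n1 = e2"
    moreover have "diag e1 n1 $ 1 \<noteq> 0 \<and> diag e1 n1 $ 2 \<noteq> 0"
      using that(1,2) by (cases b1) (auto simp: diag_def e_def n_def)
    moreover have "e2 $ 1 = 0 \<or> e2 $ 2 = 0" using that(3) by (cases b2) (auto simp: e_def)
    ultimately show False by simp
  qed
  have h: "h = h'"
  proof (rule ccontr)
    assume "h \<noteq> h'"
    obtain p q where 2: "rtri p q 0" "alphaQ h 0 (e b) (n b) = triangle p q 0"
      "p = (if h then 2 *\<^sub>R diag (e b) (n b) else 2 *\<^sub>R e b)"
      "q = (if h then sqrt 5 *\<^sub>R e b else sqrt 5 *\<^sub>R diag (e b) (n b))"
      using f by (rule alphaQ_tri)
    obtain p' q' where 3: "rtri p' q' 0" "alphaQ h' 0 e' n' = triangle p' q' 0"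
      "p' = (if h' then 2 *\<^sub>R diag e' n' else 2 *\<^sub>R e')"
      "q' = (if h' then sqrt 5 *\<^sub>R e' else sqrt 5 *\<^sub>R diag e' n')"
      using 1(1) by (rule alphaQ_tri)
    have "p = p'" using triangle_inj(1)[OF 2(1) 3(1)] 2(2) 3(2) eq by simp
    then have "diag (e b) (n b) = e' \<or> diag e' n' = e b" using 2(3) 3(3) \<open>h \<noteq> h'\<close> by (auto split: if_splits)
    then show False using ax[of "e b" b "n b" e' b'] ax[of e' b' n' "e b" b] 1(2,3) by simp
  qed
  then have "e b = e'" using alphaQ_inj[OF f 1(1)] eq by simp
  then have "b = b'" using 1(2) by (auto simp: e_def vec_eq_iff forall_2 split: if_splits)
  with h show ?thesis by simp
qed

lemma symmetric_tilings: "{T \<in> Omega. \<forall>h\<in>H1. act h T = T} = (\<lambda>(h, b). limit_tiling h b) ` UNIV"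
proof -
  have "{T \<in> Omega. \<forall>h\<in>H1. act h T = T} = {T. symmetric_tiling T}" by (simp add: symmetric_tiling_def)
  also have "\<dots> = (\<lambda>(h, b). limit_tiling h b) ` UNIV"
  proof safe
    fix T assume "symmetric_tiling T"
    then obtain h b where "T = limit_tiling h b" using symmetric_seed symmetric_eq_limit by blast
    then show "T \<in> (\<lambda>(h, b). limit_tiling h b) ` UNIV" by (auto intro!: image_eqI[of _ _ "(h, b)"])
  next
    fix h b show "symmetric_tiling (limit_tiling h b)" by (rule symmetric_limit)
  qed
  finally show ?thesis .
qed

lemma card_symmetric_tilings: "card {T \<in> Omega. \<forall>h\<in>H1. act h T = T} = 4"
proof -
  have "h = h' \<and> b = b'" if eq: "limit_tiling h b = limit_tiling h' b'" for h b h' b'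
  proof (rule seed_inj, rule seed_unique[OF Omega_patch[OF limit_Omega] seed_limit])
    show "seed h' b' \<subseteq> limit_tiling h b" unfolding eq by (rule seed_limit)
  qed
  then have "inj (\<lambda>(h, b). limit_tiling h b)" by (auto simp: inj_def)
  then have "card ((\<lambda>(h, b). limit_tiling h b) ` UNIV) = card (UNIV :: (bool \<times> bool) set)"
    by (rule card_image)
  then show ?thesis unfolding symmetric_tilings by (simp add: card_UNIV_bool flip: UNIV_Times_UNIV)
qed

theorem mainTheorem4:
  shows "(\<forall>T\<in>Omega. \<exists>k K. k \<in> carrier O2 \<and> subgroup K O2 \<and> K \<subseteq> H1 \<and>
            stabilizer O2 act T = (\<lambda>h. k \<otimes>\<^bsub>O2\<^esub> h \<otimes>\<^bsub>O2\<^esub> inv\<^bsub>O2\<^esub> k) ` K) \<and>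
         card {T \<in> Omega. \<forall>h\<in>H1. act h T = T} = 4 \<and>
         (\<forall>T\<in>Omega. (\<forall>h\<in>H1. act h T = T) \<longrightarrow> (pinwheel_subst ^^ 2) T = T)"
  using stabilizer_conjugate card_symmetric_tilings symmetric_fixed unfolding symmetric_tiling_def by blast

end
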